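(* If $\xi$ is a countable ordinal and $(\mathfrak{P},\mathcal{P})$ is a probability block, then if $(\mathfrak{P},\mathcal{P})$ is $\xi$-sufficient, it is $\xi$-regulatory. If $\xi,\zeta$ are countable ordinals, $(\mathfrak{P},\mathcal{P})$ is a $\xi$-sufficient probability block, and $(\mathfrak{Q},\mathcal{Q})$ is a $\zeta$-sufficient probability block, then $(\mathfrak{Q}*\mathfrak{P},\mathcal{Q}[\mathcal{P}])$ is $(\xi+\zeta)$-sufficient.
   Context: Families of sets. $\mathbb{N}=\{1,2,\ldots\}$. For $M\subset\mathbb{N}$, $[M]$ (resp. $[M]^{<\mathbb{N}}$) is the set of infinite (resp. finite) subsets of $M$; sets are identified with their increasing enumerations. $E<F$ means $E=\varnothing$ or $F=\varnothing$ or $\max E<\min F$; $n\leqslant E$ means $n\leqslant\min E$ (true if $E=\varnothing$). For $M=\{m_1<m_2<\ldots\}$ and $\mathcal{F}\subset[\mathbb{N}]^{<\mathbb{N}}$, $\mathcal{F}(M)=\{\{m_n:n\in E\}:E\in\mathcal{F}\}$. A set $\{n_1<\ldots<n_r\}$ is a spread of $\{m_1<\ldots<m_r\}$ if $m_i\leqslant n_i$ for all $i$ ($\varnothing$ is a spread of $\varnothing$). $\mathcal{G}\subset[\mathbb{N}]^{<\mathbb{N}}$ is hereditary if closed under subsets, spreading if closed under spreads, compact if compact in the Cantor topology of $2^{\mathbb{N}}$, regular if it is all three. $MAX(\mathcal{G})$ is the set of members of $\mathcal{G}$ maximal under inclusion. $\mathcal{G}$ is nice if it is regular, $\{1\}\in\mathcal{G}$,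 and for every $\varnothing\neq E\in\mathcal{G}$ either $E\in MAX(\mathcal{G})$ or $E\cup\{1+\max E\}\in\mathcal{G}$. For a nice $\mathcal{F}$ and $M\in[\mathbb{N}]$, $M_{\mathcal{F},1}<M_{\mathcal{F},2}<\ldots$ is the unique partition of $M$ into successive members of $MAX(\mathcal{F})$; if $M=\{m_1<m_2<\ldots\}$, $M^{-1}_{\mathcal{F},n}$ is the set with $M_{\mathcal{F},n}=\{m_i:i\in M^{-1}_{\mathcal{F},n}\}$. For non-empty regular $\mathcal{F},\mathcal{G}$, $\mathcal{F}[\mathcal{G}]=\{\varnothing\}\cup\{\bigcup_{i=1}^nE_i:\varnothing\neq E_i\in\mathcal{G},\ E_1<\ldots<E_n,\ \{\min E_i:1\leqslant i\leqslant n\}\in\mathcal{F}\}$ (nice if $\mathcal{F},\mathcal{G}$ are nice). $CB(K)$ is the Cantor–Bendixson index: $K^0=K$, $K^{\alpha+1}$ is the set of non-isolated points of $K^\alpha$, intersections at limits, $CB(K)=\min\{\alpha:K^\alpha=\varnothing\}$. Schreier families: $\mathcal{S}_0=\{E:|E|\leqslant 1\}$; $\mathcal{S}_{\xi+1}=\{\varnothing\}\cup\{\bigcup_{i=1}^nE_i:\varnothing\neq E_i\in\mathcal{S}_\xi,\ n\leqslant E_1,\ E_1<\ldots<E_n\}$; for a limit ordinal $\xi<\omega_1$, $\mathcal{S}_\xi=\{E:\exists n\leqslant E\in\mathcal{S}_{\xi_n+1}\}$ for a fixed sequence $\xi_n\uparrow\xi$ with $\mathcal{S}_{\xi_n+1}\subset\mathcal{S}_{\xi_{n+1}}$.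 A hereditary family $\mathfrak{E}\subset[\mathbb{N}]^{<\mathbb{N}}$ is $\xi$-full if there is $M\in[\mathbb{N}]$ with $\mathcal{S}_\xi(M)\subset\mathfrak{E}$. Probability blocks. A probability measure $\mathbb{P}$ on $\mathbb{N}$ is treated as a function, $\mathbb{P}(n)=\mathbb{P}(\{n\})$, and $\mathrm{supp}(\mathbb{P})=\{n:\mathbb{P}(n)>0\}$. Given a nice family $\mathcal{P}$ and a family $\mathfrak{P}=\{\mathbb{P}_{M,n}:M\in[\mathbb{N}],n\in\mathbb{N}\}$ of probability measures on $\mathbb{N}$, $(\mathfrak{P},\mathcal{P})$ is a probability block if: (i) for $M\in[\mathbb{N}]$, $r\in\mathbb{N}$, if $N=M\setminus\bigcup_{i=1}^{r-1}\mathrm{supp}(\mathbb{P}_{M,i})$ then $\mathbb{P}_{N,1}=\mathbb{P}_{M,r}$; (ii) $\mathrm{supp}(\mathbb{P}_{M,1})=M_{\mathcal{P},1}$ for each $M\in[\mathbb{N}]$; (iii) if $M,N\in[\mathbb{N}]$ and $r_1<\ldots<r_s$ are such that $\bigcup_{i=1}^s\mathrm{supp}(\mathbb{P}_{M,r_i})$ is an initial segment of $N$, then $\mathbb{P}_{N,i}=\mathbb{P}_{M,r_i}$ for $1\leqslant i\leqslant s$. $(\mathfrak{P},\mathcal{P})$ is $\xi$-sufficient if for every $\varepsilon>0$, every regular $\mathcal{G}$ with $CB(\mathcal{G})\leqslant\omega^\xi$, and every $L\in[\mathbb{N}]$, there is $M\in[L]$ with $\mathbb{P}_{N,1}(E)\leqslant\varepsilon$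 for all $N\in[M]$, $E\in\mathcal{G}$. $(\mathfrak{P},\mathcal{P})$ is $\xi$-regulatory if for every bounded $f:\mathbb{N}\times MAX(\mathcal{P})\to\mathbb{R}$ and all reals $\delta<\varepsilon$: if there is $L\in[\mathbb{N}]$ such that $\sum_{i=1}^\infty\mathbb{P}_{M,1}(i)f(i,\mathrm{supp}(\mathbb{P}_{M,1}))\geqslant\varepsilon$ for every $M\in[L]$, then the family $\{E\in[L]^{<\mathbb{N}}:(\exists F\in MAX(\mathcal{P})\cap[L]^{<\mathbb{N}})(\forall i\in E)(f(i,F)\geqslant\delta)\}$ is $\xi$-full. Convolution. For probability blocks $(\mathfrak{P},\mathcal{P})$, $(\mathfrak{Q},\mathcal{Q})$ and $M\in[\mathbb{N}]$, let $l_n=\min\mathrm{supp}(\mathbb{P}_{M,n})$, $L=\{l_1<l_2<\ldots\}$, and $\mathbb{O}_{M,n}=\sum_{i\in L^{-1}_{\mathcal{Q},n}}\mathbb{Q}_{L,n}(l_i)\mathbb{P}_{M,i}$; then $\mathfrak{Q}*\mathfrak{P}=\{\mathbb{O}_{M,n}:M\in[\mathbb{N}],n\in\mathbb{N}\}$, and $(\mathfrak{Q}*\mathfrak{P},\mathcal{Q}[\mathcal{P}])$ is again a probability block. *)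

theory Defs
  imports "HOL-Probability.Probability"
begin

section \<open>Countable ordinals\<close>

text \<open>The countable ordinals are the elements of the first uncountable ordinal, represented by
  the cardinal successor of the order of the natural numbers. The lemmas below show that this is a
  well-order which is uncountable and all of whose proper initial segments are countable, which
  determines it up to isomorphism.\<close>

typedef omega1 = "Field (cardSuc natLeq)"
  using Field_cardSuc_not_empty[OF natLeq_Card_order] by blast

lemma Well_order_cardSuc_natLeq: "Well_order (cardSuc natLeq)"
  by (rule cardSuc_Well_order[OF natLeq_Card_order])

instantiation omega1 :: wellorder
begin

definition less_eq_omega1 :: "omega1 \<Rightarrow> omega1 \<Rightarrow> bool" where
  "x \<le> y \<longleftrightarrow> (Rep_omega1 x, Rep_omega1 y) \<in> cardSuc natLeq"

definition less_omega1 :: "omega1 \<Rightarrow> omega1 \<Rightarrow> bool" where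
  "x < y \<longleftrightarrow> x \<le> y \<and> x \<noteq> (y :: omega1)"

instance
proof
  let ?r = "cardSuc natLeq"
  have W: "wo_rel ?r"
    using Well_order_cardSuc_natLeq by (simp add: wo_rel_def)
  have F: "Rep_omega1 x \<in> Field ?r" for x
    by (rule Rep_omega1)
  show refl: "x \<le> x" for x :: omega1
    using wo_rel.REFL[OF W] F by (simp add: less_eq_omega1_def refl_on_def)
  show "x \<le> z" if "x \<le> y" "y \<le> z" for x y z :: omega1
    using wo_rel.TRANS[OF W] that unfolding less_eq_omega1_def by (rule transD)
  show antisym: "x = y" if "x \<le> y" "y \<le> x" for x y :: omega1
    using antisymD[OF wo_rel.ANTISYM[OF W]] that
    unfolding less_eq_omega1_def Rep_omega1_inject[symmetric] by blast
  show "x \<le> y \<or> y \<le> x" for x y :: omega1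
    using wo_rel.TOTALS[OF W] F unfolding less_eq_omega1_def by blast
  show "x < y \<longleftrightarrow> x \<le> y \<and> \<not> y \<le> x" for x y :: omega1
    using antisym[of x y] refl[of y] unfolding less_omega1_def by blast
  have "wf (inv_image (?r - Id) Rep_omega1)"
    using wo_rel.WF[OF W] by (rule wf_inv_image)
  moreover have "{(x, y). x < (y :: omega1)} = inv_image (?r - Id) Rep_omega1"
    by (auto simp: less_omega1_def less_eq_omega1_def Rep_omega1_inject)
  ultimately have wf: "wf {(x, y). x < (y :: omega1)}" by simp
  show "P a" if "\<And>x. (\<And>y. y < x \<Longrightarrow> P y) \<Longrightarrow> P x" for P and a :: omega1
    using wf by (rule wf_induct_rule) (use that in simp)
qed

end

lemma countable_lessThan_omega1:
  includes cardinal_syntax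
  shows "countable {..<\<alpha> :: omega1}"
proof -
  let ?r = "cardSuc natLeq"
  have C: "Card_order ?r" by (rule cardSuc_Card_order[OF natLeq_Card_order])
  have "|underS ?r (Rep_omega1 \<alpha>)| <o ?r"
    by (rule card_of_underS[OF C Rep_omega1])
  then have "|underS ?r (Rep_omega1 \<alpha>)| \<le>o natLeq"
    using cardSuc_ordLeq_ordLess[OF natLeq_Card_order card_of_Card_order] by blast
  from ordLeq_ordIso_trans[OF this ordIso_symmetric[OF card_of_nat]]
  have "|underS ?r (Rep_omega1 \<alpha>)| \<le>o |UNIV :: nat set|" .
  then have "countable (underS ?r (Rep_omega1 \<alpha>))"
    unfolding card_of_ordLeq[symmetric] by (auto intro: countableI)
  moreover have "Rep_omega1 ` {..<\<alpha>} \<subseteq> underS ?r (Rep_omega1 \<alpha>)"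
    by (auto simp: underS_def less_omega1_def less_eq_omega1_def Rep_omega1_inject)
  ultimately have "countable (Rep_omega1 ` {..<\<alpha>})"
    by (rule countable_subset[rotated])
  then show ?thesis
    by (rule countable_image_inj_on) (simp add: inj_on_def Rep_omega1_inject)
qed

lemma uncountable_omega1:
  includes cardinal_syntax
  shows "uncountable (UNIV :: omega1 set)"
proof
  let ?r = "cardSuc natLeq"
  assume "countable (UNIV :: omega1 set)"
  then have "countable (Rep_omega1 ` (UNIV :: omega1 set))" by simp
  then have "countable (Field ?r)"
    using type_definition.Rep_range[OF type_definition_omega1] by simp
  then have "|Field ?r| \<le>o |UNIV :: nat set|"
    unfolding card_of_ordLeq[symmetric] countable_def by auto
  from ordLeq_ordIso_trans[OF this card_of_nat] have "|Field ?r| \<le>o natLeq" .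
  from ordIso_ordLeq_trans[OF ordIso_symmetric[OF card_of_Field_ordIso] this]
  have "?r \<le>o natLeq"
    by (simp add: cardSuc_Card_order natLeq_Card_order)
  with not_ordLess_ordLeq[OF cardSuc_greater[OF natLeq_Card_order]] show False ..
qed

lemma countable_bounded_omega1:
  assumes "countable A"
  shows "\<exists>\<beta> :: omega1. \<forall>\<alpha>\<in>A. \<alpha> < \<beta>"
proof (rule ccontr)
  assume "\<not> ?thesis"
  then have *: "\<exists>\<alpha>\<in>A. \<beta> \<le> \<alpha>" for \<beta>
    by (simp add: not_less)
  have "(UNIV :: omega1 set) \<subseteq> (\<Union>\<alpha>\<in>A. insert \<alpha> {..<\<alpha>})"
  proof
    fix \<beta>
    obtain \<alpha> where "\<alpha> \<in> A" "\<beta> \<le> \<alpha>" using * by blast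
    then show "\<beta> \<in> (\<Union>\<alpha>\<in>A. insert \<alpha> {..<\<alpha>})"
      by (intro UN_I[of \<alpha>]) (simp_all add: order_le_less disj_commute)
  qed
  moreover have "countable (\<Union>\<alpha>\<in>A. insert \<alpha> {..<\<alpha>})"
    using assms countable_lessThan_omega1 by auto
  ultimately show False
    using uncountable_omega1 countable_subset by blast
qed

definition osucc :: "omega1 \<Rightarrow> omega1" where
  "osucc \<alpha> = (LEAST \<beta>. \<alpha> < \<beta>)"

lemma less_osucc_iff: "\<beta> < osucc \<alpha> \<longleftrightarrow> \<beta> \<le> \<alpha>"
proof -
  have ex: "\<exists>\<gamma>. \<alpha> < \<gamma>"
    using countable_bounded_omega1[of "{\<alpha>}"] by simp
  have "\<alpha> < osucc \<alpha>" unfolding osucc_def by (rule LeastI_ex[OF ex])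
  moreover have "\<beta> < osucc \<alpha> \<Longrightarrow> \<not> \<alpha> < \<beta>"
    unfolding osucc_def by (rule not_less_Least)
  ultimately show ?thesis by force
qed

lemma osucc_le_iff: "osucc \<alpha> \<le> \<beta> \<longleftrightarrow> \<alpha> < \<beta>"
  using less_osucc_iff[of \<beta> \<alpha>] by (simp flip: not_less)

lemma osucc_inject [simp]: "osucc \<alpha> = osucc \<beta> \<longleftrightarrow> \<alpha> = \<beta>"
  by (metis antisym less_osucc_iff order_refl)

instantiation omega1 :: "{zero, one}"
begin
definition zero_omega1 :: omega1 where "0 = (LEAST \<alpha> :: omega1. True)"
definition one_omega1 :: omega1 where "1 = osucc 0"
instance ..
end

lemma zero_le_omega1 [simp]: "(0 :: omega1) \<le> \<alpha>"
  unfolding zero_omega1_def by (rule Least_le) simp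

lemma not_less_zero_omega1 [simp]: "\<not> \<alpha> < (0 :: omega1)"
  by (simp add: not_less)

lemma osucc_neq_zero [simp]: "osucc \<alpha> \<noteq> 0"
  by (metis less_osucc_iff not_less_zero_omega1 order_refl)

definition limit_ord :: "omega1 \<Rightarrow> bool" where
  "limit_ord \<alpha> \<longleftrightarrow> \<alpha> \<noteq> 0 \<and> (\<forall>\<beta>. \<alpha> \<noteq> osucc \<beta>)"

lemma limit_ord_osucc_less:
  assumes "limit_ord \<alpha>" "\<beta> < \<alpha>" shows "osucc \<beta> < \<alpha>"
  using assms by (metis limit_ord_def order_less_le osucc_le_iff)

lemma Least_bound_omega1:
  fixes f :: "omega1 \<Rightarrow> omega1"
  shows "\<alpha> \<le> (LEAST \<gamma>. \<alpha> \<le> \<gamma> \<and> (\<forall>\<delta>\<in>{..<\<beta>}. f \<delta> < \<gamma>))"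
    and "\<delta> < \<beta> \<Longrightarrow> f \<delta> < (LEAST \<gamma>. \<alpha> \<le> \<gamma> \<and> (\<forall>\<delta>\<in>{..<\<beta>}. f \<delta> < \<gamma>))"
proof -
  obtain \<gamma> where "\<forall>x \<in> insert \<alpha> (f ` {..<\<beta>}). x < \<gamma>"
    using countable_bounded_omega1[of "insert \<alpha> (f ` {..<\<beta>})"] countable_lessThan_omega1
    by auto
  then have "\<alpha> \<le> \<gamma> \<and> (\<forall>\<delta>\<in>{..<\<beta>}. f \<delta> < \<gamma>)" by auto
  from LeastI[of "\<lambda>\<gamma>. \<alpha> \<le> \<gamma> \<and> (\<forall>\<delta>\<in>{..<\<beta>}. f \<delta> < \<gamma>)", OF this]
  show "\<alpha> \<le> (LEAST \<gamma>. \<alpha> \<le> \<gamma> \<and> (\<forall>\<delta>\<in>{..<\<beta>}. f \<delta> < \<gamma>))"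
    and "\<delta> < \<beta> \<Longrightarrow> f \<delta> < (LEAST \<gamma>. \<alpha> \<le> \<gamma> \<and> (\<forall>\<delta>\<in>{..<\<beta>}. f \<delta> < \<gamma>))"
    by auto
qed

lemma Least_bound_le_omega1:
  fixes f :: "omega1 \<Rightarrow> omega1"
  shows "\<alpha> \<le> (LEAST \<gamma>. \<alpha> \<le> \<gamma> \<and> (\<forall>\<delta>\<in>{..<\<beta>}. f \<delta> \<le> \<gamma>))"
    and "\<delta> < \<beta> \<Longrightarrow> f \<delta> \<le> (LEAST \<gamma>. \<alpha> \<le> \<gamma> \<and> (\<forall>\<delta>\<in>{..<\<beta>}. f \<delta> \<le> \<gamma>))"
proof -
  have "\<alpha> \<le> (LEAST \<gamma>. \<alpha> \<le> \<gamma> \<and> (\<forall>\<delta>\<in>{..<\<beta>}. f \<delta> < \<gamma>)) \<and>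
    (\<forall>\<delta>\<in>{..<\<beta>}. f \<delta> \<le> (LEAST \<gamma>. \<alpha> \<le> \<gamma> \<and> (\<forall>\<delta>\<in>{..<\<beta>}. f \<delta> < \<gamma>)))"
    using Least_bound_omega1[where \<alpha>=\<alpha> and \<beta>=\<beta> and f=f] by (auto intro: less_imp_le)
  from LeastI[of "\<lambda>\<gamma>. \<alpha> \<le> \<gamma> \<and> (\<forall>\<delta>\<in>{..<\<beta>}. f \<delta> \<le> \<gamma>)", OF this]
  show "\<alpha> \<le> (LEAST \<gamma>. \<alpha> \<le> \<gamma> \<and> (\<forall>\<delta>\<in>{..<\<beta>}. f \<delta> \<le> \<gamma>))"
    and "\<delta> < \<beta> \<Longrightarrow> f \<delta> \<le> (LEAST \<gamma>. \<alpha> \<le> \<gamma> \<and> (\<forall>\<delta>\<in>{..<\<beta>}. f \<delta> \<le> \<gamma>))"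
    by auto
qed

text \<open>Ordinal addition, multiplication and powers of \<open>\<omega>\<close>, each by a single transfinite recursion
  covering the zero, successor and limit cases; the usual three equations are derived after each
  definition.\<close>

function oadd :: "omega1 \<Rightarrow> omega1 \<Rightarrow> omega1" where
  "oadd \<alpha> \<beta> = (LEAST \<gamma>. \<alpha> \<le> \<gamma> \<and> (\<forall>\<delta>\<in>{..<\<beta>}. oadd \<alpha> \<delta> < \<gamma>))"
  by auto
termination
  by (relation "inv_image {(x, y). x < y} snd") (auto intro: wf_inv_image wf)

declare oadd.simps [simp del]

instantiation omega1 :: plus
begin
definition plus_omega1 :: "omega1 \<Rightarrow> omega1 \<Rightarrow> omega1" where "\<alpha> + \<beta> = oadd \<alpha> \<beta>"
instance ..
end

lemma plus_omega1_rec: "\<alpha> + \<beta> = (LEAST \<gamma> :: omega1. \<alpha> \<le> \<gamma> \<and> (\<forall>\<delta>\<in>{..<\<beta>}. \<alpha> + \<delta> < \<gamma>))"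
  unfolding plus_omega1_def by (rule oadd.simps)

lemma le_plus_omega1: "\<alpha> \<le> \<alpha> + (\<beta> :: omega1)"
  by (subst plus_omega1_rec) (rule Least_bound_omega1)

lemma plus_strict_mono_omega1: "\<delta> < \<beta> \<Longrightarrow> \<alpha> + \<delta> < \<alpha> + (\<beta> :: omega1)"
  by (subst (2) plus_omega1_rec) (rule Least_bound_omega1)

lemma plus_mono_omega1: "\<delta> \<le> \<beta> \<Longrightarrow> \<alpha> + \<delta> \<le> \<alpha> + (\<beta> :: omega1)"
  by (metis order_le_less plus_strict_mono_omega1)

lemma plus_zero_omega1: "\<alpha> + 0 = (\<alpha> :: omega1)"
  by (subst plus_omega1_rec) (auto intro: Least_equality)

lemma plus_osucc: "\<alpha> + osucc \<beta> = osucc (\<alpha> + \<beta>)"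
proof (rule antisym)
  show "osucc (\<alpha> + \<beta>) \<le> \<alpha> + osucc \<beta>"
    by (simp add: osucc_le_iff less_osucc_iff plus_strict_mono_omega1)
  have "\<alpha> \<le> osucc (\<alpha> + \<beta>)"
    using le_plus_omega1[of \<alpha> \<beta>] by (meson less_imp_le less_osucc_iff)
  moreover have "\<forall>\<delta>\<in>{..<osucc \<beta>}. \<alpha> + \<delta> < osucc (\<alpha> + \<beta>)"
    by (simp add: less_osucc_iff plus_mono_omega1)
  ultimately show "\<alpha> + osucc \<beta> \<le> osucc (\<alpha> + \<beta>)"
    unfolding plus_omega1_rec[of \<alpha> "osucc \<beta>"] by (intro Least_le conjI)
qed

lemma plus_limit:
  assumes "limit_ord \<beta>"
  shows "\<alpha> + \<beta> = (LEAST \<gamma>. \<forall>\<delta><\<beta>. \<alpha> + \<delta> \<le> \<gamma>)"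
proof (rule Least_equality[symmetric])
  show "\<forall>\<delta><\<beta>. \<alpha> + \<delta> \<le> \<alpha> + \<beta>" by (simp add: plus_mono_omega1)
  fix \<gamma> assume *: "\<forall>\<delta><\<beta>. \<alpha> + \<delta> \<le> \<gamma>"
  have "0 < \<beta>" using assms by (simp add: limit_ord_def order_less_le)
  then have "\<alpha> \<le> \<gamma>" using * plus_zero_omega1 by metis
  moreover have "\<alpha> + \<delta> < \<gamma>" if "\<delta> < \<beta>" for \<delta>
    using * limit_ord_osucc_less[OF assms that] by (metis osucc_le_iff plus_osucc)
  ultimately show "\<alpha> + \<beta> \<le> \<gamma>"
    by (subst plus_omega1_rec) (auto intro: Least_le)
qed

function omult :: "omega1 \<Rightarrow> omega1 \<Rightarrow> omega1" where
  "omult \<alpha> \<beta> = (LEAST \<gamma>. 0 \<le> \<gamma> \<and> (\<forall>\<delta>\<in>{..<\<beta>}. omult \<alpha> \<delta> + \<alpha> \<le> \<gamma>))"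
  by auto
termination
  by (relation "inv_image {(x, y). x < y} snd") (auto intro: wf_inv_image wf)

declare omult.simps [simp del]

instantiation omega1 :: times
begin
definition times_omega1 :: "omega1 \<Rightarrow> omega1 \<Rightarrow> omega1" where "\<alpha> * \<beta> = omult \<alpha> \<beta>"
instance ..
end

lemma times_omega1_rec:
  "\<alpha> * \<beta> = (LEAST \<gamma> :: omega1. 0 \<le> \<gamma> \<and> (\<forall>\<delta>\<in>{..<\<beta>}. \<alpha> * \<delta> + \<alpha> \<le> \<gamma>))"
  unfolding times_omega1_def by (rule omult.simps)

lemma times_step_omega1: "\<delta> < \<beta> \<Longrightarrow> \<alpha> * \<delta> + \<alpha> \<le> \<alpha> * (\<beta> :: omega1)"
  by (subst (2) times_omega1_rec) (rule Least_bound_le_omega1)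

lemma times_mono_omega1: "\<delta> \<le> \<beta> \<Longrightarrow> \<alpha> * \<delta> \<le> \<alpha> * (\<beta> :: omega1)"
  by (metis le_plus_omega1 order_le_less order_refl order_trans times_step_omega1)

lemma times_zero_omega1: "\<alpha> * 0 = (0 :: omega1)"
  by (subst times_omega1_rec) (auto intro: Least_equality)

lemma times_osucc: "\<alpha> * osucc \<beta> = \<alpha> * \<beta> + \<alpha>"
proof (rule antisym)
  show "\<alpha> * \<beta> + \<alpha> \<le> \<alpha> * osucc \<beta>" by (rule times_step_omega1) (simp add: less_osucc_iff)
  have "\<alpha> * \<delta> + \<alpha> \<le> \<alpha> * \<beta> + \<alpha>" if "\<delta> \<le> \<beta>" for \<delta>
  proof (cases "\<delta> = \<beta>")
    case False
    with that have "\<delta> < \<beta>" by simp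
    from order_trans[OF times_step_omega1[OF this] le_plus_omega1] show ?thesis .
  qed simp
  then show "\<alpha> * osucc \<beta> \<le> \<alpha> * \<beta> + \<alpha>"
    by (subst times_omega1_rec) (auto intro!: Least_le simp: less_osucc_iff)
qed

lemma times_limit:
  assumes "limit_ord \<beta>"
  shows "\<alpha> * \<beta> = (LEAST \<gamma>. \<forall>\<delta><\<beta>. \<alpha> * \<delta> \<le> \<gamma>)"
proof (rule Least_equality[symmetric])
  show "\<forall>\<delta><\<beta>. \<alpha> * \<delta> \<le> \<alpha> * \<beta>" by (simp add: times_mono_omega1)
  fix \<gamma> assume "\<forall>\<delta><\<beta>. \<alpha> * \<delta> \<le> \<gamma>"
  then have "\<alpha> * \<delta> + \<alpha> \<le> \<gamma>" if "\<delta> < \<beta>" for \<delta>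
    using limit_ord_osucc_less[OF assms that] by (simp flip: times_osucc)
  then show "\<alpha> * \<beta> \<le> \<gamma>"
    by (subst times_omega1_rec) (auto intro: Least_le)
qed

definition omega :: omega1 where
  "omega = (LEAST \<alpha>. limit_ord \<alpha>)"

lemma limit_ord_omega: "limit_ord omega"
proof -
  obtain \<gamma> where \<gamma>: "(osucc ^^ n) 0 < \<gamma>" for n
    using countable_bounded_omega1[of "range (\<lambda>n. (osucc ^^ n) 0)"] by auto
  define \<alpha> where "\<alpha> = (LEAST \<gamma>. \<forall>n. (osucc ^^ n) 0 < \<gamma>)"
  have \<alpha>: "(osucc ^^ n) 0 < \<alpha>" for n
    unfolding \<alpha>_def using LeastI[of "\<lambda>\<gamma>. \<forall>n. (osucc ^^ n) 0 < \<gamma>" \<gamma>] \<gamma> by blast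
  have "\<alpha> \<noteq> osucc \<beta>" for \<beta>
  proof
    assume *: "\<alpha> = osucc \<beta>"
    have "(osucc ^^ n) 0 < \<beta>" for n
      using \<alpha>[of "Suc n"] * by (simp add: less_osucc_iff osucc_le_iff)
    then have "\<alpha> \<le> \<beta>" unfolding \<alpha>_def by (simp add: Least_le)
    with * show False by (simp add: osucc_le_iff)
  qed
  moreover have "\<alpha> \<noteq> 0" using \<alpha>[of 0] by auto
  ultimately have "limit_ord \<alpha>" by (simp add: limit_ord_def)
  then show ?thesis unfolding omega_def by (rule LeastI)
qed

function omega_power :: "omega1 \<Rightarrow> omega1" where
  "omega_power \<beta> = (LEAST \<gamma>. 1 \<le> \<gamma> \<and> (\<forall>\<delta>\<in>{..<\<beta>}. omega_power \<delta> * omega \<le> \<gamma>))"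
  by auto
termination
  by (relation "{(x, y). x < y}") (auto intro: wf)

declare omega_power.simps [simp del]

lemma omega_power_zero: "omega_power 0 = 1"
  by (subst omega_power.simps) (auto intro: Least_equality)

lemma omega_power_pos: "1 \<le> omega_power \<beta>"
  by (subst omega_power.simps) (rule Least_bound_le_omega1)

lemma omega_power_step: "\<delta> < \<beta> \<Longrightarrow> omega_power \<delta> * omega \<le> omega_power \<beta>"
  by (subst (2) omega_power.simps) (rule Least_bound_le_omega1)

lemma le_times_omega: "\<alpha> \<le> \<alpha> * omega"
proof -
  have "0 + \<alpha> = \<alpha>"
  proof (induction \<alpha> rule: less_induct)
    case (less \<alpha>)
    show ?case
      by (subst plus_omega1_rec, rule Least_equality)
        (use less in \<open>auto simp flip: not_less\<close>)
  qed
  moreover have "0 < omega"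
    using limit_ord_omega by (simp add: limit_ord_def order_less_le)
  ultimately show ?thesis
    using times_step_omega1[of 0 omega \<alpha>] by (simp add: times_zero_omega1)
qed

lemma omega_power_mono: "\<delta> \<le> \<beta> \<Longrightarrow> omega_power \<delta> \<le> omega_power \<beta>"
  by (metis le_times_omega omega_power_step order_le_less order_refl order_trans)

lemma omega_power_osucc: "omega_power (osucc \<beta>) = omega_power \<beta> * omega"
proof (rule antisym)
  show "omega_power \<beta> * omega \<le> omega_power (osucc \<beta>)"
    by (rule omega_power_step) (simp add: less_osucc_iff)
  have "omega_power \<delta> * omega \<le> omega_power \<beta> * omega" if "\<delta> \<le> \<beta>" for \<delta>
  proof (cases "\<delta> = \<beta>")
    case False
    with that have "\<delta> < \<beta>" by simp
    from order_trans[OF omega_power_step[OF this] le_times_omega] show ?thesis .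
  qed simp
  moreover have "1 \<le> omega_power \<beta> * omega"
    using omega_power_pos le_times_omega order_trans by blast
  ultimately show "omega_power (osucc \<beta>) \<le> omega_power \<beta> * omega"
    by (subst omega_power.simps) (auto intro!: Least_le simp: less_osucc_iff)
qed

lemma omega_power_limit:
  assumes "limit_ord \<beta>"
  shows "omega_power \<beta> = (LEAST \<gamma>. \<forall>\<delta><\<beta>. omega_power \<delta> \<le> \<gamma>)"
proof (rule Least_equality[symmetric])
  show "\<forall>\<delta><\<beta>. omega_power \<delta> \<le> omega_power \<beta>" by (simp add: omega_power_mono)
  fix \<gamma> assume *: "\<forall>\<delta><\<beta>. omega_power \<delta> \<le> \<gamma>"
  have "0 < \<beta>" using assms by (simp add: limit_ord_def order_less_le)
  then have "1 \<le> \<gamma>" using * omega_power_zero by metis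
  moreover have "omega_power \<delta> * omega \<le> \<gamma>" if "\<delta> < \<beta>" for \<delta>
    using * limit_ord_osucc_less[OF assms that] by (simp flip: omega_power_osucc)
  ultimately show "omega_power \<beta> \<le> \<gamma>"
    by (subst omega_power.simps) (auto intro: Least_le)
qed


section \<open>Families of finite sets\<close>

text \<open>The set \<open>{1,2,\<dots>}\<close> is \<^term>\<open>{1..} :: nat set\<close>, and all sequences indexed by it are functions
  on \<^typ>\<open>nat\<close> whose value at \<open>0\<close> plays no role. The finite subsets of \<open>M\<close> form
  \<^term>\<open>Fpow M\<close>.\<close>

definition Ipow :: "nat set \<Rightarrow> nat set set" where
  "Ipow M = {N. N \<subseteq> M \<and> infinite N}"

definition elt :: "nat set \<Rightarrow> nat \<Rightarrow> nat" where
  "elt M n = enumerate M (n - 1)"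

definition before :: "nat set \<Rightarrow> nat set \<Rightarrow> bool" where
  "before E F \<longleftrightarrow> E = {} \<or> F = {} \<or> Max E < Min F"

definition below :: "nat \<Rightarrow> nat set \<Rightarrow> bool" where
  "below n E \<longleftrightarrow> E = {} \<or> n \<le> Min E"

definition transport :: "nat set set \<Rightarrow> nat set \<Rightarrow> nat set set" where
  "transport \<F> M = (\<lambda>E. elt M ` E) ` \<F>"

definition spread_of :: "nat set \<Rightarrow> nat set \<Rightarrow> bool" where
  "spread_of E F \<longleftrightarrow> finite E \<and> finite F \<and>
     list_all2 (\<le>) (sorted_list_of_set E) (sorted_list_of_set F)" (* F is a spread of E *)

definition hereditary :: "nat set set \<Rightarrow> bool" where
  "hereditary \<G> \<longleftrightarrow> (\<forall>E\<in>\<G>. \<forall>F. F \<subseteq> E \<longrightarrow> F \<in> \<G>)"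

definition spreading :: "nat set set \<Rightarrow> bool" where
  "spreading \<G> \<longleftrightarrow> (\<forall>E\<in>\<G>. \<forall>F. spread_of E F \<longrightarrow> F \<in> \<G>)"

text \<open>The Cantor space of subsets of \<open>{1,2,\<dots>}\<close>, via indicator functions.\<close>

definition cantor :: "nat set topology" where
  "cantor = pullback_topology (Pow {1..}) (\<lambda>E n. n \<in> E)
     (product_topology (\<lambda>_. discrete_topology UNIV) UNIV)"

definition regular :: "nat set set \<Rightarrow> bool" where
  "regular \<G> \<longleftrightarrow> \<G> \<subseteq> Fpow {1..} \<and> hereditary \<G> \<and> spreading \<G> \<and> compactin cantor \<G>"

definition maximals :: "nat set set \<Rightarrow> nat set set" where
  "maximals \<G> = {E \<in> \<G>. \<forall>F\<in>\<G>. E \<subseteq> F \<longrightarrow> F = E}"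

definition nice :: "nat set set \<Rightarrow> bool" where
  "nice \<G> \<longleftrightarrow> regular \<G> \<and> {1} \<in> \<G> \<and>
     (\<forall>E\<in>\<G>. E \<noteq> {} \<longrightarrow> E \<in> maximals \<G> \<or> insert (1 + Max E) E \<in> \<G>)"

text \<open>\<open>block \<F> M n\<close> is the \<open>n\<close>-th member \<open>M\<^bsub>\<F>,n\<^esub>\<close> (\<open>n \<ge> 1\<close>) of the unique partition of \<open>M\<close> into
  successive members of \<open>MAX(\<F>)\<close>; the value at \<open>0\<close> is fixed only to make the description
  unique. \<open>MAX\<close> is called \<open>maximals\<close>, as the former is reserved syntax.\<close>

definition block :: "nat set set \<Rightarrow> nat set \<Rightarrow> nat \<Rightarrow> nat set" where
  "block \<F> M = (THE B. B 0 = {} \<and> (\<forall>n\<ge>1. B n \<in> maximals \<F>) \<and>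
     (\<forall>n\<ge>1. before (B n) (B (Suc n))) \<and> (\<Union>n\<in>{1..}. B n) = M)"

definition block_inv :: "nat set set \<Rightarrow> nat set \<Rightarrow> nat \<Rightarrow> nat set" where
  "block_inv \<F> M n = {i \<in> {1..}. elt M i \<in> block \<F> M n}"

definition compose_families :: "nat set set \<Rightarrow> nat set set \<Rightarrow> nat set set" where
  "compose_families \<F> \<G> = {{}} \<union> {(\<Union>i\<in>{1..n}. E i) | (E :: nat \<Rightarrow> nat set) n.
     1 \<le> n \<and> (\<forall>i\<in>{1..n}. E i \<noteq> {} \<and> E i \<in> \<G>) \<and>
     (\<forall>i\<in>{1..<n}. before (E i) (E (Suc i))) \<and> (\<lambda>i. Min (E i)) ` {1..n} \<in> \<F>}"


section \<open>The Cantor--Bendixson index\<close>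

definition derivative :: "nat set set \<Rightarrow> nat set set" where
  "derivative K = K \<inter> cantor derived_set_of K"

function cb_derivative :: "nat set set \<Rightarrow> omega1 \<Rightarrow> nat set set" where
  "cb_derivative K \<alpha> = K \<inter> (\<Inter>\<beta>\<in>{..<\<alpha>}. derivative (cb_derivative K \<beta>))"
  by auto
termination
  by (relation "inv_image {(x, y). x < y} snd") (auto intro: wf_inv_image wf)

declare cb_derivative.simps [simp del]

lemma cb_derivative_iff:
  "E \<in> cb_derivative K \<alpha> \<longleftrightarrow> E \<in> K \<and> (\<forall>\<beta><\<alpha>. E \<in> derivative (cb_derivative K \<beta>))"
  by (subst cb_derivative.simps) blast

lemma cb_derivative_zero: "cb_derivative K 0 = K"
  by (rule set_eqI) (simp add: cb_derivative_iff[of _ K 0])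

lemma cb_derivative_antimono:
  assumes "\<beta> \<le> \<alpha>" shows "cb_derivative K \<alpha> \<subseteq> cb_derivative K \<beta>"
proof
  fix E assume "E \<in> cb_derivative K \<alpha>"
  then show "E \<in> cb_derivative K \<beta>"
    unfolding cb_derivative_iff[of E K \<alpha>] cb_derivative_iff[of E K \<beta>]
    using assms by (blast intro: less_le_trans)
qed

lemma derivative_mono: "K \<subseteq> L \<Longrightarrow> derivative K \<subseteq> derivative L"
  unfolding derivative_def using derived_set_of_mono[of K L cantor] by blast

lemma cb_derivative_osucc: "cb_derivative K (osucc \<alpha>) = derivative (cb_derivative K \<alpha>)"
proof (intro set_eqI iffI)
  fix E assume "E \<in> cb_derivative K (osucc \<alpha>)"
  then show "E \<in> derivative (cb_derivative K \<alpha>)"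
    unfolding cb_derivative_iff[of E K "osucc \<alpha>"] by (simp add: less_osucc_iff)
next
  fix E assume E: "E \<in> derivative (cb_derivative K \<alpha>)"
  then have "E \<in> cb_derivative K \<alpha>" by (simp add: derivative_def)
  then have "E \<in> K" unfolding cb_derivative_iff[of E K \<alpha>] by blast
  moreover have "E \<in> derivative (cb_derivative K \<beta>)" if "\<beta> \<le> \<alpha>" for \<beta>
    using derivative_mono[OF cb_derivative_antimono[OF that]] E by blast
  ultimately show "E \<in> cb_derivative K (osucc \<alpha>)"
    unfolding cb_derivative_iff[of E K "osucc \<alpha>"] by (simp add: less_osucc_iff)
qed

lemma cb_derivative_limit:
  assumes "limit_ord \<alpha>"
  shows "cb_derivative K \<alpha> = (\<Inter>\<beta>\<in>{..<\<alpha>}. cb_derivative K \<beta>)"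
proof (intro set_eqI iffI)
  fix E assume "E \<in> cb_derivative K \<alpha>"
  then show "E \<in> (\<Inter>\<beta>\<in>{..<\<alpha>}. cb_derivative K \<beta>)"
    using cb_derivative_antimono[of _ \<alpha> K] less_imp_le by blast
next
  fix E assume E: "E \<in> (\<Inter>\<beta>\<in>{..<\<alpha>}. cb_derivative K \<beta>)"
  have "0 < \<alpha>" using assms by (simp add: limit_ord_def order_less_le)
  then have "E \<in> K" using E cb_derivative_zero[of K] by blast
  moreover have "E \<in> derivative (cb_derivative K \<delta>)" if "\<delta> < \<alpha>" for \<delta>
    using E limit_ord_osucc_less[OF assms that] unfolding cb_derivative_osucc[symmetric] by blast
  ultimately show "E \<in> cb_derivative K \<alpha>"
    unfolding cb_derivative_iff[of E K \<alpha>] by blast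
qed

text \<open>A compact family of finite sets is countable, so some derivative of countable order is empty
  and the minimum is attained; the index is only applied to such families.\<close>

definition CB :: "nat set set \<Rightarrow> omega1" where
  "CB K = (LEAST \<alpha>. cb_derivative K \<alpha> = {})"


section \<open>Schreier families\<close>

text \<open>Defined inductively; for admissible \<open>s\<close> this is the transfinite recursion given by the three
  equations below. The families depend on the sequences \<open>(\<xi>\<^sub>n)\<close> (here \<open>s \<xi> n\<close>, \<open>n \<ge> 1\<close>) fixed at limit ordinals.\<close>

inductive schreier :: "(omega1 \<Rightarrow> nat \<Rightarrow> omega1) \<Rightarrow> omega1 \<Rightarrow> nat set \<Rightarrow> bool"
  for s :: "omega1 \<Rightarrow> nat \<Rightarrow> omega1" where
  zero: "E \<in> Fpow {1..} \<Longrightarrow> card E \<le> 1 \<Longrightarrow> schreier s 0 E"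
| succ_empty: "schreier s (osucc \<xi>) {}"
| succ: "1 \<le> n \<Longrightarrow> (\<And>i. i \<in> {1..n} \<Longrightarrow> E i \<noteq> {} \<and> schreier s \<xi> (E i)) \<Longrightarrow> below n (E 1) \<Longrightarrow>
    (\<And>i. i \<in> {1..<n} \<Longrightarrow> before (E i) (E (Suc i))) \<Longrightarrow>
    schreier s (osucc \<xi>) (\<Union>i\<in>{1..n}. E i)"
| limit: "limit_ord \<xi> \<Longrightarrow> 1 \<le> n \<Longrightarrow> below n E \<Longrightarrow> schreier s (osucc (s \<xi> n)) E \<Longrightarrow>
    schreier s \<xi> E"

definition Schreier :: "(omega1 \<Rightarrow> nat \<Rightarrow> omega1) \<Rightarrow> omega1 \<Rightarrow> nat set set" where
  "Schreier s \<xi> = {E. schreier s \<xi> E}"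

lemma Schreier_zero: "Schreier s 0 = {E \<in> Fpow {1..}. card E \<le> 1}"
proof -
  have "0 \<noteq> osucc \<alpha>" for \<alpha> using osucc_neq_zero[of \<alpha>] by metis
  then show ?thesis
    by (auto simp: Schreier_def limit_ord_def elim: schreier.cases intro: schreier.zero)
qed

lemma Schreier_osucc:
  "Schreier s (osucc \<xi>) = {{}} \<union> {(\<Union>i\<in>{1..n}. E i) | (E :: nat \<Rightarrow> nat set) n.
     1 \<le> n \<and> (\<forall>i\<in>{1..n}. E i \<noteq> {} \<and> E i \<in> Schreier s \<xi>) \<and> below n (E 1) \<and>
     (\<forall>i\<in>{1..<n}. before (E i) (E (Suc i)))}" (is "_ = ?R")
proof (intro set_eqI iffI)
  fix F assume "F \<in> Schreier s (osucc \<xi>)"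
  then have "schreier s (osucc \<xi>) F" by (simp add: Schreier_def)
  then show "F \<in> ?R"
  proof cases
    case (succ n E \<eta>)
    then show ?thesis by (auto simp: Schreier_def intro!: exI[of _ E] exI[of _ n])
  qed (auto simp: limit_ord_def)
next
  fix F assume "F \<in> ?R"
  then consider "F = {}" | E n where "F = (\<Union>i\<in>{1..n}. E i)" "1 \<le> n"
      "\<forall>i\<in>{1..n}. E i \<noteq> {} \<and> schreier s \<xi> (E i)" "below n (E 1)"
      "\<forall>i\<in>{1..<n}. before (E i) (E (Suc i))"
    by (auto simp: Schreier_def)
  then have "schreier s (osucc \<xi>) F"
  proof cases
    case 1
    then show ?thesis using schreier.succ_empty by simp
  next
    case (2 E n)
    show ?thesis unfolding 2(1) by (rule schreier.succ) (use 2 in blast)+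
  qed
  then show "F \<in> Schreier s (osucc \<xi>)" by (simp add: Schreier_def)
qed

lemma Schreier_limit:
  assumes "limit_ord \<xi>"
  shows "Schreier s \<xi> = {E. \<exists>n\<ge>1. below n E \<and> E \<in> Schreier s (osucc (s \<xi> n))}"
proof (intro set_eqI iffI)
  fix E assume "E \<in> Schreier s \<xi>"
  then have "schreier s \<xi> E" by (simp add: Schreier_def)
  then show "E \<in> {E. \<exists>n\<ge>1. below n E \<and> E \<in> Schreier s (osucc (s \<xi> n))}"
    using assms by cases (auto simp: limit_ord_def Schreier_def)
qed (use assms schreier.limit in \<open>auto simp: Schreier_def\<close>)

definition admissible :: "(omega1 \<Rightarrow> nat \<Rightarrow> omega1) \<Rightarrow> bool" where
  "admissible s \<longleftrightarrow> (\<forall>\<xi>. limit_ord \<xi> \<longrightarrow>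
     (\<forall>n\<ge>1. s \<xi> n < s \<xi> (Suc n) \<and> s \<xi> n < \<xi>) \<and>
     (\<forall>\<eta><\<xi>. \<exists>n\<ge>1. \<eta> < s \<xi> n) \<and>
     (\<forall>n\<ge>1. Schreier s (osucc (s \<xi> n)) \<subseteq> Schreier s (s \<xi> (Suc n))))"

definition full :: "(omega1 \<Rightarrow> nat \<Rightarrow> omega1) \<Rightarrow> omega1 \<Rightarrow> nat set set \<Rightarrow> bool" where
  "full s \<xi> \<E> \<longleftrightarrow> hereditary \<E> \<and> \<E> \<subseteq> Fpow {1..} \<and>
     (\<exists>M\<in>Ipow {1..}. transport (Schreier s \<xi>) M \<subseteq> \<E>)"


section \<open>Probability blocks\<close>

definition initial_segment :: "nat set \<Rightarrow> nat set \<Rightarrow> bool" where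
  "initial_segment A N \<longleftrightarrow> A \<subseteq> N \<and> (\<forall>a\<in>A. \<forall>n\<in>N. n < a \<longrightarrow> n \<in> A)"

definition probability_block :: "(nat set \<Rightarrow> nat \<Rightarrow> nat pmf) \<Rightarrow> nat set set \<Rightarrow> bool" where
  "probability_block \<PP> \<P> \<longleftrightarrow> nice \<P> \<and>
     (\<forall>M\<in>Ipow {1..}. \<forall>n\<ge>1. set_pmf (\<PP> M n) \<subseteq> {1..}) \<and>
     (\<forall>M\<in>Ipow {1..}. \<forall>r\<ge>1. \<PP> (M - (\<Union>i\<in>{1..<r}. set_pmf (\<PP> M i))) 1 = \<PP> M r) \<and>
     (\<forall>M\<in>Ipow {1..}. set_pmf (\<PP> M 1) = block \<P> M 1) \<and>
     (\<forall>M\<in>Ipow {1..}. \<forall>N\<in>Ipow {1..}. \<forall>(r :: nat \<Rightarrow> nat) s.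
        (\<forall>i\<in>{1..s}. 1 \<le> r i) \<and> strict_mono_on {1..s} r \<and>
        initial_segment (\<Union>i\<in>{1..s}. set_pmf (\<PP> M (r i))) N \<longrightarrow>
        (\<forall>i\<in>{1..s}. \<PP> N i = \<PP> M (r i)))"

text \<open>Both notions below are properties of probability blocks, hence the first conjunct.\<close>

definition sufficient :: "omega1 \<Rightarrow> (nat set \<Rightarrow> nat \<Rightarrow> nat pmf) \<Rightarrow> nat set set \<Rightarrow> bool" where
  "sufficient \<xi> \<PP> \<P> \<longleftrightarrow> probability_block \<PP> \<P> \<and>
     (\<forall>\<epsilon>>0. \<forall>\<G>. regular \<G> \<and> CB \<G> \<le> omega_power \<xi> \<longrightarrow>
        (\<forall>L\<in>Ipow {1..}. \<exists>M\<in>Ipow L. \<forall>N\<in>Ipow M. \<forall>E\<in>\<G>.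
           measure_pmf.prob (\<PP> N 1) E \<le> \<epsilon>))"

definition regulatory ::
  "(omega1 \<Rightarrow> nat \<Rightarrow> omega1) \<Rightarrow> omega1 \<Rightarrow> (nat set \<Rightarrow> nat \<Rightarrow> nat pmf) \<Rightarrow> nat set set \<Rightarrow> bool" where
  "regulatory s \<xi> \<PP> \<P> \<longleftrightarrow> probability_block \<PP> \<P> \<and>
     (\<forall>(f :: nat \<times> nat set \<Rightarrow> real) \<delta> \<epsilon>. bounded (f ` ({1..} \<times> maximals \<P>)) \<and> \<delta> < \<epsilon> \<longrightarrow>
        (\<forall>L\<in>Ipow {1..}.
           (\<forall>M\<in>Ipow L. (\<Sum>\<^sub>\<infinity>i\<in>{1..}. pmf (\<PP> M 1) i * f (i, set_pmf (\<PP> M 1))) \<ge> \<epsilon>) \<longrightarrow>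
           full s \<xi> {E \<in> Fpow L. \<exists>F \<in> maximals \<P> \<inter> Fpow L. \<forall>i\<in>E. f (i, F) \<ge> \<delta>}))"

text \<open>This is \<open>\<QQ> * \<PP>\<close>; as in the notation \<open>L\<^sup>-\<^sup>1\<^bsub>\<Q>,n\<^esub>\<close> it also depends on the family \<open>\<Q>\<close>.
  The summands below vanish outside a finite set of \<open>k\<close> and, for probability blocks, the
  function of \<open>k\<close> has total mass one, so \<^const>\<open>embed_pmf\<close> yields the measure with this density.\<close>

definition convolve ::
  "nat set set \<Rightarrow> (nat set \<Rightarrow> nat \<Rightarrow> nat pmf) \<Rightarrow> (nat set \<Rightarrow> nat \<Rightarrow> nat pmf) \<Rightarrow>
   nat set \<Rightarrow> nat \<Rightarrow> nat pmf" where
  "convolve \<Q> \<QQ> \<PP> M n =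
     (let l = (\<lambda>i. Min (set_pmf (\<PP> M i))); L = l ` {1..}
      in embed_pmf (\<lambda>k. \<Sum>i\<in>block_inv \<Q> L n. pmf (\<QQ> L n) (l i) * pmf (\<PP> M i) k))"

end

theory Submission
  imports Defs
begin

text \<open>The topological hypothesis on the families \<open>\<G>\<close> is translated into ranks: ordinal functions that
  decrease strictly along end-extensions. The Cantor--Bendixson rank is such a function
  (\<open>ranked_cb_rank\<close>), and conversely every hereditary family with a rank \<open>\<rho>\<close> is contained in a regular
  family of index at most \<open>\<rho> {} + 1\<close>, consisting of sets labelled by descending ordinals
  (\<open>ranked_subset_regular\<close>). Hence a \<open>\<xi>\<close>-sufficient probability block makes all families of rank below
  \<open>\<omega>\<^sup>\<xi>\<close> negligible on suitable infinite sets (\<open>sufficient_ranked\<close>).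

  Sufficient implies regulatory. The Schreier family \<open>\<S>\<^sub>\<xi>\<close> is assembled from increasing families \<open>A n\<close> of
  rank below \<open>\<omega>\<^sup>\<xi>\<close>, the \<open>n\<close>-th responsible for the sets with minimum \<open>n\<close> (\<open>approximated_Schreier\<close>). Let \<open>\<E>\<close>
  be hereditary. By the dichotomy that follows from Galvin's lemma (\<open>hereditary_dichotomy\<close>), every
  infinite set has, for each \<open>n\<close>, an infinite subset on which \<open>\<E>\<close> contains \<open>A n\<close> or is contained in it.
  If containment of \<open>A n\<close> can always be achieved, a diagonal argument (\<open>fusion\<close>) shows that \<open>\<E>\<close> is
  \<open>\<xi>\<close>-full; otherwise \<open>\<E>\<close> has rank below \<open>\<omega>\<^sup>\<xi>\<close> on some infinite set (\<open>full_or_small_rank\<close>). In the latter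
  case, for the family \<open>\<E>\<close> in the definition of regulatory, the set where \<open>f \<ge> \<delta>\<close> has small mass for
  some measure \<open>\<PP>\<^bsub>N,1\<^esub>\<close>, so that the mean of \<open>f\<close> is smaller than \<open>\<epsilon>\<close>.

  Convolutions. Decompositions into maximal members of \<open>\<P>\<close> are extremal among all decompositions
  (\<open>decomp_maximals_dominates\<close>); from this \<open>\<Q>[\<P>]\<close> is nice, its blocks are unions of blocks for \<open>\<P>\<close>
  grouped by the blocks for \<open>\<Q>\<close> of their minima, and the convolution is a probability block. If
  \<open>CB \<G> \<le> \<omega>\<^bsup>\<xi>+\<zeta>\<^esup>\<close>, write the rank of \<open>E \<in> \<G>\<close> as \<open>\<omega>\<^sup>\<xi> * r E + \<eta>\<close> with \<open>\<eta> < \<omega>\<^sup>\<xi>\<close>. Continuing a set without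
  lowering \<open>r\<close> stays within a family of rank below \<open>\<omega>\<^sup>\<xi>\<close>, hence has small mass for \<open>\<PP>\<close>. So \<open>r\<close> drops on
  every block where \<open>E\<close> has large mass, the minima of these blocks are labelled by descending
  ordinals below \<open>\<omega>\<^sup>\<zeta>\<close>, and \<open>\<QQ>\<close> gives them small mass (\<open>sufficient_convolve_aux\<close>).\<close>

section \<open>Ordinal arithmetic\<close>

lemma plus_le_iff_omega1:
  fixes \<alpha> \<beta> \<gamma> :: omega1
  shows "\<alpha> + \<beta> \<le> \<gamma> \<longleftrightarrow> \<alpha> \<le> \<gamma> \<and> (\<forall>\<delta><\<beta>. \<alpha> + \<delta> < \<gamma>)"
proof
  assume "\<alpha> + \<beta> \<le> \<gamma>"
  then show "\<alpha> \<le> \<gamma> \<and> (\<forall>\<delta><\<beta>. \<alpha> + \<delta> < \<gamma>)"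
    using le_plus_omega1[of \<alpha> \<beta>] plus_strict_mono_omega1[of _ \<beta> \<alpha>] by (meson less_le_trans order_trans)
next
  assume "\<alpha> \<le> \<gamma> \<and> (\<forall>\<delta><\<beta>. \<alpha> + \<delta> < \<gamma>)"
  then show "\<alpha> + \<beta> \<le> \<gamma>"
    by (subst plus_omega1_rec) (auto intro: Least_le)
qed

lemma times_le_iff_omega1:
  fixes \<alpha> \<beta> \<gamma> :: omega1
  shows "\<alpha> * \<beta> \<le> \<gamma> \<longleftrightarrow> (\<forall>\<delta><\<beta>. \<alpha> * \<delta> + \<alpha> \<le> \<gamma>)"
proof
  assume "\<alpha> * \<beta> \<le> \<gamma>"
  then show "\<forall>\<delta><\<beta>. \<alpha> * \<delta> + \<alpha> \<le> \<gamma>"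
    using times_step_omega1[of _ \<beta> \<alpha>] by (meson order_trans)
next
  assume "\<forall>\<delta><\<beta>. \<alpha> * \<delta> + \<alpha> \<le> \<gamma>"
  then show "\<alpha> * \<beta> \<le> \<gamma>"
    by (subst times_omega1_rec) (auto intro: Least_le)
qed

lemma less_plus_iff_omega1:
  fixes \<alpha> \<beta> \<gamma> :: omega1
  shows "\<gamma> < \<alpha> + \<beta> \<longleftrightarrow> \<gamma> < \<alpha> \<or> (\<exists>\<delta><\<beta>. \<gamma> \<le> \<alpha> + \<delta>)"
  unfolding not_le[symmetric] plus_le_iff_omega1 by blast

lemma less_times_iff_omega1:
  fixes \<alpha> \<beta> \<gamma> :: omega1
  shows "\<gamma> < \<alpha> * \<beta> \<longleftrightarrow> (\<exists>\<delta><\<beta>. \<gamma> < \<alpha> * \<delta> + \<alpha>)"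
  unfolding not_le[symmetric] times_le_iff_omega1 by blast

lemma omega_power_le_iff:
  "omega_power \<beta> \<le> \<gamma> \<longleftrightarrow> 1 \<le> \<gamma> \<and> (\<forall>\<delta><\<beta>. omega_power \<delta> * omega \<le> \<gamma>)"
proof
  assume "omega_power \<beta> \<le> \<gamma>"
  then show "1 \<le> \<gamma> \<and> (\<forall>\<delta><\<beta>. omega_power \<delta> * omega \<le> \<gamma>)"
    using omega_power_pos[of \<beta>] omega_power_step[of _ \<beta>] by (meson order_trans)
next
  assume "1 \<le> \<gamma> \<and> (\<forall>\<delta><\<beta>. omega_power \<delta> * omega \<le> \<gamma>)"
  then show "omega_power \<beta> \<le> \<gamma>"
    by (subst omega_power.simps) (auto intro: Least_le)
qed

lemma plus_assoc_omega1: "(\<alpha> + \<beta>) + \<gamma> = \<alpha> + (\<beta> + (\<gamma> :: omega1))"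
proof (induction \<gamma> rule: less_induct)
  case (less \<gamma>)
  show ?case
  proof (rule antisym)
    show "\<alpha> + \<beta> + \<gamma> \<le> \<alpha> + (\<beta> + \<gamma>)"
      by (subst plus_le_iff_omega1)
        (use less in \<open>auto intro: plus_mono_omega1 plus_strict_mono_omega1 le_plus_omega1\<close>)
    have "\<alpha> + \<delta> < \<alpha> + \<beta> + \<gamma>" if \<delta>: "\<delta> < \<beta> + \<gamma>" for \<delta>
    proof (cases "\<delta> < \<beta>")
      case True
      then show ?thesis
        using plus_strict_mono_omega1 le_plus_omega1 less_le_trans by blast
    next
      case False
      then obtain \<eta> where \<eta>: "\<eta> < \<gamma>" "\<delta> \<le> \<beta> + \<eta>"
        using \<delta> unfolding less_plus_iff_omega1 by blast
      then have "\<alpha> + \<delta> \<le> (\<alpha> + \<beta>) + \<eta>"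
        using less plus_mono_omega1 by simp
      also have "\<dots> < \<alpha> + \<beta> + \<gamma>" using \<eta> plus_strict_mono_omega1 by blast
      finally show ?thesis .
    qed
    moreover have "\<alpha> \<le> \<alpha> + \<beta> + \<gamma>" using le_plus_omega1 order_trans by blast
    ultimately show "\<alpha> + (\<beta> + \<gamma>) \<le> \<alpha> + \<beta> + \<gamma>"
      by (subst plus_le_iff_omega1) auto
  qed
qed

lemma plus_left_mono_omega1:
  fixes \<alpha> \<beta> \<gamma> :: omega1
  assumes "\<alpha> \<le> \<beta>" shows "\<alpha> + \<gamma> \<le> \<beta> + \<gamma>"
proof (induction \<gamma> rule: less_induct)
  case (less \<gamma>)
  then show ?case
    by (subst plus_le_iff_omega1)
      (use assms in \<open>auto intro: order_trans[OF _ le_plus_omega1] le_less_trans plus_strict_mono_omega1\<close>)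
qed

lemma times_left_mono_omega1:
  fixes \<alpha> \<beta> \<gamma> :: omega1
  assumes "\<alpha> \<le> \<beta>" shows "\<alpha> * \<gamma> \<le> \<beta> * \<gamma>"
proof (induction \<gamma> rule: less_induct)
  case (less \<gamma>)
  have "\<alpha> * \<delta> + \<alpha> \<le> \<beta> * \<gamma>" if "\<delta> < \<gamma>" for \<delta>
  proof -
    have "\<alpha> * \<delta> + \<alpha> \<le> \<beta> * \<delta> + \<beta>"
      using plus_left_mono_omega1[OF less[OF that]] plus_mono_omega1[OF assms] order_trans by blast
    also have "\<dots> \<le> \<beta> * \<gamma>" by (rule times_step_omega1[OF that])
    finally show ?thesis .
  qed
  then show ?case by (simp add: times_le_iff_omega1)
qed

lemma plus_diff_omega1:
  fixes \<alpha> \<gamma> :: omega1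
  assumes "\<alpha> \<le> \<gamma>" obtains \<eta> where "\<alpha> + \<eta> = \<gamma>"
proof -
  have "\<gamma> \<le> \<alpha> + \<gamma>"
  proof (induction \<gamma> rule: less_induct)
    case (less \<gamma>)
    show ?case
    proof (rule ccontr)
      assume *: "\<not> \<gamma> \<le> \<alpha> + \<gamma>"
      then have "\<alpha> + \<gamma> \<le> \<alpha> + (\<alpha> + \<gamma>)" using less by simp
      moreover have "\<alpha> + (\<alpha> + \<gamma>) < \<alpha> + \<gamma>" using * by (intro plus_strict_mono_omega1) simp
      ultimately show False by simp
    qed
  qed
  then have ex: "\<exists>\<eta>. \<gamma> \<le> \<alpha> + \<eta>" by blast
  define \<eta> where "\<eta> = (LEAST \<eta>. \<gamma> \<le> \<alpha> + \<eta>)"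
  have "\<gamma> \<le> \<alpha> + \<eta>" unfolding \<eta>_def by (rule LeastI_ex[OF ex])
  moreover have "\<alpha> + \<eta> \<le> \<gamma>"
    using assms not_less_Least[of _ "\<lambda>\<eta>. \<gamma> \<le> \<alpha> + \<eta>"]
    by (subst plus_le_iff_omega1) (auto simp: \<eta>_def not_le)
  ultimately show ?thesis using that by force
qed

text \<open>Left division with remainder: \<open>\<gamma> = \<alpha> * oquot \<alpha> \<gamma> + orem \<alpha> \<gamma>\<close> with \<open>orem \<alpha> \<gamma> < \<alpha>\<close>, for \<open>\<alpha> \<ge> 1\<close>.\<close>

definition oquot :: "omega1 \<Rightarrow> omega1 \<Rightarrow> omega1" where
  "oquot \<alpha> \<gamma> = (LEAST \<beta>. \<gamma> < \<alpha> * osucc \<beta>)"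

definition orem :: "omega1 \<Rightarrow> omega1 \<Rightarrow> omega1" where
  "orem \<alpha> \<gamma> = (SOME \<eta>. \<alpha> * oquot \<alpha> \<gamma> + \<eta> = \<gamma>)"

lemma oquot_ex:
  assumes "1 \<le> \<alpha>" shows "\<exists>\<beta>. \<gamma> < \<alpha> * osucc \<beta>"
proof -
  have *: "\<beta> < \<alpha> * osucc \<beta>" for \<beta>
  proof (induction \<beta> rule: less_induct)
    case (less \<beta>)
    have pos: "\<alpha> * \<beta> < \<alpha> * \<beta> + \<alpha>"
      using plus_strict_mono_omega1[of 0 \<alpha> "\<alpha> * \<beta>"] assms
      by (simp add: plus_zero_omega1 one_omega1_def osucc_le_iff)
    have "\<beta> \<le> \<alpha> * \<beta>"
    proof (rule ccontr)
      assume a: "\<not> \<beta> \<le> \<alpha> * \<beta>"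
      then have "\<alpha> * \<beta> < \<alpha> * osucc (\<alpha> * \<beta>)" using less[of "\<alpha> * \<beta>"] by simp
      moreover have "\<alpha> * osucc (\<alpha> * \<beta>) \<le> \<alpha> * \<beta>"
        using a by (intro times_mono_omega1) (simp add: osucc_le_iff)
      ultimately show False by simp
    qed
    with pos show ?case by (simp add: times_osucc)
  qed
  then show ?thesis by blast
qed

lemma less_times_osucc_oquot:
  assumes "1 \<le> \<alpha>" shows "\<gamma> < \<alpha> * osucc (oquot \<alpha> \<gamma>)"
  unfolding oquot_def by (rule LeastI_ex[OF oquot_ex[OF assms]])

lemma times_oquot_le: "\<alpha> * oquot \<alpha> \<gamma> \<le> \<gamma>"
proof (subst times_le_iff_omega1, safe)
  fix \<delta> assume "\<delta> < oquot \<alpha> \<gamma>"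
  then have "\<not> \<gamma> < \<alpha> * osucc \<delta>" unfolding oquot_def by (rule not_less_Least)
  then show "\<alpha> * \<delta> + \<alpha> \<le> \<gamma>" by (simp add: times_osucc)
qed

lemma oquot_orem: "\<alpha> * oquot \<alpha> \<gamma> + orem \<alpha> \<gamma> = \<gamma>"
  unfolding orem_def by (rule someI_ex) (use plus_diff_omega1[OF times_oquot_le] in metis)

lemma orem_less:
  assumes "1 \<le> \<alpha>" shows "orem \<alpha> \<gamma> < \<alpha>"
proof (rule ccontr)
  assume "\<not> ?thesis"
  then have "\<alpha> * oquot \<alpha> \<gamma> + \<alpha> \<le> \<gamma>"
    using plus_mono_omega1[of \<alpha> "orem \<alpha> \<gamma>" "\<alpha> * oquot \<alpha> \<gamma>"] by (simp add: oquot_orem)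
  with less_times_osucc_oquot[OF assms, of \<gamma>] show False by (simp add: times_osucc)
qed

lemma oquot_mono:
  assumes "1 \<le> \<alpha>" "\<gamma> \<le> \<gamma>'" shows "oquot \<alpha> \<gamma> \<le> oquot \<alpha> \<gamma>'"
  unfolding oquot_def[of \<alpha> \<gamma>]
  by (rule Least_le) (use less_times_osucc_oquot[OF assms(1), of \<gamma>'] assms(2) in simp)

lemma orem_strict_mono:
  assumes "oquot \<alpha> \<gamma> = oquot \<alpha> \<gamma>'" "\<gamma> < \<gamma>'" shows "orem \<alpha> \<gamma> < orem \<alpha> \<gamma>'"
  using plus_mono_omega1[of "orem \<alpha> \<gamma>'" "orem \<alpha> \<gamma>" "\<alpha> * oquot \<alpha> \<gamma>'"] assms oquot_orem
  by (metis not_le)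

lemma oquot_less:
  assumes "\<gamma> < \<alpha> * \<beta>" shows "oquot \<alpha> \<gamma> < \<beta>"
proof -
  obtain \<delta> where "\<delta> < \<beta>" "\<gamma> < \<alpha> * osucc \<delta>"
    using assms unfolding less_times_iff_omega1 times_osucc by blast
  then show ?thesis
    unfolding oquot_def by (meson Least_le le_less_trans)
qed

lemma times_plus_le_omega1:
  fixes \<alpha> \<beta> \<gamma> :: omega1
  shows "\<alpha> * \<beta> + \<alpha> * \<gamma> \<le> \<alpha> * (\<beta> + \<gamma>)"
proof (induction \<gamma> rule: less_induct)
  case (less \<gamma>)
  have "\<alpha> * \<beta> + \<delta> < \<alpha> * (\<beta> + \<gamma>)" if \<delta>: "\<delta> < \<alpha> * \<gamma>" for \<delta>
  proof -
    obtain \<eta> where \<eta>: "\<eta> < \<gamma>" "\<delta> < \<alpha> * \<eta> + \<alpha>"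
      using \<delta> unfolding less_times_iff_omega1 by blast
    have "\<alpha> * \<beta> + \<delta> < \<alpha> * \<beta> + (\<alpha> * \<eta> + \<alpha>)" by (rule plus_strict_mono_omega1[OF \<eta>(2)])
    also have "\<dots> = (\<alpha> * \<beta> + \<alpha> * \<eta>) + \<alpha>" by (simp add: plus_assoc_omega1)
    also have "\<dots> \<le> \<alpha> * (\<beta> + \<eta>) + \<alpha>" by (rule plus_left_mono_omega1[OF less[OF \<eta>(1)]])
    also have "\<dots> \<le> \<alpha> * (\<beta> + \<gamma>)"
      by (rule times_step_omega1[OF plus_strict_mono_omega1[OF \<eta>(1)]])
    finally show ?thesis .
  qed
  then show ?case
    by (subst plus_le_iff_omega1) (simp add: times_mono_omega1 le_plus_omega1)
qed

lemma times_assoc_le_omega1: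
  fixes \<alpha> \<beta> \<gamma> :: omega1
  shows "(\<alpha> * \<beta>) * \<gamma> \<le> \<alpha> * (\<beta> * \<gamma>)"
proof (induction \<gamma> rule: less_induct)
  case (less \<gamma>)
  have "\<alpha> * \<beta> * \<delta> + \<alpha> * \<beta> \<le> \<alpha> * (\<beta> * \<gamma>)" if "\<delta> < \<gamma>" for \<delta>
  proof -
    have "\<alpha> * \<beta> * \<delta> + \<alpha> * \<beta> \<le> \<alpha> * (\<beta> * \<delta>) + \<alpha> * \<beta>"
      by (rule plus_left_mono_omega1[OF less[OF that]])
    also have "\<dots> \<le> \<alpha> * (\<beta> * \<delta> + \<beta>)" by (rule times_plus_le_omega1)
    also have "\<dots> \<le> \<alpha> * (\<beta> * \<gamma>)" by (rule times_mono_omega1[OF times_step_omega1[OF that]])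
    finally show ?thesis .
  qed
  then show ?case by (subst times_le_iff_omega1) simp
qed

lemma times_one_omega1: "\<alpha> \<le> \<alpha> * (1 :: omega1)"
  using times_step_omega1[of 0 1 \<alpha>] times_plus_le_omega1
  by (simp add: times_zero_omega1 one_omega1_def less_osucc_iff)
    (metis plus_diff_omega1 zero_le_omega1 plus_assoc_omega1 plus_zero_omega1 times_zero_omega1
      order_trans le_plus_omega1)

lemma omega_power_plus_le: "omega_power (\<xi> + \<zeta>) \<le> omega_power \<xi> * omega_power \<zeta>"
proof (induction \<zeta> rule: less_induct)
  case (less \<zeta>)
  have ge: "omega_power \<xi> \<le> omega_power \<xi> * omega_power \<zeta>"
    using times_one_omega1 times_mono_omega1[OF omega_power_pos] order_trans by blast
  have "omega_power \<delta> * omega \<le> omega_power \<xi> * omega_power \<zeta>" if \<delta>: "\<delta> < \<xi> + \<zeta>" for \<delta>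
  proof (cases "\<delta> < \<xi>")
    case True
    then show ?thesis using omega_power_step ge order_trans by blast
  next
    case False
    then obtain \<eta> where \<eta>: "\<eta> < \<zeta>" "\<delta> \<le> \<xi> + \<eta>"
      using \<delta> unfolding less_plus_iff_omega1 by blast
    have "omega_power \<delta> * omega \<le> omega_power (\<xi> + \<eta>) * omega"
      by (rule times_left_mono_omega1[OF omega_power_mono[OF \<eta>(2)]])
    also have "\<dots> \<le> (omega_power \<xi> * omega_power \<eta>) * omega"
      by (rule times_left_mono_omega1[OF less[OF \<eta>(1)]])
    also have "\<dots> \<le> omega_power \<xi> * (omega_power \<eta> * omega)"
      by (rule times_assoc_le_omega1)
    also have "\<dots> \<le> omega_power \<xi> * omega_power \<zeta>"
      by (rule times_mono_omega1[OF omega_power_step[OF \<eta>(1)]])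
    finally show ?thesis .
  qed
  moreover have "1 \<le> omega_power \<xi> * omega_power \<zeta>" using omega_power_pos ge order_trans by blast
  ultimately show ?case by (subst omega_power_le_iff) auto
qed

lemma funpow_osucc_less_omega: "(osucc ^^ n) 0 < omega"
proof (induction n)
  case 0
  then show ?case using limit_ord_omega by (simp add: limit_ord_def order_less_le)
next
  case (Suc n)
  then show ?case using limit_ord_osucc_less[OF limit_ord_omega] by simp
qed

lemma osucc_less_omega_power:
  assumes "0 < \<zeta>" "\<beta> < omega_power \<zeta>" shows "osucc \<beta> < omega_power \<zeta>"
proof -
  have "\<exists>\<delta><\<zeta>. \<beta> < omega_power \<delta> * omega"
  proof (cases "1 \<le> \<beta>")
    case True
    then show ?thesis
      using assms omega_power_le_iff[of \<zeta> \<beta>] by (auto simp: not_le)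
  next
    case False
    then have "\<beta> < omega_power 0" by (simp add: omega_power_zero)
    then show ?thesis using assms(1) le_times_omega less_le_trans by blast
  qed
  then obtain \<delta> where \<delta>: "\<delta> < \<zeta>" "\<beta> < omega_power \<delta> * omega" by blast
  then obtain k where k: "k < omega" "\<beta> < omega_power \<delta> * osucc k"
    by (auto simp: less_times_iff_omega1 times_osucc)
  have "osucc \<beta> \<le> omega_power \<delta> * osucc k" using k by (simp add: osucc_le_iff)
  also have "\<dots> < omega_power \<delta> * osucc k + omega_power \<delta>"
    using plus_strict_mono_omega1[of 0 "omega_power \<delta>"] omega_power_pos[of \<delta>]
    by (metis plus_zero_omega1 one_omega1_def osucc_le_iff)
  also have "\<dots> \<le> omega_power \<delta> * omega"
    by (rule times_step_omega1[OF limit_ord_osucc_less[OF limit_ord_omega k(1)]])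
  also have "\<dots> \<le> omega_power \<zeta>" by (rule omega_power_step[OF \<delta>(1)])
  finally show ?thesis .
qed

lemma omega_power_strict_mono:
  assumes "\<delta> < \<beta>" shows "omega_power \<delta> < omega_power \<beta>"
proof -
  have "osucc 0 < omega"
    using funpow_osucc_less_omega[of 1] by simp
  then have "omega_power \<delta> * osucc 0 + omega_power \<delta> \<le> omega_power \<delta> * omega"
    by (rule times_step_omega1)
  also have "\<dots> \<le> omega_power \<beta>" by (rule omega_power_step[OF assms])
  finally have *: "omega_power \<delta> * osucc 0 + omega_power \<delta> \<le> omega_power \<beta>" .
  have "omega_power \<delta> \<le> omega_power \<delta> * osucc 0"
    using times_one_omega1 by (simp add: one_omega1_def)
  also have "\<dots> < omega_power \<delta> * osucc 0 + omega_power \<delta>"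
    using plus_strict_mono_omega1[of 0 "omega_power \<delta>"] omega_power_pos[of \<delta>]
    by (metis plus_zero_omega1 one_omega1_def osucc_le_iff)
  finally show ?thesis using * by simp
qed

section \<open>Topology of families of finite sets\<close>

lemma topspace_cantor: "topspace cantor = Pow {1..}"
  by (auto simp: cantor_def topspace_pullback_topology)

lemma openin_cantor_cylinder: "openin cantor {E' \<in> Pow {1..}. E' \<inter> {..k} = E \<inter> {..k}}"
proof -
  let ?V = "\<lambda>n. if n \<le> k then {n \<in> E} else (UNIV :: bool set)"
  have "openin (product_topology (\<lambda>_. discrete_topology UNIV) UNIV) (Pi\<^sub>E UNIV ?V)"
    by (intro product_topology_basis) (auto intro: finite_subset[of _ "{..k}"])
  moreover have "{E' \<in> Pow {1..}. E' \<inter> {..k} = E \<inter> {..k}} =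
      (\<lambda>E n. n \<in> E) -` Pi\<^sub>E UNIV ?V \<inter> Pow {1..}"
    by (auto simp: PiE_def Pi_def set_eq_iff)
  ultimately show ?thesis
    unfolding cantor_def openin_pullback_topology by blast
qed

lemma openin_cantorE:
  assumes "openin cantor U" "E \<in> U"
  obtains k where "\<And>E'. E' \<subseteq> {1..} \<Longrightarrow> E' \<inter> {..k} = E \<inter> {..k} \<Longrightarrow> E' \<in> U"
proof -
  obtain V where V: "openin (product_topology (\<lambda>_::nat. discrete_topology (UNIV :: bool set)) UNIV) V"
      and U: "U = (\<lambda>E n. n \<in> E) -` V \<inter> Pow {1..}"
    using assms(1) unfolding cantor_def openin_pullback_topology by blast
  have "(\<lambda>n. n \<in> E) \<in> V" using assms(2) U by auto
  then obtain X where X: "finite {i. X i \<noteq> UNIV}" "(\<lambda>n. n \<in> E) \<in> Pi\<^sub>E UNIV X" "Pi\<^sub>E UNIV X \<subseteq> V"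
    using V unfolding openin_product_topology_alt by (auto simp: topspace_discrete_topology)
  obtain k where k: "{i. X i \<noteq> UNIV} \<subseteq> {..k}"
    using X(1) finite_nat_iff_bounded_le by blast
  have "E' \<in> U" if "E' \<subseteq> {1..}" "E' \<inter> {..k} = E \<inter> {..k}" for E'
  proof -
    have "(n \<in> E') \<in> X n" for n
    proof (cases "n \<le> k")
      case True
      then have "n \<in> E' \<longleftrightarrow> n \<in> E" using that(2) by blast
      then show ?thesis using X(2) by (auto simp: PiE_def Pi_def)
    next
      case False
      then have "X n = UNIV" using k by auto
      then show ?thesis by simp
    qed
    then have "(\<lambda>n. n \<in> E') \<in> V" using X(3) by (auto simp: PiE_def Pi_def)
    then show ?thesis using U that(1) by auto
  qed
  then show ?thesis using that by blast
qed

lemma cantor_derived_set_iff: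
  "E \<in> cantor derived_set_of K \<longleftrightarrow>
     E \<subseteq> {1..} \<and> (\<forall>k. \<exists>E'\<in>K. E' \<subseteq> {1..} \<and> E' \<noteq> E \<and> E' \<inter> {..k} = E \<inter> {..k})"
proof (intro iffI conjI allI)
  assume E: "E \<in> cantor derived_set_of K"
  then show "E \<subseteq> {1..}" by (auto simp: derived_set_of_def topspace_cantor)
  fix k
  show "\<exists>E'\<in>K. E' \<subseteq> {1..} \<and> E' \<noteq> E \<and> E' \<inter> {..k} = E \<inter> {..k}"
  proof -
    let ?U = "{E' \<in> Pow {1..}. E' \<inter> {..k} = E \<inter> {..k}}"
    have "E \<in> ?U" using \<open>E \<subseteq> {1..}\<close> by blast
    moreover have "\<And>U. E \<in> U \<Longrightarrow> openin cantor U \<Longrightarrow> \<exists>F. F \<noteq> E \<and> F \<in> K \<and> F \<in> U"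
      using E by (simp add: derived_set_of_def)
    ultimately obtain F where "F \<noteq> E" "F \<in> K" "F \<in> ?U"
      using openin_cantor_cylinder[of k E] by meson
    then show ?thesis by blast
  qed
next
  assume *: "E \<subseteq> {1..} \<and> (\<forall>k. \<exists>E'\<in>K. E' \<subseteq> {1..} \<and> E' \<noteq> E \<and> E' \<inter> {..k} = E \<inter> {..k})"
  have "\<exists>E'. E' \<noteq> E \<and> E' \<in> K \<and> E' \<in> U" if U: "E \<in> U \<and> openin cantor U" for U
  proof -
    obtain k where k: "\<And>E'. E' \<subseteq> {1..} \<Longrightarrow> E' \<inter> {..k} = E \<inter> {..k} \<Longrightarrow> E' \<in> U"
      using openin_cantorE[of U E] U by blast
    obtain F where "F \<in> K" "F \<subseteq> {1..}" "F \<noteq> E" "F \<inter> {..k} = E \<inter> {..k}" using * by blast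
    then show ?thesis using k by blast
  qed
  then show "E \<in> cantor derived_set_of K"
    using * by (auto simp: derived_set_of_def topspace_cantor)
qed

lemma compact_cantor: "compact_space cantor"
proof -
  let ?T = "product_topology (\<lambda>_. discrete_topology (UNIV :: bool set)) (UNIV :: nat set)"
  let ?h = "\<lambda>f. {n \<in> {1..}. f n} :: nat set"
  have "compact_space ?T"
    by (simp add: compact_space_product_topology compact_space_discrete_topology)
  moreover have "continuous_map ?T cantor ?h"
    unfolding cantor_def
  proof (rule continuous_map_pullback')
    show "continuous_map ?T ?T ((\<lambda>E n. n \<in> E) \<circ> ?h)"
    proof (subst continuous_map_componentwise_UNIV, rule allI)
      fix n :: nat
      show "continuous_map ?T (discrete_topology UNIV) (\<lambda>x. ((\<lambda>E n. n \<in> E) \<circ> ?h) x n)"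
      proof (cases "1 \<le> n")
        case True
        then have "(\<lambda>x. ((\<lambda>E n. n \<in> E) \<circ> ?h) x n) = (\<lambda>x. x n)" by (simp add: fun_eq_iff)
        then show ?thesis
          using continuous_map_product_projection[of n UNIV "\<lambda>_. discrete_topology UNIV"] by simp
      next
        case False
        then have "(\<lambda>x. ((\<lambda>E n. n \<in> E) \<circ> ?h) x n) = (\<lambda>x. False)" by (simp add: fun_eq_iff)
        then show ?thesis by simp
      qed
    qed
  qed auto
  ultimately have "compactin cantor (?h ` topspace ?T)"
    using image_compactin compact_space_def by blast
  moreover have "?h ` topspace ?T = Pow {1..}"
  proof (intro equalityI subsetI)
    fix E assume E: "E \<in> Pow {1 :: nat ..}"
    then have "E = ?h (\<lambda>n. n \<in> E)" by auto
    then show "E \<in> ?h ` topspace ?T" by (auto simp: PiE_def)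
  qed auto
  ultimately show ?thesis by (simp add: compact_space_def topspace_cantor)
qed

text \<open>Among the hereditary families of finite sets, the compact ones are those without an infinite
  branch.\<close>

lemma compactin_cantorI:
  assumes sub: "\<G> \<subseteq> Fpow {1..}" and her: "hereditary \<G>"
    and no_branch: "\<And>M. M \<in> Ipow {1..} \<Longrightarrow> \<exists>k. M \<inter> {..k} \<notin> \<G>"
  shows "compactin cantor \<G>"
proof -
  have "openin cantor (Pow {1..} - \<G>)"
  proof (subst openin_subopen, safe)
    fix E :: "nat set" assume E: "E \<subseteq> {1..}" "E \<notin> \<G>"
    have "\<exists>k. E \<inter> {..k} \<notin> \<G>"
    proof (cases "finite E")
      case True
      then obtain k where "E \<subseteq> {..k}" using finite_nat_iff_bounded_le by blast
      then have "E \<inter> {..k} = E" by blast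
      then show ?thesis using E by metis
    next
      case False
      then show ?thesis using no_branch E by (simp add: Ipow_def)
    qed
    then obtain k where k: "E \<inter> {..k} \<notin> \<G>" by blast
    have "{E' \<in> Pow {1..}. E' \<inter> {..k} = E \<inter> {..k}} \<subseteq> Pow {1..} - \<G>"
    proof safe
      fix E' assume "E' \<inter> {..k} = E \<inter> {..k}" "E' \<in> \<G>"
      then have "E \<inter> {..k} \<in> \<G>" using her unfolding hereditary_def by (metis inf_le1)
      with k show False ..
    qed
    then show "\<exists>T. openin cantor T \<and> E \<in> T \<and> T \<subseteq> Pow {1..} - \<G>"
      using openin_cantor_cylinder[of k E] E by blast
  qed
  then have "closedin cantor \<G>"
    using sub by (auto simp: closedin_def topspace_cantor Fpow_def)
  then show ?thesis using compact_cantor closedin_compact_space by blast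
qed

lemma compactin_cantorD:
  assumes compact: "compactin cantor \<G>" and sub: "\<G> \<subseteq> Fpow {1..}" and M: "M \<in> Ipow {1..}"
  shows "\<exists>k. M \<inter> {..k} \<notin> \<G>"
proof (rule ccontr)
  assume "\<not> ?thesis"
  then have M': "M \<inter> {..k} \<in> \<G>" for k by blast
  define U where "U k = {E \<in> Pow {1..}. E \<inter> {..k} \<noteq> M \<inter> {..k}}" for k
  have "openin cantor (U k)" for k
  proof -
    have "U k = \<Union>{{E' \<in> Pow {1..}. E' \<inter> {..k} = E \<inter> {..k}} | E. E \<in> U k}"
      unfolding U_def by blast
    also have "openin cantor \<dots>" using openin_cantor_cylinder by (auto intro!: openin_Union)
    finally show ?thesis .
  qed
  moreover have "\<G> \<subseteq> \<Union>(range U)"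
  proof
    fix E assume "E \<in> \<G>"
    then have E: "finite E" "E \<subseteq> {1..}" using sub by (auto simp: Fpow_def)
    obtain x where "x \<in> M - E" using M E by (metis Diff_infinite_finite Ipow_def ex_in_conv
        finite.emptyI mem_Collect_eq)
    then have "E \<inter> {..x} \<noteq> M \<inter> {..x}" by blast
    then show "E \<in> \<Union>(range U)" using E by (auto simp: U_def)
  qed
  ultimately obtain \<F> where \<F>: "finite \<F>" "\<F> \<subseteq> range U" "\<G> \<subseteq> \<Union>\<F>"
    using compact unfolding compactin_def by (metis (no_types, lifting) image_iff)
  then obtain I where I: "finite I" "\<F> = U ` I" by (meson finite_subset_image)
  obtain k where "I \<subseteq> {..k}" using I(1) finite_nat_iff_bounded_le by blast
  then have "\<not> M \<inter> {..k} \<in> \<Union>\<F>" unfolding I(2) U_def by (auto simp: Int_assoc min_def)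
  then show False using M' \<F>(3) by blast
qed

section \<open>Spreads, derivatives and ranks of families\<close>

lemma sorted_list_of_set_strict_mono_image:
  fixes \<phi> :: "nat \<Rightarrow> nat"
  assumes "finite E" "strict_mono_on E \<phi>"
  shows "sorted_list_of_set (\<phi> ` E) = map \<phi> (sorted_list_of_set E)"
proof (rule sorted_distinct_set_unique)
  have inj: "inj_on \<phi> E" using assms(2) by (rule strict_mono_on_imp_inj_on)
  show "sorted (map \<phi> (sorted_list_of_set E))"
    unfolding sorted_map
  proof (rule sorted_wrt_mono_rel[OF _ sorted_sorted_list_of_set])
    fix x y assume "x \<in> set (sorted_list_of_set E)" "y \<in> set (sorted_list_of_set E)" "x \<le> y"
    then show "\<phi> x \<le> \<phi> y"
      using assms strict_mono_onD[OF assms(2), of x y] by (cases "x = y") auto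
  qed
  show "distinct (map \<phi> (sorted_list_of_set E))"
    using inj assms(1) by (simp add: distinct_map)
qed (use assms in auto)

lemma spread_of_iff:
  "spread_of E F \<longleftrightarrow> finite E \<and> (\<exists>\<phi>. strict_mono_on E \<phi> \<and> \<phi> ` E = F \<and> (\<forall>x\<in>E. x \<le> \<phi> x))"
proof
  assume *: "spread_of E F"
  then have fin: "finite E" "finite F" by (auto simp: spread_of_def)
  define xs where "xs = sorted_list_of_set E"
  define ys where "ys = sorted_list_of_set F"
  have xs: "set xs = E" "sorted xs" "distinct xs" and ys: "set ys = F" "sorted ys" "distinct ys"
    using fin by (auto simp: xs_def ys_def)
  have len: "length xs = length ys" and le: "\<And>i. i < length xs \<Longrightarrow> xs ! i \<le> ys ! i"
    using * by (auto simp: spread_of_def xs_def ys_def list_all2_conv_all_nth)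
  define \<phi> where "\<phi> x = the (map_of (zip xs ys) x)" for x
  have \<phi>: "\<phi> (xs ! i) = ys ! i" if "i < length xs" for i
    using map_of_zip_nth[OF len xs(3)] that len by (simp add: \<phi>_def)
  have E: "E = (\<lambda>i. xs ! i) ` {..<length xs}"
    using xs(1) by (auto simp: in_set_conv_nth set_conv_nth)
  have F: "F = (\<lambda>i. ys ! i) ` {..<length xs}"
    using ys(1) len by (auto simp: in_set_conv_nth set_conv_nth)
  have "strict_mono_on E \<phi>"
  proof (rule strict_mono_onI)
    fix x y assume "x \<in> E" "y \<in> E" "x < y"
    then obtain i j where ij: "i < length xs" "j < length xs" "x = xs ! i" "y = xs ! j"
      unfolding E by auto
    have "i < j"
      using \<open>x < y\<close> ij sorted_nth_mono[OF xs(2), of j i] by (meson not_le)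
    then have "ys ! i \<le> ys ! j" "ys ! i \<noteq> ys ! j"
      using ij len sorted_nth_mono[OF ys(2), of i j] nth_eq_iff_index_eq[OF ys(3), of i j] by auto
    then show "\<phi> x < \<phi> y" using ij \<phi> by simp
  qed
  moreover have "\<phi> ` E = F" unfolding F by (subst E) (auto simp: \<phi> image_image)
  moreover have "\<forall>x\<in>E. x \<le> \<phi> x" by (subst E) (auto simp: \<phi> le)
  ultimately show "finite E \<and> (\<exists>\<phi>. strict_mono_on E \<phi> \<and> \<phi> ` E = F \<and> (\<forall>x\<in>E. x \<le> \<phi> x))"
    using fin by blast
next
  assume "finite E \<and> (\<exists>\<phi>. strict_mono_on E \<phi> \<and> \<phi> ` E = F \<and> (\<forall>x\<in>E. x \<le> \<phi> x))"
  then obtain \<phi> where *: "finite E" "strict_mono_on E \<phi>" "\<phi> ` E = F" "\<forall>x\<in>E. x \<le> \<phi> x" by blast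
  then have "sorted_list_of_set F = map \<phi> (sorted_list_of_set E)"
    using sorted_list_of_set_strict_mono_image by blast
  then show "spread_of E F"
    using * by (auto simp: spread_of_def list_all2_conv_all_nth)
      (metis nth_mem set_sorted_list_of_set sorted_list_of_set.length_sorted_key_list_of_set)
qed

lemma spreading_image:
  assumes "spreading \<G>" "E \<in> \<G>" "finite E" "strict_mono_on E \<phi>" "\<And>x. x \<in> E \<Longrightarrow> x \<le> \<phi> x"
  shows "\<phi> ` E \<in> \<G>"
  using assms unfolding spreading_def spread_of_iff by blast

lemma spreading_of_dominated:
  fixes \<phi> :: "nat \<Rightarrow> nat"
  assumes "spreading \<G>" "\<phi> ` E \<in> \<G>" "finite E" "strict_mono_on E \<phi>" "\<And>x. x \<in> E \<Longrightarrow> \<phi> x \<le> x"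
  shows "E \<in> \<G>"
proof -
  let ?\<psi> = "inv_into E \<phi>"
  have inj: "inj_on \<phi> E" using assms(4) by (rule strict_mono_on_imp_inj_on)
  have sm: "strict_mono_on (\<phi> ` E) ?\<psi>"
  proof (rule strict_mono_onI)
    fix a b assume "a \<in> \<phi> ` E" "b \<in> \<phi> ` E" "a < b"
    then obtain x y where xy: "x \<in> E" "y \<in> E" "a = \<phi> x" "b = \<phi> y" by auto
    have "x < y"
    proof (rule ccontr)
      assume "\<not> x < y"
      then have "\<phi> y \<le> \<phi> x"
        using xy strict_mono_onD[OF assms(4), of y x] by (cases "x = y") auto
      then show False using xy \<open>a < b\<close> by simp
    qed
    then show "?\<psi> a < ?\<psi> b" using xy inj by simp
  qed
  have "?\<psi> ` \<phi> ` E \<in> \<G>"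
    by (rule spreading_image[OF assms(1,2) _ sm]) (use assms(3,5) inj in auto)
  also have "?\<psi> ` \<phi> ` E = E" using inj by (simp add: image_inv_into_cancel)
  finally show ?thesis .
qed

lemma hereditaryD: "hereditary \<G> \<Longrightarrow> E \<in> \<G> \<Longrightarrow> F \<subseteq> E \<Longrightarrow> F \<in> \<G>"
  unfolding hereditary_def by blast

text \<open>\<open>F\<close> is a proper end-extension of \<open>E\<close>: it has further elements, all of them after those of \<open>E\<close>.\<close>

definition end_ext :: "nat set \<Rightarrow> nat set \<Rightarrow> bool" where
  "end_ext E F \<longleftrightarrow> E \<subset> F \<and> (\<forall>x\<in>E. \<forall>y\<in>F - E. x < y)"

text \<open>A hereditary family of finite sets together with an ordinal function that decreases strictly along
  proper end-extensions. Such a function bounds the Cantor--Bendixson index from above, and for a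
  regular family the Cantor--Bendixson rank of its members is the least one; ranks are easier to
  estimate than derivatives, since no topology is involved.\<close>

definition ranked :: "nat set set \<Rightarrow> (nat set \<Rightarrow> omega1) \<Rightarrow> bool" where
  "ranked \<A> \<rho> \<longleftrightarrow> \<A> \<subseteq> Fpow {1..} \<and> hereditary \<A> \<and>
     (\<forall>E\<in>\<A>. \<forall>F\<in>\<A>. end_ext E F \<longrightarrow> \<rho> F < \<rho> E)"

lemma rankedD:
  assumes "ranked \<A> \<rho>"
  shows "\<A> \<subseteq> Fpow {1..}" "hereditary \<A>"
    "\<And>E F. E \<in> \<A> \<Longrightarrow> F \<in> \<A> \<Longrightarrow> end_ext E F \<Longrightarrow> \<rho> F < \<rho> E"
  using assms by (auto simp: ranked_def)

lemma end_ext_empty: "end_ext {} E \<longleftrightarrow> E \<noteq> {}"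
  by (auto simp: end_ext_def)

lemma end_ext_if_Int_atMost_eq:
  assumes "F \<inter> {..k} = E \<inter> {..k}" "E \<subseteq> {..k}" "F \<noteq> E"
  shows "end_ext E F"
proof -
  have "x < y" if "x \<in> E" "y \<in> F - E" for x y
  proof (rule ccontr)
    assume "\<not> x < y"
    then have "y \<in> F \<inter> {..k}" using that assms(2) by auto
    then show False using that assms(1) by auto
  qed
  then show ?thesis using assms unfolding end_ext_def by blast
qed

lemma ranked_no_branch:
  assumes "ranked \<A> \<rho>" "M \<in> Ipow {1..}"
  shows "\<exists>k. M \<inter> {..k} \<notin> \<A>"
proof (rule ccontr)
  assume "\<not> ?thesis"
  then have *: "M \<inter> {..k} \<in> \<A>" for k by blast
  have "\<exists>m. \<rho> (M \<inter> {..m}) < \<rho> (M \<inter> {..k})" for k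
  proof -
    obtain m where m: "m \<in> M" "k < m"
      using assms(2) by (auto simp: Ipow_def infinite_nat_iff_unbounded)
    have "end_ext (M \<inter> {..k}) (M \<inter> {..m})"
    proof (rule end_ext_if_Int_atMost_eq[of _ k])
      have "m \<in> M \<inter> {..m}" "m \<notin> M \<inter> {..k}" using m by auto
      then show "M \<inter> {..m} \<noteq> M \<inter> {..k}" by blast
    qed (use m in auto)
    then show ?thesis using rankedD(3)[OF assms(1)] * by blast
  qed
  moreover obtain \<gamma> where "\<gamma> \<in> range (\<lambda>k. \<rho> (M \<inter> {..k}))"
    "\<And>\<delta>. \<delta> < \<gamma> \<Longrightarrow> \<delta> \<notin> range (\<lambda>k. \<rho> (M \<inter> {..k}))"
    using exists_least_iff[of "\<lambda>\<gamma>. \<gamma> \<in> range (\<lambda>k. \<rho> (M \<inter> {..k}))"] by blast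
  ultimately show False by blast
qed

text \<open>A neighbourhood of a finite set \<open>E\<close> in \<open>K\<close> that is small enough contains, besides \<open>E\<close>, only
  end-extensions of \<open>E\<close>, so every derivation step costs at least one unit of rank.\<close>

lemma mem_cb_derivative_le_rank:
  assumes "K \<subseteq> Fpow {1..}"
    and decr: "\<And>E F. E \<in> K \<Longrightarrow> F \<in> K \<Longrightarrow> end_ext E F \<Longrightarrow> \<rho> F < \<rho> E"
  shows "E \<in> cb_derivative K \<gamma> \<Longrightarrow> \<gamma> \<le> \<rho> E"
proof (induction "\<rho> E" arbitrary: E \<gamma> rule: less_induct)
  case less
  then have E: "E \<in> K" and *: "\<And>\<beta>. \<beta> < \<gamma> \<Longrightarrow> E \<in> derivative (cb_derivative K \<beta>)"
    by (simp_all add: cb_derivative_iff[of E])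
  show ?case
  proof (rule ccontr)
    assume "\<not> \<gamma> \<le> \<rho> E"
    then have E': "E \<in> cantor derived_set_of (cb_derivative K (\<rho> E))"
      using * by (simp add: derivative_def not_le)
    obtain k where k: "E \<subseteq> {..k}"
      using E assms(1) finite_nat_iff_bounded_le by (auto simp: Fpow_def)
    obtain F where F: "F \<in> cb_derivative K (\<rho> E)" "F \<noteq> E" "F \<inter> {..k} = E \<inter> {..k}"
      using E' unfolding cantor_derived_set_iff by blast
    then have "F \<in> K" by (simp add: cb_derivative_iff[of F])
    moreover have "end_ext E F" using F k by (intro end_ext_if_Int_atMost_eq)
    ultimately have "\<rho> F < \<rho> E" using decr E by blast
    moreover from less(1)[OF this F(1)] have "\<rho> E \<le> \<rho> F" .
    ultimately show False by simp
  qed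
qed

lemma CB_le_rank:
  assumes "ranked K \<rho>" shows "CB K \<le> osucc (\<rho> {})"
proof -
  have "cb_derivative K (osucc (\<rho> {})) = {}"
  proof (rule equals0I)
    fix E assume E: "E \<in> cb_derivative K (osucc (\<rho> {}))"
    then have "osucc (\<rho> {}) \<le> \<rho> E"
      using mem_cb_derivative_le_rank rankedD[OF assms] by blast
    moreover have "E \<in> K" using E by (simp add: cb_derivative_iff[of E])
    then have "\<rho> E \<le> \<rho> {}"
      using rankedD(3)[OF assms, of "{}" E] hereditaryD[OF rankedD(2)[OF assms], of E "{}"]
      by (cases "E = {}") (auto simp: end_ext_empty)
    ultimately show False by (simp add: osucc_le_iff)
  qed
  then show ?thesis unfolding CB_def by (rule Least_le)
qed

lemma regularD:
  assumes "regular \<G>"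
  shows "\<G> \<subseteq> Fpow {1..}" "hereditary \<G>" "spreading \<G>" "compactin cantor \<G>"
  using assms by (auto simp: regular_def)

text \<open>In a hereditary spreading family a single point \<open>n\<close> with \<open>insert n E \<in> K\<close> suffices to make \<open>E\<close> a
  limit point: spreading moves \<open>n\<close> arbitrarily far away. Thus derivatives can be described without
  topology, and they are again hereditary and spreading.\<close>

lemma derivative_spreading_iff:
  assumes "K \<subseteq> Fpow {1..}" "hereditary K" "spreading K"
  shows "E \<in> derivative K \<longleftrightarrow> E \<in> K \<and> (\<exists>n. (\<forall>x\<in>E. x < n) \<and> insert n E \<in> K)"
proof
  assume "E \<in> derivative K"
  then have E: "E \<in> K" "E \<in> cantor derived_set_of K" by (auto simp: derivative_def)
  obtain k where k: "E \<subseteq> {..k}"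
    using E assms(1) finite_nat_iff_bounded_le by (auto simp: Fpow_def)
  obtain F where F: "F \<in> K" "F \<noteq> E" "F \<inter> {..k} = E \<inter> {..k}"
    using E unfolding cantor_derived_set_iff by blast
  then have ext: "end_ext E F" using k end_ext_if_Int_atMost_eq by blast
  then obtain n where n: "n \<in> F" "n \<notin> E" by (auto simp: end_ext_def)
  then have "insert n E \<in> K"
    using hereditaryD[OF assms(2) F(1)] ext by (auto simp: end_ext_def)
  moreover have "\<forall>x\<in>E. x < n" using n ext by (simp add: end_ext_def)
  ultimately show "E \<in> K \<and> (\<exists>n. (\<forall>x\<in>E. x < n) \<and> insert n E \<in> K)"
    using E by blast
next
  assume "E \<in> K \<and> (\<exists>n. (\<forall>x\<in>E. x < n) \<and> insert n E \<in> K)"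
  then obtain n where E: "E \<in> K" and n: "\<forall>x\<in>E. x < n" "insert n E \<in> K" by blast
  have fin: "finite E" "E \<subseteq> {1..}" using E assms(1) by (auto simp: Fpow_def)
  have "\<exists>F\<in>K. F \<subseteq> {1..} \<and> F \<noteq> E \<and> F \<inter> {..k} = E \<inter> {..k}" for k
  proof -
    define m where "m = n + Suc k"
    have "(\<lambda>x. if x = n then m else x) ` insert n E \<in> K"
      by (rule spreading_image[OF assms(3) n(2)])
        (use fin n(1) in \<open>auto simp: strict_mono_on_def m_def\<close>)
    moreover have "(\<lambda>x. if x = n then m else x) ` insert n E = insert m E"
      using n(1) by force
    ultimately have "insert m E \<in> K" by simp
    moreover have "m \<notin> E" using n(1) by (auto simp: m_def)
    ultimately show ?thesis
      using fin by (intro bexI[of _ "insert m E"]) (auto simp: m_def)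
  qed
  then show "E \<in> derivative K"
    using E fin by (simp add: derivative_def cantor_derived_set_iff)
qed

lemma hereditary_spreading_derivative:
  assumes "K \<subseteq> Fpow {1..}" "hereditary K" "spreading K"
  shows "hereditary (derivative K)" "spreading (derivative K)"
proof -
  note iff = derivative_spreading_iff[OF assms]
  show "hereditary (derivative K)"
    unfolding hereditary_def
  proof safe
    fix E F assume "E \<in> derivative K" "F \<subseteq> E"
    then obtain n where n: "E \<in> K" "\<forall>x\<in>E. x < n" "insert n E \<in> K" "F \<subseteq> E"
      using iff[of E] by blast
    have "F \<in> K" by (rule hereditaryD[OF assms(2) n(1,4)])
    moreover have "insert n F \<in> K" by (rule hereditaryD[OF assms(2) n(3)]) (use n(4) in auto)
    moreover have "\<forall>x\<in>F. x < n" using n(2,4) by auto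
    ultimately show "F \<in> derivative K" using iff[of F] by blast
  qed
  show "spreading (derivative K)"
    unfolding spreading_def
  proof safe
    fix E F assume "E \<in> derivative K" and sp: "spread_of E F"
    then obtain n where n: "E \<in> K" "\<forall>x\<in>E. x < n" "insert n E \<in> K" using iff[of E] by blast
    obtain \<phi> where \<phi>: "finite E" "strict_mono_on E \<phi>" "\<phi> ` E = F" "\<forall>x\<in>E. x \<le> \<phi> x"
      using sp unfolding spread_of_iff by blast
    obtain k where k: "F \<subseteq> {..k}" using \<phi> finite_nat_iff_bounded_le by blast
    define m where "m = n + Suc k"
    have "(\<lambda>x. if x = n then m else \<phi> x) ` insert n E \<in> K"
    proof (rule spreading_image[OF assms(3) n(3)])
      have "\<phi> x < m" if "x \<in> E" for x using that \<phi>(3) k by (auto simp: m_def)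
      then show "strict_mono_on (insert n E) (\<lambda>x. if x = n then m else \<phi> x)"
        using n(2) \<phi>(2) by (auto simp: strict_mono_on_def)
    qed (use \<phi> in \<open>auto simp: m_def\<close>)
    moreover have "(\<lambda>x. if x = n then m else \<phi> x) ` insert n E = insert m F"
      using n(2) \<phi>(3) by force
    ultimately have "insert m F \<in> K" by simp
    moreover have "F \<in> K" using assms(3) n(1) sp unfolding spreading_def by blast
    moreover have "\<forall>x\<in>F. x < m" using k by (auto simp: m_def)
    ultimately show "F \<in> derivative K" using iff[of F] by blast
  qed
qed

lemma cb_derivative_subset: "cb_derivative K \<gamma> \<subseteq> K"
  by (auto simp: cb_derivative_iff[of _ K \<gamma>])

lemma hereditary_spreading_cb_derivative:
  assumes "K \<subseteq> Fpow {1..}" "hereditary K" "spreading K"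
  shows "hereditary (cb_derivative K \<gamma>) \<and> spreading (cb_derivative K \<gamma>)"
proof (induction \<gamma> rule: less_induct)
  case (less \<gamma>)
  have der: "hereditary (derivative (cb_derivative K \<beta>)) \<and> spreading (derivative (cb_derivative K \<beta>))"
    if "\<beta> < \<gamma>" for \<beta>
  proof -
    have "cb_derivative K \<beta> \<subseteq> Fpow {1..}" using cb_derivative_subset[of K \<beta>] assms(1) by (rule subset_trans)
    then show ?thesis using hereditary_spreading_derivative less[OF that] by simp
  qed
  have "hereditary (cb_derivative K \<gamma>)"
    unfolding hereditary_def
  proof (intro ballI allI impI)
    fix E F assume E: "E \<in> cb_derivative K \<gamma>" "F \<subseteq> E"
    have "F \<in> K" using E hereditaryD[OF assms(2)] cb_derivative_subset by blast
    moreover have "F \<in> derivative (cb_derivative K \<beta>)" if "\<beta> < \<gamma>" for \<beta>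
      using der[OF that] E that hereditaryD by (simp add: cb_derivative_iff[of E]) blast
    ultimately show "F \<in> cb_derivative K \<gamma>" by (simp add: cb_derivative_iff[of F])
  qed
  moreover have "spreading (cb_derivative K \<gamma>)"
    unfolding spreading_def
  proof (intro ballI allI impI)
    fix E F assume E: "E \<in> cb_derivative K \<gamma>" "spread_of E F"
    have "E \<in> K" using E cb_derivative_subset by blast
    then have "F \<in> K" using E assms(3) by (auto simp: spreading_def)
    moreover have "F \<in> derivative (cb_derivative K \<beta>)" if "\<beta> < \<gamma>" for \<beta>
      using der[OF that] E that by (auto simp: cb_derivative_iff[of E] spreading_def)
    ultimately show "F \<in> cb_derivative K \<gamma>" by (simp add: cb_derivative_iff[of F])
  qed
  ultimately show ?case ..
qed

text \<open>The minimum in the definition of \<open>CB\<close> is attained. As \<open>K\<close> is countable, all members that ever leave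
  the derivatives have left by some countable stage. The derivative at that stage equals the next
  one, so each of its members has a proper end-extension in it; iterating gives an infinite branch
  of \<open>K\<close>, contradicting compactness.\<close>

lemma cb_derivative_CB_empty:
  assumes "regular K" shows "cb_derivative K (CB K) = {}"
proof -
  note K = regularD[OF assms]
  have "countable K"
    by (rule countable_subset[OF K(1)]) (simp add: countable_Fpow)
  then obtain \<beta> where \<beta>: "\<forall>\<alpha>\<in>(\<lambda>E. LEAST \<alpha>. E \<notin> cb_derivative K \<alpha>) ` K. \<alpha> < \<beta>"
    using countable_bounded_omega1[OF countable_image, of K "\<lambda>E. LEAST \<alpha>. E \<notin> cb_derivative K \<alpha>"]
    by auto
  have step: "\<exists>F. F \<in> cb_derivative K \<beta> \<and> E \<subset> F" if E: "E \<in> cb_derivative K \<beta>" for E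
  proof -
    have "E \<in> cb_derivative K (osucc \<beta>)"
    proof (rule ccontr)
      assume *: "E \<notin> cb_derivative K (osucc \<beta>)"
      let ?\<alpha> = "LEAST \<alpha>. E \<notin> cb_derivative K \<alpha>"
      have out: "E \<notin> cb_derivative K ?\<alpha>" by (rule LeastI[of "\<lambda>\<alpha>. E \<notin> cb_derivative K \<alpha>", OF *])
      have "?\<alpha> < \<beta>" using \<beta> E cb_derivative_subset[of K \<beta>] by blast
      then have "E \<in> cb_derivative K ?\<alpha>"
        using subsetD[OF cb_derivative_antimono[OF less_imp_le] E] by blast
      with out show False by (rule notE)
    qed
    moreover have "cb_derivative K \<beta> \<subseteq> Fpow {1..}" using cb_derivative_subset[of K \<beta>] K(1) by simp
    ultimately obtain n where "\<forall>x\<in>E. x < n" "insert n E \<in> cb_derivative K \<beta>"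
      using derivative_spreading_iff[of "cb_derivative K \<beta>" E]
        hereditary_spreading_cb_derivative[OF K(1-3), of \<beta>]
      unfolding cb_derivative_osucc by auto
    then show ?thesis by (intro exI[of _ "insert n E"]) auto
  qed
  have "cb_derivative K \<beta> = {}"
  proof (rule ccontr)
    assume "cb_derivative K \<beta> \<noteq> {}"
    then obtain E where E: "E 0 \<in> cb_derivative K \<beta>"
        "\<And>i. E i \<in> cb_derivative K \<beta>" "\<And>i. E i \<subset> E (Suc i)"
      using dependent_nat_choice[of "\<lambda>i E. E \<in> cb_derivative K \<beta>" "\<lambda>i E F. E \<subset> F"] step
      by (metis ex_in_conv)
    have EK: "E i \<in> K" for i using E cb_derivative_subset by blast
    have mono: "incseq E" using E(3) by (intro incseq_SucI) auto
    let ?M = "\<Union>(range E)"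
    have "infinite ?M"
    proof
      assume fin: "finite ?M"
      have "strict_mono (\<lambda>i. card (E i))"
        unfolding strict_mono_Suc_iff
      proof
        fix i show "card (E i) < card (E (Suc i))"
          by (rule psubset_card_mono) (use E(3) fin in \<open>auto intro: finite_subset[OF _ fin]\<close>)
      qed
      then have "Suc (card ?M) \<le> card (E (Suc (card ?M)))" using strict_mono_imp_increasing by blast
      moreover have "card (E (Suc (card ?M))) \<le> card ?M" by (rule card_mono[OF fin]) auto
      ultimately show False by simp
    qed
    moreover have "?M \<subseteq> {1..}" using EK K(1) by (fastforce simp: Fpow_def)
    ultimately obtain k where k: "?M \<inter> {..k} \<notin> K"
      using compactin_cantorD[OF K(4,1), of ?M] by (auto simp: Ipow_def)
    have chain: "subset.chain UNIV (range E)"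
      unfolding subset_chain_def using incseqD[OF mono] nat_le_linear by blast
    obtain B where "B \<in> range E" "?M \<inter> {..k} \<subseteq> B"
      by (rule finite_subset_Union_chain[OF _ _ _ chain, of "?M \<inter> {..k}"]) auto
    then show False using k EK hereditaryD[OF K(2)] by blast
  qed
  then show ?thesis unfolding CB_def by (rule LeastI)
qed

text \<open>The Cantor--Bendixson rank of a member of a regular family: the last derivative that contains it.\<close>

definition cb_rank :: "nat set set \<Rightarrow> nat set \<Rightarrow> omega1" where
  "cb_rank \<G> E = (LEAST \<gamma>. E \<notin> cb_derivative \<G> (osucc \<gamma>))"

lemma cb_derivative_iff_cb_rank:
  assumes "regular \<G>" "E \<in> \<G>"
  shows "E \<in> cb_derivative \<G> \<gamma> \<longleftrightarrow> \<gamma> \<le> cb_rank \<G> E"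
proof -
  have "E \<notin> cb_derivative \<G> (osucc (CB \<G>))"
    using cb_derivative_CB_empty[OF assms(1)] cb_derivative_antimono[of "CB \<G>" "osucc (CB \<G>)" \<G>]
      less_osucc_iff[of "CB \<G>" "CB \<G>"] by auto
  then have out: "E \<notin> cb_derivative \<G> (osucc (cb_rank \<G> E))"
    unfolding cb_rank_def by (rule LeastI)
  have "E \<in> cb_derivative \<G> (osucc \<delta>)" if "\<delta> < cb_rank \<G> E" for \<delta>
    using not_less_Least[of \<delta> "\<lambda>\<gamma>. E \<notin> cb_derivative \<G> (osucc \<gamma>)"] that by (simp add: cb_rank_def)
  then have "E \<in> cb_derivative \<G> (cb_rank \<G> E)"
    using assms(2) by (subst cb_derivative_iff) (simp add: cb_derivative_osucc)
  then show ?thesis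
    using out cb_derivative_antimono[of \<gamma> "cb_rank \<G> E" \<G>]
      cb_derivative_antimono[of "osucc (cb_rank \<G> E)" \<gamma> \<G>]
    by (auto simp: osucc_le_iff not_le[symmetric])
qed

lemma cb_rank_less_CB:
  assumes "regular \<G>" "E \<in> \<G>" shows "cb_rank \<G> E < CB \<G>"
  using cb_derivative_iff_cb_rank[OF assms, of "CB \<G>"] cb_derivative_CB_empty[OF assms(1)]
  by (simp add: not_le)

lemma cb_rank_antimono:
  assumes "regular \<G>" "E \<in> \<G>" "F \<subseteq> E" shows "cb_rank \<G> E \<le> cb_rank \<G> F"
proof -
  note G = regularD[OF assms(1)]
  have "F \<in> \<G>" using hereditaryD[OF G(2) assms(2,3)] .
  moreover have "F \<in> cb_derivative \<G> (cb_rank \<G> E)"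
  proof (rule hereditaryD[OF _ _ assms(3)])
    show "hereditary (cb_derivative \<G> (cb_rank \<G> E))"
      using hereditary_spreading_cb_derivative[OF G(1-3)] by simp
    show "E \<in> cb_derivative \<G> (cb_rank \<G> E)"
      by (simp add: cb_derivative_iff_cb_rank[OF assms(1,2)])
  qed
  ultimately show ?thesis by (simp add: cb_derivative_iff_cb_rank[OF assms(1)])
qed

lemma ranked_cb_rank:
  assumes "regular \<G>" shows "ranked \<G> (cb_rank \<G>)"
  unfolding ranked_def
proof (intro conjI ballI impI)
  note G = regularD[OF assms]
  show "\<G> \<subseteq> Fpow {1..}" "hereditary \<G>" by fact+
  fix E F assume EF: "E \<in> \<G>" "F \<in> \<G>" "end_ext E F"
  let ?K = "cb_derivative \<G> (cb_rank \<G> F)"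
  have K: "hereditary ?K" "spreading ?K" "?K \<subseteq> Fpow {1..}"
    using hereditary_spreading_cb_derivative[OF G(1-3)] cb_derivative_subset[of \<G> "cb_rank \<G> F"] G(1)
    by simp_all
  have "F \<in> ?K" using cb_derivative_iff_cb_rank[OF assms EF(2)] by simp
  moreover obtain n where n: "n \<in> F - E" using EF(3) by (auto simp: end_ext_def)
  ultimately have "insert n E \<in> ?K" "E \<in> ?K"
    using hereditaryD[OF K(1)] EF(3) by (auto simp: end_ext_def)
  then have "E \<in> derivative ?K"
    using n EF(3) derivative_spreading_iff[OF K(3,1,2)] by (auto simp: end_ext_def)
  then have "E \<in> cb_derivative \<G> (osucc (cb_rank \<G> F))" by (simp add: cb_derivative_osucc)
  then show "cb_rank \<G> F < cb_rank \<G> E"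
    using cb_derivative_iff_cb_rank[OF assms EF(1)] by (simp add: osucc_le_iff)
qed

section \<open>Families of descending sequences of ordinals\<close>

text \<open>The family of finite sets whose members can be labelled by strictly decreasing ordinals
  below \<open>\<theta>\<close>, the label of \<open>n\<close> being taken from \<open>B n\<close>. If the sets \<open>B n\<close> are finite and increase with
  \<open>n\<close>, this is a regular family, and every ranked family is contained in one of this form.\<close>

definition descending :: "(nat \<Rightarrow> omega1 set) \<Rightarrow> omega1 \<Rightarrow> nat set set" where
  "descending B \<theta> = {E \<in> Fpow {1..}. \<exists>g. (\<forall>n\<in>E. g n \<in> B n \<and> g n < \<theta>) \<and>
     (\<forall>m\<in>E. \<forall>n\<in>E. m < n \<longrightarrow> g n < g m)}"

text \<open>The rank of a non-empty set is the largest label that its last element can carry, and that of the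
  empty set is \<open>\<theta>\<close>.\<close>

lemma ranked_descending:
  assumes fin: "\<And>n. finite (B n)"
  obtains \<rho> where "ranked (descending B \<theta>) \<rho>" "\<rho> {} = \<theta>"
proof -
  define W where "W E g \<longleftrightarrow> (\<forall>n\<in>E. g n \<in> B n \<and> g n < \<theta>) \<and>
     (\<forall>m\<in>E. \<forall>n\<in>E. m < n \<longrightarrow> g n < g m)" for E and g :: "nat \<Rightarrow> omega1"
  define \<rho> where "\<rho> E = (if E = {} then \<theta> else Max {g (Max E) | g. W E g})" for E
  have \<rho>: "g (Max E) \<le> \<rho> E" "\<exists>g. W E g \<and> \<rho> E = g (Max E)"
    if E: "finite E" "E \<noteq> {}" "W E g" for E g
  proof -
    let ?X = "{g (Max E) | g. W E g}"
    have "?X \<subseteq> B (Max E)" using Max_in[OF E(1,2)] by (auto simp: W_def)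
    then have fX: "finite ?X" using fin finite_subset by blast
    have "?X \<noteq> {}" using E(3) by blast
    from Max_in[OF fX this] Max_ge[OF fX, of "g (Max E)"] E
    show "g (Max E) \<le> \<rho> E" "\<exists>g. W E g \<and> \<rho> E = g (Max E)" by (auto simp: \<rho>_def)
  qed
  have "\<rho> F < \<rho> E" if EF: "E \<in> descending B \<theta>" "F \<in> descending B \<theta>" "end_ext E F" for E F
  proof -
    have F: "finite F" "F \<noteq> {}" using EF by (auto simp: descending_def Fpow_def end_ext_def)
    obtain g0 where "W F g0" using EF(2) by (auto simp: descending_def W_def)
    then obtain g where g: "W F g" "\<rho> F = g (Max F)" using \<rho>(2)[OF F] by blast
    have MF: "Max F \<in> F" using Max_in[OF F] .
    show ?thesis
    proof (cases "E = {}")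
      case True
      then show ?thesis using g MF by (simp add: \<rho>_def W_def)
    next
      case False
      have E: "finite E" "E \<subseteq> F" using EF F by (auto simp: end_ext_def intro: finite_subset)
      have ME: "Max E \<in> E" using Max_in[OF E(1) False] .
      obtain y where "y \<in> F - E" using EF(3) by (auto simp: end_ext_def)
      then have "Max E < y" "y \<le> Max F" using EF(3) ME F by (auto simp: end_ext_def)
      then have "g (Max F) < g (Max E)" using g MF ME E by (auto simp: W_def)
      moreover have "W E g" using g E by (auto simp: W_def)
      then have "g (Max E) \<le> \<rho> E" using \<rho>(1)[OF E(1) False] by blast
      ultimately show ?thesis using g(2) by simp
    qed
  qed
  moreover have "hereditary (descending B \<theta>)"
    unfolding hereditary_def
  proof (intro ballI allI impI)
    fix E F assume "E \<in> descending B \<theta>" "F \<subseteq> E"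
    then obtain g where "W E g" "E \<in> Fpow {1..}" by (auto simp: descending_def W_def)
    moreover from this \<open>F \<subseteq> E\<close> have "W F g" unfolding W_def by blast
    moreover have "F \<in> Fpow {1..}"
      using \<open>E \<in> Fpow {1..}\<close> \<open>F \<subseteq> E\<close> by (auto simp: Fpow_def intro: finite_subset)
    ultimately show "F \<in> descending B \<theta>" by (auto simp: descending_def W_def)
  qed
  moreover have "descending B \<theta> \<subseteq> Fpow {1..}" by (auto simp: descending_def)
  ultimately have "ranked (descending B \<theta>) \<rho>" by (simp add: ranked_def)
  then show ?thesis using that by (simp add: \<rho>_def)
qed

lemma spreading_descending:
  assumes "\<And>m n. m \<le> n \<Longrightarrow> B m \<subseteq> B n"
  shows "spreading (descending B \<theta>)"
  unfolding spreading_def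
proof (intro ballI allI impI)
  fix E F assume "E \<in> descending B \<theta>" and sp: "spread_of E F"
  then obtain g where E: "finite E" "E \<subseteq> {1..}" and g: "\<forall>n\<in>E. g n \<in> B n \<and> g n < \<theta>"
      "\<forall>m\<in>E. \<forall>n\<in>E. m < n \<longrightarrow> g n < g m"
    unfolding descending_def Fpow_def by blast
  obtain \<phi> where \<phi>: "strict_mono_on E \<phi>" "\<phi> ` E = F" "\<forall>x\<in>E. x \<le> \<phi> x"
    using sp unfolding spread_of_iff by blast
  have inj: "inj_on \<phi> E" using \<phi>(1) by (rule strict_mono_on_imp_inj_on)
  let ?g = "\<lambda>n. g (inv_into E \<phi> n)"
  have "?g n \<in> B n \<and> ?g n < \<theta>" if "n \<in> F" for n
    using that \<phi> g inj assms by (auto simp: subset_iff)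
  moreover have "?g n < ?g m" if "m \<in> F" "n \<in> F" "m < n" for m n
  proof -
    obtain x y where xy: "x \<in> E" "y \<in> E" "m = \<phi> x" "n = \<phi> y" using \<open>m \<in> F\<close> \<open>n \<in> F\<close> \<phi>(2) by blast
    have "x < y"
      using xy \<open>m < n\<close> strict_mono_onD[OF \<phi>(1), of y x] by (metis less_asym linorder_cases)
    then show ?thesis using xy inj g by simp
  qed
  moreover have "F \<in> Fpow {1..}" using \<phi> E by (force simp: Fpow_def)
  ultimately show "F \<in> descending B \<theta>"
    unfolding descending_def by (intro CollectI conjI exI[of _ ?g]) simp_all
qed

lemma regular_descending:
  assumes "\<And>n. finite (B n)" "\<And>m n. m \<le> n \<Longrightarrow> B m \<subseteq> B n"
  shows "regular (descending B \<theta>)" "CB (descending B \<theta>) \<le> osucc \<theta>"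
proof -
  obtain \<rho> where \<rho>: "ranked (descending B \<theta>) \<rho>" "\<rho> {} = \<theta>"
    using ranked_descending[of B \<theta>] assms(1) by metis
  then show "CB (descending B \<theta>) \<le> osucc \<theta>" using CB_le_rank[OF \<rho>(1)] by simp
  show "regular (descending B \<theta>)"
    unfolding regular_def
  proof (intro conjI)
    show "spreading (descending B \<theta>)" using assms(2) by (rule spreading_descending)
    show "compactin cantor (descending B \<theta>)"
      using rankedD(1,2)[OF \<rho>(1)] ranked_no_branch[OF \<rho>(1)] by (rule compactin_cantorI)
  qed (use rankedD[OF \<rho>(1)] in auto)
qed

text \<open>The element \<open>n\<close> of a member \<open>E\<close> is labelled by the rank of \<open>E \<inter> {..n}\<close>; only finitely many sets lie
  below \<open>n\<close>, so only finitely many labels are possible at \<open>n\<close>.\<close>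

lemma ranked_subset_regular:
  assumes "ranked \<A> \<rho>"
  obtains \<G> where "regular \<G>" "CB \<G> \<le> osucc (\<rho> {})" "\<A> \<subseteq> \<G>"
proof -
  note A = rankedD[OF assms]
  define B where "B n = \<rho> ` {D \<in> \<A>. D \<subseteq> {..n}}" for n
  have fin: "finite (B n)" for n
    unfolding B_def by (rule finite_imageI, rule finite_subset[of _ "Pow {..n}"]) auto
  have mono: "B m \<subseteq> B n" if "m \<le> n" for m n using that by (force simp: B_def)
  have "E \<in> descending B (\<rho> {})" if E: "E \<in> \<A>" for E
  proof -
    let ?g = "\<lambda>n. \<rho> (E \<inter> {..n})"
    have sub: "E \<inter> {..n} \<in> \<A>" "{} \<in> \<A>" for n using hereditaryD[OF A(2) E] by auto
    have "?g n \<in> B n" for n using sub by (auto simp: B_def)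
    moreover have "?g n < \<rho> {}" if "n \<in> E" for n
      by (rule A(3)) (use sub that in \<open>auto simp: end_ext_empty\<close>)
    moreover have "?g n < ?g m" if "n \<in> E" "m < n" for m n
    proof (rule A(3)[OF sub(1) sub(1)])
      have "n \<in> E \<inter> {..n}" "n \<notin> E \<inter> {..m}" using that by auto
      then have "E \<inter> {..n} \<noteq> E \<inter> {..m}" by blast
      then show "end_ext (E \<inter> {..m}) (E \<inter> {..n})"
        by (intro end_ext_if_Int_atMost_eq[of _ m]) (use that in auto)
    qed
    ultimately show ?thesis using E A(1) by (auto simp: descending_def intro!: exI[of _ ?g])
  qed
  then show ?thesis
    using that[of "descending B (\<rho> {})"] regular_descending[of B, OF fin mono] by blast
qed

section \<open>Diagonalization and Galvin's lemma\<close>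

lemma Ipow_trans: "N \<in> Ipow M \<Longrightarrow> M \<in> Ipow L \<Longrightarrow> N \<in> Ipow L"
  by (auto simp: Ipow_def)

lemma Ipow_refl: "N \<in> Ipow M \<Longrightarrow> N \<in> Ipow N"
  by (auto simp: Ipow_def)

lemma Ipow_greater: "M \<in> Ipow L \<Longrightarrow> {n \<in> M. m < n} \<in> Ipow M"
proof -
  assume "M \<in> Ipow L"
  then have "infinite (M - {..m})" by (simp add: Ipow_def Diff_infinite_finite)
  moreover have "M - {..m} = {n \<in> M. m < n}" by auto
  ultimately show ?thesis by (simp add: Ipow_def)
qed

lemma least_mem:
  assumes "N \<in> Ipow M"
  shows "(LEAST n. n \<in> N) \<in> N" "n \<in> N \<Longrightarrow> (LEAST n. n \<in> N) \<le> n"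
proof -
  have "N \<noteq> {}" using assms by (auto simp: Ipow_def)
  then show "(LEAST n. n \<in> N) \<in> N" by (auto intro: LeastI)
qed (rule Least_le)

lemma Ipow_finite_dense:
  assumes down: "\<And>D N N'. \<Phi> D N \<Longrightarrow> N' \<in> Ipow N \<Longrightarrow> \<Phi> D N'"
    and dense: "\<And>D N. N \<in> Ipow L \<Longrightarrow> \<exists>N'\<in>Ipow N. \<Phi> D N'"
    and "finite X" "N \<in> Ipow L"
  shows "\<exists>N'\<in>Ipow N. \<forall>D\<in>X. \<Phi> D N'"
  using assms(3)
proof induction
  case empty
  then show ?case using Ipow_refl[OF assms(4)] by blast
next
  case (insert D X)
  then obtain N1 where N1: "N1 \<in> Ipow N" "\<forall>D\<in>X. \<Phi> D N1" by blast
  then obtain N2 where "N2 \<in> Ipow N1" "\<Phi> D N2"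
    using dense[of N1 D] Ipow_trans[OF N1(1) assms(4)] by blast
  then show ?case using N1 down Ipow_trans by blast
qed

text \<open>The diagonal argument: a property, indexed by finite sets, that is inherited by infinite
  subsets and can be achieved inside every infinite set holds on suitable tails of one set, for
  all indices at once.\<close>

lemma fusion:
  assumes down: "\<And>D N N'. \<Phi> D N \<Longrightarrow> N' \<in> Ipow N \<Longrightarrow> \<Phi> D N'"
    and dense: "\<And>D N. N \<in> Ipow L \<Longrightarrow> \<exists>N'\<in>Ipow N. \<Phi> D N'"
    and L: "L \<in> Ipow {1..}"
  shows "\<exists>M\<in>Ipow L. \<Phi> {} M \<and> (\<forall>m\<in>M. \<forall>D. D \<subseteq> {..m} \<longrightarrow> \<Phi> D {n \<in> M. m < n})"
proof -
  define R where "R = (\<lambda>N N'. N' \<in> Ipow {n \<in> N. (LEAST n. n \<in> N) < n} \<and>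
    (\<forall>D. D \<subseteq> {..LEAST n. n \<in> N} \<longrightarrow> \<Phi> D N'))"
  obtain N0 where N0: "N0 \<in> Ipow L" "\<Phi> {} N0" using dense[of L "{}"] Ipow_refl[OF L] by blast
  have "\<exists>N'. N' \<in> Ipow L \<and> R N N'" if N: "N \<in> Ipow L" for N
  proof -
    let ?n = "LEAST n. n \<in> N"
    have tail: "{n \<in> N. ?n < n} \<in> Ipow N" using Ipow_greater[OF N] .
    then have "{n \<in> N. ?n < n} \<in> Ipow L" using N Ipow_trans by blast
    then have "\<exists>N'\<in>Ipow {n \<in> N. ?n < n}. \<forall>D\<in>Pow {..?n}. \<Phi> D N'"
      using Ipow_finite_dense[where \<Phi> = \<Phi> and L = L, OF down dense] by simp
    then obtain N' where "N' \<in> Ipow {n \<in> N. ?n < n}" "\<forall>D\<in>Pow {..?n}. \<Phi> D N'" by blast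
    then show ?thesis using tail N Ipow_trans unfolding R_def by blast
  qed
  then have "\<exists>S. \<forall>i. (S i \<in> Ipow L \<and> (i = 0 \<longrightarrow> S i = N0)) \<and> R (S i) (S (Suc i))"
    by (intro dependent_nat_choice) (use N0(1) in auto)
  then obtain S where S0: "S 0 = N0" and SL: "\<And>i. S i \<in> Ipow L" and SR: "\<And>i. R (S i) (S (Suc i))"
    by blast
  define m where "m i = (LEAST n. n \<in> S i)" for i
  have mS: "m i \<in> S i" for i
  proof -
    have "S i \<noteq> {}" using SL[of i] by (auto simp: Ipow_def)
    then show ?thesis unfolding m_def by (meson LeastI ex_in_conv)
  qed
  have step: "S (Suc i) \<subseteq> {n \<in> S i. m i < n}" for i
    using SR[of i] by (auto simp: R_def m_def Ipow_def)
  have anti: "S j \<subseteq> S i" if "i \<le> j" for i j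
    using that by (induction rule: dec_induct) (use step in auto)
  have mono: "strict_mono m"
    unfolding strict_mono_Suc_iff using step mS by blast
  let ?M = "range m"
  have inf_M: "infinite ?M" using mono strict_mono_imp_inj_on range_inj_infinite by blast
  have Msub: "?M \<in> Ipow L"
    using inf_M mS SL by (auto simp: Ipow_def)
  show ?thesis
  proof (intro bexI[OF _ Msub] conjI ballI allI impI)
    have "?M \<in> Ipow N0" using inf_M mS anti[of 0] S0 by (auto simp: Ipow_def)
    then show "\<Phi> {} ?M" using N0(2) down by blast
  next
    fix k D assume k: "k \<in> ?M" and D: "D \<subseteq> {..k}"
    then obtain i where i: "k = m i" by blast
    have "{n \<in> ?M. k < n} \<subseteq> S (Suc i)"
    proof safe
      fix j assume "k < m j"
      then have "Suc i \<le> j" using mono i by (simp add: strict_mono_less Suc_le_eq)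
      then show "m j \<in> S (Suc i)" using anti mS by blast
    qed
    moreover have "infinite {n \<in> ?M. k < n}" using Ipow_greater[OF Msub] by (simp add: Ipow_def)
    ultimately have "{n \<in> ?M. k < n} \<in> Ipow (S (Suc i))" by (simp add: Ipow_def)
    moreover have "\<Phi> D (S (Suc i))" using SR[of i] D i by (simp add: R_def m_def)
    ultimately show "\<Phi> D {n \<in> ?M. k < n}" using down by blast
  qed
qed

text \<open>Galvin's lemma. Here \<open>N\<close> accepts a finite set \<open>s\<close> if \<open>s \<union> N'\<close> has an initial segment in \<open>\<F>\<close> for every
  infinite \<open>N' \<subseteq> N\<close> after \<open>s\<close>, and \<open>N\<close> rejects \<open>s\<close> if no infinite subset of \<open>N\<close> accepts \<open>s\<close>.\<close>

lemma galvin: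
  fixes \<F> :: "nat set set"
  assumes L: "L \<in> Ipow {1..}"
  shows "\<exists>M\<in>Ipow L. (\<forall>E\<in>\<F>. \<not> (finite E \<and> E \<subseteq> M)) \<or> (\<forall>N\<in>Ipow M. \<exists>k. N \<inter> {..<k} \<in> \<F>)"
proof -
  define acc where "acc s N \<longleftrightarrow>
    (\<forall>N'\<in>Ipow N. (\<forall>x\<in>s. \<forall>y\<in>N'. x < y) \<longrightarrow> (\<exists>k. (s \<union> N') \<inter> {..<k} \<in> \<F>))" for s N
  define rej where "rej s N \<longleftrightarrow> (\<forall>N'\<in>Ipow N. \<not> acc s N')" for s N
  have accD: "\<exists>k. (s \<union> N') \<inter> {..<k} \<in> \<F>"
    if "acc s N" "N' \<in> Ipow N" "\<And>x y. x \<in> s \<Longrightarrow> y \<in> N' \<Longrightarrow> x < y" for s N N'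
    using that(1)[unfolded acc_def, rule_format, OF that(2)] that(3) by simp
  have acc_down: "acc s N'" if "acc s N" "N' \<in> Ipow N" for s N N'
    using that Ipow_trans unfolding acc_def by blast
  have rej_down: "rej s N'" if "rej s N" "N' \<in> Ipow N" for s N N'
    using that Ipow_trans unfolding rej_def by blast
  have d1: "acc D N' \<or> rej D N'" if "acc D N \<or> rej D N" "N' \<in> Ipow N" for D N N'
    using that acc_down rej_down by blast
  have d2: "\<exists>N'\<in>Ipow N. acc D N' \<or> rej D N'" if "N \<in> Ipow L" for D N
    using Ipow_refl[OF that] unfolding rej_def by blast
  obtain M where M: "M \<in> Ipow L" "acc {} M \<or> rej {} M"
      "\<And>m D. m \<in> M \<Longrightarrow> D \<subseteq> {..m} \<Longrightarrow> acc D {n \<in> M. m < n} \<or> rej D {n \<in> M. m < n}"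
  proof -
    have "\<exists>M\<in>Ipow L. (acc {} M \<or> rej {} M) \<and>
        (\<forall>m\<in>M. \<forall>D. D \<subseteq> {..m} \<longrightarrow> acc D {n \<in> M. m < n} \<or> rej D {n \<in> M. m < n})"
      by (rule fusion[where \<Phi> = "\<lambda>D N. acc D N \<or> rej D N"]) (use d1 d2 L in blast)+
    then show ?thesis using that by blast
  qed
  have decided: "acc s M \<or> rej s M" if s: "s \<subseteq> M" "finite s" for s
  proof (cases "s = {}")
    case False
    let ?T = "{n \<in> M. Max s < n}"
    have *: "Max s \<in> M" "s \<subseteq> {..Max s}" using s False Max_in by auto
    have "acc s M" if "acc s ?T"
      unfolding acc_def
    proof (intro ballI impI)
      fix N' assume "N' \<in> Ipow M" "\<forall>x\<in>s. \<forall>y\<in>N'. x < y"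
      then have "N' \<in> Ipow ?T" using Max_in[OF s(2) False] by (auto simp: Ipow_def)
      then show "\<exists>k. (s \<union> N') \<inter> {..<k} \<in> \<F>"
        using accD[OF \<open>acc s ?T\<close>] \<open>\<forall>x\<in>s. \<forall>y\<in>N'. x < y\<close> by simp
    qed
    moreover have "rej s M" if "rej s ?T"
      unfolding rej_def
    proof (intro ballI notI)
      fix N' assume N': "N' \<in> Ipow M" "acc s N'"
      then have "{n \<in> N'. Max s < n} \<in> Ipow N'" using Ipow_greater by blast
      moreover from this have "{n \<in> N'. Max s < n} \<in> Ipow ?T" using N'(1) by (auto simp: Ipow_def)
      ultimately show False using \<open>rej s ?T\<close> N' acc_down unfolding rej_def by blast
    qed
    ultimately show ?thesis using M(3)[OF *] by blast
  qed (use M(2) in simp)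
  show ?thesis
  proof (cases "acc {} M")
    case True
    then show ?thesis using M(1) unfolding acc_def by auto
  next
    case False
    then have rej0: "rej {} M" using M(2) by blast
    \<comment> \<open>if \<open>M\<close> rejects \<open>s\<close>, it rejects all but finitely many one-point end-extensions of \<open>s\<close>,
      so a second diagonal argument gives a set all of whose finite subsets are rejected\<close>
    define \<Psi> where "\<Psi> s N \<longleftrightarrow> (s \<subseteq> M \<and> finite s \<and> rej s M \<longrightarrow>
      (\<forall>n\<in>N. (\<forall>x\<in>s. x < n) \<longrightarrow> rej (insert n s) M))" for s N
    have PsiD: "rej (insert n s) M"
      if "\<Psi> s N" "s \<subseteq> M" "finite s" "rej s M" "n \<in> N" "\<And>x. x \<in> s \<Longrightarrow> x < n" for s N n
      using that unfolding \<Psi>_def by blast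
    have e2: "\<exists>N'\<in>Ipow N. \<Psi> s N'" if N: "N \<in> Ipow M" for s N
    proof (cases "s \<subseteq> M \<and> finite s \<and> rej s M")
      case True
      let ?B = "{n \<in> N. (\<forall>x\<in>s. x < n) \<and> \<not> rej (insert n s) M}"
      have "finite ?B"
      proof (rule ccontr)
        assume "infinite ?B"
        then have B: "?B \<in> Ipow M" using N by (auto simp: Ipow_def)
        have "acc s ?B"
          unfolding acc_def
        proof (intro ballI impI)
          fix N' assume N': "N' \<in> Ipow ?B" "\<forall>x\<in>s. \<forall>y\<in>N'. x < y"
          define n where "n = (LEAST n. n \<in> N')"
          have n: "n \<in> N'" "\<And>y. y \<in> N' \<Longrightarrow> n \<le> y"
            using least_mem[OF N'(1)] by (simp_all add: n_def)
          have "n \<in> ?B" using n(1) N'(1) unfolding Ipow_def by blast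
          then have a1: "acc (insert n s) M"
            using decided[of "insert n s"] True N unfolding Ipow_def by blast
          have a2: "{y \<in> N'. n < y} \<in> Ipow M"
            by (rule Ipow_trans[OF Ipow_trans[OF Ipow_greater[OF N'(1)] N'(1)] B])
          have "\<exists>k. (insert n s \<union> {y \<in> N'. n < y}) \<inter> {..<k} \<in> \<F>"
            by (rule accD[OF a1 a2]) (use N'(2) in auto)
          moreover have "insert n s \<union> {y \<in> N'. n < y} = s \<union> N'"
            using n by (auto simp: order_le_less)
          ultimately show "\<exists>k. (s \<union> N') \<inter> {..<k} \<in> \<F>" by simp
        qed
        then show False using True B unfolding rej_def by blast
      qed
      then have "N - ?B \<in> Ipow N" using N by (auto simp: Ipow_def)
      moreover have "\<Psi> s (N - ?B)" by (auto simp: \<Psi>_def)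
      ultimately show ?thesis by blast
    next
      case False
      then show ?thesis using Ipow_refl[OF N] by (auto simp: \<Psi>_def)
    qed
    have e1: "\<Psi> s N'" if "\<Psi> s N" "N' \<in> Ipow N" for s N N'
      using that by (auto simp: \<Psi>_def Ipow_def)
    have e3: "M \<in> Ipow {1..}" by (rule Ipow_trans[OF M(1) L])
    obtain P where P: "P \<in> Ipow M" "\<Psi> {} P"
        "\<And>m D. m \<in> P \<Longrightarrow> D \<subseteq> {..m} \<Longrightarrow> \<Psi> D {n \<in> P. m < n}"
    proof -
      have "\<exists>P\<in>Ipow M. \<Psi> {} P \<and> (\<forall>m\<in>P. \<forall>D. D \<subseteq> {..m} \<longrightarrow> \<Psi> D {n \<in> P. m < n})"
        by (rule fusion[where \<Phi> = \<Psi>]) (use e1 e2 e3 in blast)+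
      then show ?thesis using that by blast
    qed
    have "rej s M" if "finite s" "s \<subseteq> P" for s
      using that
    proof (induction s rule: finite_linorder_max_induct)
      case (insert n s)
      then have s: "rej s M" "s \<subseteq> M" "n \<in> P" using P(1) by (auto simp: Ipow_def)
      show ?case
      proof (cases "s = {}")
        case True
        show ?thesis by (rule PsiD[OF _ s(2) insert(1) s(1), of P]) (use True P(2) s in auto)
      next
        case False
        then have "Max s \<in> s" using insert(1) by (rule Max_in[rotated])
        then have m: "Max s \<in> P" "s \<subseteq> {..Max s}" "Max s < n" using insert by auto
        show ?thesis
          by (rule PsiD[OF P(3)[OF m(1,2)] s(2) insert(1) s(1)]) (use m s insert(2) in auto)
      qed
    qed (use rej0 in simp)
    note rejP = this
    have "\<not> (finite E \<and> E \<subseteq> P)" if "E \<in> \<F>" for E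
    proof -
      have "acc E M" if "finite E"
        unfolding acc_def
      proof (intro ballI impI)
        fix N' assume N': "N' \<in> Ipow M" "\<forall>x\<in>E. \<forall>y\<in>N'. x < y"
        define k where "k = (LEAST n. n \<in> N')"
        have "k \<in> N'" "\<And>y. y \<in> N' \<Longrightarrow> k \<le> y" using least_mem[OF N'(1)] by (simp_all add: k_def)
        then have "(E \<union> N') \<inter> {..<k} = E" using N'(2) by force
        then show "\<exists>k. (E \<union> N') \<inter> {..<k} \<in> \<F>" using \<open>E \<in> \<F>\<close> by metis
      qed
      moreover have "M \<in> Ipow M" using Ipow_refl[OF M(1)] .
      ultimately show ?thesis
        using rejP[of E] unfolding rej_def by blast
    qed
    then show ?thesis by (intro bexI[OF _ Ipow_trans[OF P(1) M(1)]] disjI1 ballI)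
  qed
qed

text \<open>The resulting dichotomy for hereditary families: one of \<open>\<A>\<close> and \<open>\<E>\<close> contains the other one on
  an infinite set.\<close>

lemma hereditary_dichotomy:
  assumes A: "hereditary \<A>" "\<A> \<subseteq> Fpow {1..}" and E: "hereditary \<E>" "\<E> \<subseteq> Fpow {1..}"
    and L: "L \<in> Ipow {1..}"
  shows "\<exists>M\<in>Ipow L. (\<forall>E\<in>\<A>. E \<subseteq> M \<longrightarrow> E \<in> \<E>) \<or> (\<forall>E\<in>\<E>. E \<subseteq> M \<longrightarrow> E \<in> \<A>)"
proof -
  obtain M where M: "M \<in> Ipow L"
      "(\<forall>E\<in>\<A> - \<E>. \<not> (finite E \<and> E \<subseteq> M)) \<or> (\<forall>N\<in>Ipow M. \<exists>k. N \<inter> {..<k} \<in> \<A> - \<E>)"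
    using galvin[OF L, of "\<A> - \<E>"] by auto
  from M(2) show ?thesis
  proof
    assume "\<forall>E\<in>\<A> - \<E>. \<not> (finite E \<and> E \<subseteq> M)"
    then have "\<forall>E\<in>\<A>. E \<subseteq> M \<longrightarrow> E \<in> \<E>" using A(2) unfolding Fpow_def by blast
    then show ?thesis using M(1) by blast
  next
    assume *: "\<forall>N\<in>Ipow M. \<exists>k. N \<inter> {..<k} \<in> \<A> - \<E>"
    have "E \<in> \<A>" if EE: "E \<in> \<E>" "E \<subseteq> M" for E
    proof (rule ccontr)
      assume EA: "E \<notin> \<A>"
      have fin: "finite E" using EE E(2) by (auto simp: Fpow_def)
      define N where "N = E \<union> {n \<in> M. \<forall>x\<in>E. x < n}"
      obtain b where b: "E \<subseteq> {..b}" using fin finite_nat_iff_bounded_le by blast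
      then have "{n \<in> M. b < n} \<subseteq> N" by (auto simp: N_def)
      moreover have "infinite {n \<in> M. b < n}" using Ipow_greater[OF M(1)] by (simp add: Ipow_def)
      ultimately have "infinite N" using finite_subset by blast
      then have "N \<in> Ipow M" using EE(2) by (auto simp: N_def Ipow_def)
      then obtain k where k: "N \<inter> {..<k} \<in> \<A>" "N \<inter> {..<k} \<notin> \<E>" using * by blast
      have "N \<inter> {..<k} \<subseteq> E"
      proof (rule ccontr)
        assume "\<not> ?thesis"
        then obtain y where "y \<in> N" "y < k" "y \<notin> E" by auto
        then have "E \<subseteq> N \<inter> {..<k}" by (force simp: N_def)
        then show False using hereditaryD[OF A(1) k(1)] EA by blast
      qed
      then show False using k(2) hereditaryD[OF E(1) EE(1)] by blast
    qed
    then show ?thesis using M(1) by blast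
  qed
qed

section \<open>Unions of successive sets\<close>

text \<open>\<open>decomp \<A> F X\<close>: the set \<open>F\<close> is the union of finitely many successive non-empty members of \<open>\<A>\<close>,
  and \<open>X\<close> is the set of their minima.\<close>

inductive decomp :: "nat set set \<Rightarrow> nat set \<Rightarrow> nat set \<Rightarrow> bool" for \<A> where
  empty: "decomp \<A> {} {}"
| insert: "E \<in> \<A> \<Longrightarrow> E \<noteq> {} \<Longrightarrow> finite E \<Longrightarrow> \<forall>x\<in>E. \<forall>y\<in>F. x < y \<Longrightarrow> decomp \<A> F X \<Longrightarrow>
    decomp \<A> (E \<union> F) (insert (Min E) X)"

lemma decomp_finite: "decomp \<A> F X \<Longrightarrow> finite F \<and> finite X \<and> X \<subseteq> F \<and> (F \<noteq> {} \<longrightarrow> X \<noteq> {})"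
  by (induction rule: decomp.induct) auto

lemma Min_less_of_less:
  fixes E F :: "nat set"
  assumes "E \<noteq> {}" "finite E" "\<forall>x\<in>E. \<forall>y\<in>F. x < y" "X \<subseteq> F" "x \<in> X"
  shows "Min E < x"
  using assms Min_in[of E] by blast

lemma decomp_Min: "decomp \<A> F X \<Longrightarrow> F \<noteq> {} \<Longrightarrow> Min X = Min F"
proof (induction rule: decomp.induct)
  case (insert E F X)
  have X: "finite F" "finite X" "X \<subseteq> F" using decomp_finite[OF insert(5)] by auto
  have E: "Min E \<in> E" using insert by simp
  have lt: "Min E \<le> y" if "y \<in> F" for y
    using insert(4) E that by (blast intro: less_imp_le)
  have "Min (insert (Min E) X) = Min E"
    by (rule Min_eqI) (use X E lt in auto)
  moreover have "Min (E \<union> F) = Min E"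
    by (rule Min_eqI) (use X E lt insert(3) in auto)
  ultimately show ?case by simp
qed simp

lemma decomp_singleton: "E \<in> \<A> \<Longrightarrow> E \<noteq> {} \<Longrightarrow> finite E \<Longrightarrow> decomp \<A> E {Min E}"
  using decomp.insert[of E \<A> "{}" "{}"] decomp.empty by simp

text \<open>A subset of a decomposed set is decomposed by the traces of the pieces. Their minima are a spread of
  some of the original ones, as expressed by the map \<open>\<phi>\<close>.\<close>

lemma decomp_subset:
  assumes "hereditary \<A>"
  shows "decomp \<A> F X \<Longrightarrow> F' \<subseteq> F \<Longrightarrow>
    \<exists>X' \<phi>. decomp \<A> F' X' \<and> strict_mono_on X' \<phi> \<and> \<phi> ` X' \<subseteq> X \<and> (\<forall>x\<in>X'. \<phi> x \<le> x)"
proof (induction arbitrary: F' rule: decomp.induct)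
  case empty
  then show ?case using decomp.empty by (intro exI[of _ "{}"] exI[of _ id]) auto
next
  case (insert E F X)
  define E' where "E' = E \<inter> F'"
  define G where "G = F' \<inter> F"
  have F': "F' = E' \<union> G" using insert.prems by (auto simp: E'_def G_def)
  obtain X' \<phi> where IH: "decomp \<A> G X'" "strict_mono_on X' \<phi>" "\<phi> ` X' \<subseteq> X" "\<forall>x\<in>X'. \<phi> x \<le> x"
    using insert.IH[of G] by (auto simp: G_def)
  show ?case
  proof (cases "E' = {}")
    case True
    then show ?thesis using IH F' by auto
  next
    case False
    have X': "X' \<subseteq> G" and XF: "X \<subseteq> F" using decomp_finite IH(1) insert(5) by blast+
    have E': "E' \<in> \<A>" "finite E'" "\<forall>x\<in>E'. \<forall>y\<in>G. x < y"
      using insert(1,3,4) hereditaryD[OF assms insert(1), of E'] by (auto simp: E'_def G_def)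
    have "decomp \<A> F' (insert (Min E') X')"
      unfolding F' using E' False IH(1) by (intro decomp.insert)
    have lt: "Min E' < x" if "x \<in> X'" for x using Min_less_of_less[OF False E'(2,3) X' that] .
    let ?\<phi> = "\<phi>(Min E' := Min E)"
    have lt': "Min E < x" if "x \<in> X" for x
      by (rule Min_less_of_less[OF insert(2,3,4) XF that])
    have "strict_mono_on (insert (Min E') X') ?\<phi>"
    proof (rule strict_mono_onI)
      fix x y assume xy: "x \<in> insert (Min E') X'" "y \<in> insert (Min E') X'" "x < y"
      then have y: "y \<in> X'" "y \<noteq> Min E'" using lt[of x] by auto
      show "?\<phi> x < ?\<phi> y"
      proof (cases "x = Min E'")
        case True
        then show ?thesis using y IH(3) lt' by auto
      next
        case False
        then show ?thesis using y xy strict_mono_onD[OF IH(2), of x y] by auto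
      qed
    qed
    moreover have "?\<phi> ` insert (Min E') X' \<subseteq> insert (Min E) X" using IH(3) by auto
    moreover have "Min E \<le> Min E'" by (rule Min_antimono) (use False insert(3) in \<open>auto simp: E'_def\<close>)
    then have "\<forall>x\<in>insert (Min E') X'. ?\<phi> x \<le> x" using IH(4) by auto
    ultimately show ?thesis using \<open>decomp \<A> F' (insert (Min E') X')\<close> by blast
  qed
qed

lemma decomp_image:
  assumes "spreading \<A>"
  shows "decomp \<A> F X \<Longrightarrow> strict_mono_on F \<phi> \<Longrightarrow> (\<And>x. x \<in> F \<Longrightarrow> x \<le> \<phi> x) \<Longrightarrow> decomp \<A> (\<phi> ` F) (\<phi> ` X)"
proof (induction rule: decomp.induct)
  case empty
  then show ?case using decomp.empty by simp
next
  case (insert E F X)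
  have mono: "strict_mono_on E \<phi>" "strict_mono_on F \<phi>"
    using insert.prems(1) by (auto simp: strict_mono_on_def)
  have "Min (\<phi> ` E) = \<phi> (Min E)"
  proof (rule Min_eqI)
    fix y assume "y \<in> \<phi> ` E"
    then obtain x where x: "x \<in> E" "y = \<phi> x" by blast
    then have "Min E \<le> x" "Min E \<in> E" using insert(2,3) by auto
    then show "\<phi> (Min E) \<le> y"
      using x strict_mono_onD[OF mono(1), of "Min E" x] by (cases "Min E = x") auto
  qed (use insert(2,3) in auto)
  moreover have "decomp \<A> (\<phi> ` E \<union> \<phi> ` F) (insert (Min (\<phi> ` E)) (\<phi> ` X))"
  proof (rule decomp.insert)
    show "\<phi> ` E \<in> \<A>" by (rule spreading_image[OF assms insert(1,3) mono(1)]) (use insert.prems in auto)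
    show "\<forall>x\<in>\<phi> ` E. \<forall>y\<in>\<phi> ` F. x < y"
      using insert(4) strict_mono_onD[OF insert.prems(1)] by blast
    show "decomp \<A> (\<phi> ` F) (\<phi> ` X)" by (rule insert.IH[OF mono(2)]) (use insert.prems in auto)
  qed (use insert in auto)
  ultimately show ?case by (simp add: image_Un)
qed

text \<open>The family \<open>\<F>[\<A>]\<close>, phrased in terms of \<open>decomp\<close>. It agrees with \<^const>\<open>compose_families\<close> if
  \<open>{} \<in> \<F>\<close> and the members of \<open>\<A>\<close> are finite sets of positive numbers.\<close>

definition composition :: "nat set set \<Rightarrow> nat set set \<Rightarrow> nat set set" where
  "composition \<F> \<A> = {F. \<exists>X\<in>\<F>. decomp \<A> F X}"

lemma compositionI: "decomp \<A> F X \<Longrightarrow> X \<in> \<F> \<Longrightarrow> F \<in> composition \<F> \<A>"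
  unfolding composition_def by blast

lemma composition_mono: "\<F> \<subseteq> \<G> \<Longrightarrow> composition \<F> \<A> \<subseteq> composition \<G> \<A>"
  by (auto simp: composition_def)

lemma composition_subset:
  assumes "\<A> \<subseteq> Fpow {1..}" shows "composition \<F> \<A> \<subseteq> Fpow {1..}"
proof -
  have "F \<subseteq> {1..}" if "decomp \<A> F X" for F X
    using that by induction (use assms in \<open>auto simp: Fpow_def\<close>)
  then show ?thesis using decomp_finite unfolding composition_def Fpow_def by blast
qed

lemma hereditary_composition:
  assumes "hereditary \<F>" "spreading \<F>" "hereditary \<A>" shows "hereditary (composition \<F> \<A>)"
  unfolding hereditary_def
proof (intro ballI allI impI)
  fix F F' assume "F \<in> composition \<F> \<A>" "F' \<subseteq> F"
  then obtain X where X: "X \<in> \<F>" "decomp \<A> F X" by (auto simp: composition_def)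
  obtain X' \<phi> where X': "decomp \<A> F' X'" "strict_mono_on X' \<phi>" "\<phi> ` X' \<subseteq> X" "\<forall>x\<in>X'. \<phi> x \<le> x"
    using decomp_subset[OF assms(3) X(2) \<open>F' \<subseteq> F\<close>] by blast
  have "\<phi> ` X' \<in> \<F>" using hereditaryD[OF assms(1) X(1) X'(3)] .
  then have "X' \<in> \<F>"
    by (rule spreading_of_dominated[OF assms(2)]) (use X' decomp_finite[OF X'(1)] in auto)
  then show "F' \<in> composition \<F> \<A>" using X'(1) by (auto simp: composition_def)
qed

lemma spreading_composition:
  assumes "spreading \<F>" "spreading \<A>" shows "spreading (composition \<F> \<A>)"
  unfolding spreading_def
proof (intro ballI allI impI)
  fix E F assume "E \<in> composition \<F> \<A>" and sp: "spread_of E F"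
  then obtain X where X: "X \<in> \<F>" "decomp \<A> E X" by (auto simp: composition_def)
  obtain \<phi> where \<phi>: "strict_mono_on E \<phi>" "\<phi> ` E = F" "\<forall>x\<in>E. x \<le> \<phi> x"
    using sp unfolding spread_of_iff by blast
  have XE: "finite X" "X \<subseteq> E" using decomp_finite[OF X(2)] by auto
  have "decomp \<A> F (\<phi> ` X)" using decomp_image[OF assms(2) X(2) \<phi>(1)] \<phi> by auto
  moreover have "strict_mono_on X \<phi>" using \<phi>(1) XE(2) by (auto simp: strict_mono_on_def)
  then have "\<phi> ` X \<in> \<F>" by (rule spreading_image[OF assms(1) X(1) XE(1)]) (use XE \<phi> in auto)
  ultimately show "F \<in> composition \<F> \<A>" by (auto simp: composition_def)
qed

lemma before_chain:
  assumes "\<forall>i\<in>{1..n}. E i \<noteq> {} \<and> finite (E i)" "\<forall>i\<in>{1..<n}. before (E i) (E (Suc i))"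
    and "1 \<le> i" "i < j" "j \<le> n"
  shows "\<forall>x\<in>E i. \<forall>y\<in>E j. x < y"
proof -
  have step: "\<forall>x\<in>E k. \<forall>y\<in>E (Suc k). x < y" if "1 \<le> k" "k < n" for k
  proof -
    have *: "Max (E k) < Min (E (Suc k))" "finite (E k)" "finite (E (Suc k))"
      using that assms(1,2) by (auto simp: before_def)
    show ?thesis
      using Max_ge[OF *(2)] Min_le[OF *(3)] *(1) by (meson le_less_trans less_le_trans)
  qed
  have "i < j \<Longrightarrow> j \<le> n \<Longrightarrow> \<forall>x\<in>E i. \<forall>y\<in>E j. x < y"
  proof (induction j)
    case (Suc j)
    show ?case
    proof (cases "i = j")
      case True
      then show ?thesis using step[of j] assms(3) Suc by simp
    next
      case False
      then have "\<forall>x\<in>E i. \<forall>y\<in>E j. x < y" using Suc by simp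
      moreover have "\<forall>x\<in>E j. \<forall>y\<in>E (Suc j). x < y" using step[of j] Suc assms(3) by simp
      moreover obtain z where "z \<in> E j" using assms(1,3) Suc False by fastforce
      ultimately show ?thesis by (meson less_trans)
    qed
  qed simp
  then show ?thesis using assms(4,5) .
qed

lemma decomp_of_sequence:
  assumes "\<forall>i\<in>{1..n}. E i \<noteq> {} \<and> finite (E i) \<and> E i \<in> \<A>" "\<forall>i\<in>{1..<n}. before (E i) (E (Suc i))"
    and "1 \<le> a" "a \<le> Suc b" "b \<le> n"
  shows "decomp \<A> (\<Union>i\<in>{a..b}. E i) ((\<lambda>i. Min (E i)) ` {a..b})"
  using assms(4,3)
proof (induction a rule: inc_induct)
  case base
  then show ?case using decomp.empty by simp
next
  case (step a)
  have "\<forall>x\<in>E a. \<forall>y\<in>E j. x < y" if "j \<in> {Suc a..b}" for j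
    using before_chain[of n E a j] assms(1,2,5) step that by auto
  then have "\<forall>x\<in>E a. \<forall>y\<in>(\<Union>i\<in>{Suc a..b}. E i). x < y" by blast
  then have "decomp \<A> (E a \<union> (\<Union>i\<in>{Suc a..b}. E i)) (insert (Min (E a)) ((\<lambda>i. Min (E i)) ` {Suc a..b}))"
    using assms(1,5) step by (intro decomp.insert) auto
  moreover have "{a..b} = insert a {Suc a..b}" using step by auto
  ultimately show ?case by simp
qed

lemma sequence_of_decomp:
  "decomp \<A> F X \<Longrightarrow> \<exists>E n. F = (\<Union>i\<in>{1..n}. E i) \<and> (\<forall>i\<in>{1..n}. E i \<noteq> {} \<and> E i \<in> \<A>) \<and>
    (\<forall>i\<in>{1..<n}. before (E i) (E (Suc i))) \<and> X = (\<lambda>i. Min (E i)) ` {1..n} \<and> n = card X"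
proof (induction rule: decomp.induct)
  case empty
  then show ?case by (intro exI[of _ "\<lambda>_. {}"] exI[of _ 0]) auto
next
  case (insert D F X)
  then obtain E n where IH: "F = (\<Union>i\<in>{1..n}. E i)" "\<forall>i\<in>{1..n}. E i \<noteq> {} \<and> E i \<in> \<A>"
      "\<forall>i\<in>{1..<n}. before (E i) (E (Suc i))" "X = (\<lambda>i. Min (E i)) ` {1..n}" "n = card X" by blast
  define E' where "E' i = (if i = 1 then D else E (i - 1))" for i
  have iv: "{1..Suc n} = insert 1 (Suc ` {1..n})" by (auto simp: image_Suc_atLeastAtMost)
  have E'S: "E' (Suc i) = E i" if "i \<in> {1..n}" for i using that by (simp add: E'_def)
  have E'1: "E' 1 = D" by (simp add: E'_def)
  have fin: "finite F" "X \<subseteq> F" "finite X" using decomp_finite[OF insert(5)] by auto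
  have "(\<lambda>i. E' (Suc i)) ` {1..n} = E ` {1..n}" by (rule image_cong) (use E'S in auto)
  then have "D \<union> F = (\<Union>i\<in>{1..Suc n}. E' i)"
    by (simp only: iv image_insert image_image Union_insert E'1 IH(1))
  moreover have "\<forall>i\<in>{1..Suc n}. E' i \<noteq> {} \<and> E' i \<in> \<A>"
  proof
    fix i assume "i \<in> {1..Suc n}"
    then consider "i = 1" | j where "j \<in> {1..n}" "i = Suc j" unfolding iv by blast
    then show "E' i \<noteq> {} \<and> E' i \<in> \<A>" by cases (use E'S E'1 IH(2) insert(1,2) in auto)
  qed
  moreover have "\<forall>i\<in>{1..<Suc n}. before (E' i) (E' (Suc i))"
  proof
    fix i assume i: "i \<in> {1..<Suc n}"
    show "before (E' i) (E' (Suc i))"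
    proof (cases "i = 1")
      case True
      then have ne: "E 1 \<noteq> {}" "E 1 \<subseteq> F" using i IH(1,2) by auto
      then have "finite (E 1)" using fin finite_subset by blast
      then have "Min (E 1) \<in> F" using ne Min_in by blast
      moreover have "Max D \<in> D" using insert by simp
      ultimately have "Max D < Min (E 1)" using insert(4) by blast
      then show ?thesis using True by (simp add: E'_def before_def)
    next
      case False
      then obtain j where "i = Suc j" "j \<in> {1..<n}" using i by (cases i) auto
      then show ?thesis using IH(3) by (simp add: E'_def)
    qed
  qed
  moreover have "(\<lambda>i. Min (E' (Suc i))) ` {1..n} = X"
    unfolding IH(4) by (rule image_cong) (use E'S in auto)
  then have "insert (Min D) X = (\<lambda>i. Min (E' i)) ` {1..Suc n}"
    by (simp only: iv image_insert image_image E'1)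
  moreover have "Min D \<notin> X" using Min_less_of_less[OF insert(2,3,4) fin(2)] by blast
  then have "Suc n = card (insert (Min D) X)" using IH(5) fin by simp
  ultimately show ?case by blast
qed

lemma compose_families_eq_composition:
  assumes "{} \<in> \<F>" "\<A> \<subseteq> Fpow {1..}"
  shows "compose_families \<F> \<A> = composition \<F> \<A>"
proof (intro equalityI subsetI)
  fix F assume "F \<in> compose_families \<F> \<A>"
  then consider "F = {}" | E n where "F = (\<Union>i\<in>{1..n}. E i)" "1 \<le> n"
      "\<forall>i\<in>{1..n}. E i \<noteq> {} \<and> E i \<in> \<A>" "\<forall>i\<in>{1..<n}. before (E i) (E (Suc i))"
      "(\<lambda>i. Min (E i)) ` {1..n} \<in> \<F>"
    unfolding compose_families_def by blast
  then show "F \<in> composition \<F> \<A>"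
  proof cases
    case 1
    then show ?thesis using assms(1) decomp.empty by (auto simp: composition_def)
  next
    case (2 E n)
    have "decomp \<A> (\<Union>i\<in>{1..n}. E i) ((\<lambda>i. Min (E i)) ` {1..n})"
      by (rule decomp_of_sequence[of n]) (use 2 assms(2) in \<open>auto simp: Fpow_def\<close>)
    then show ?thesis using 2 by (auto simp: composition_def)
  qed
next
  fix F assume "F \<in> composition \<F> \<A>"
  then obtain X where "X \<in> \<F>" "decomp \<A> F X" by (auto simp: composition_def)
  moreover obtain E n where *: "F = (\<Union>i\<in>{1..n}. E i)" "\<forall>i\<in>{1..n}. E i \<noteq> {} \<and> E i \<in> \<A>"
      "\<forall>i\<in>{1..<n}. before (E i) (E (Suc i))" "X = (\<lambda>i. Min (E i)) ` {1..n}"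
    using sequence_of_decomp[OF \<open>decomp \<A> F X\<close>] by blast
  show "F \<in> compose_families \<F> \<A>"
  proof (cases "1 \<le> n")
    case True
    then show ?thesis
      using * \<open>X \<in> \<F>\<close> unfolding compose_families_def
      by (intro UnI2 CollectI exI[of _ E] exI[of _ n]) simp
  next
    case False
    then show ?thesis using * by (simp add: compose_families_def)
  qed
qed

section \<open>Ranks of the Schreier families\<close>

text \<open>A set of the form \<open>E \<union> G\<close> is split greedily into its longest initial segment in \<open>\<A>\<close> and the rest,
  which is in \<open>\<B>\<close> by heredity. End-extensions first use up the rank in \<open>\<A>\<close>; as soon as the rest is
  non-empty, the initial segment is frozen and the rank in \<open>\<B>\<close> decreases from below \<open>\<beta>\<close>.\<close>

lemma ranked_join:
  assumes A: "ranked \<A> \<rho>\<^sub>A" "{} \<in> \<A>" and B: "ranked \<B> \<rho>\<^sub>B" "\<rho>\<^sub>B {} \<le> \<beta>"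
    and C: "\<C> \<subseteq> Fpow {1..}" "hereditary \<C>"
    and join: "\<And>F. F \<in> \<C> \<Longrightarrow> \<exists>E\<in>\<A>. \<exists>G\<in>\<B>. F = E \<union> G \<and> (\<forall>x\<in>E. \<forall>y\<in>G. x < y)"
  shows "\<exists>\<rho>. ranked \<C> \<rho> \<and> \<rho> {} = \<beta> + \<rho>\<^sub>A {}"
proof -
  define init where "init D F \<longleftrightarrow> D \<in> \<A> \<and> D \<subseteq> F \<and> (\<forall>x\<in>D. \<forall>y\<in>F. y < x \<longrightarrow> y \<in> D)" for D F :: "nat set"
  have init_cmp: "D \<subseteq> D' \<or> D' \<subseteq> D" if "D \<subseteq> F" "\<forall>x\<in>D. \<forall>y\<in>F. y < x \<longrightarrow> y \<in> D"
      "D' \<subseteq> F" "\<forall>x\<in>D'. \<forall>y\<in>F. y < x \<longrightarrow> y \<in> D'" for D D' F :: "nat set"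
  proof (rule ccontr)
    assume "\<not> ?thesis"
    then obtain x y where xy: "x \<in> D" "x \<notin> D'" "y \<in> D'" "y \<notin> D" by blast
    then consider "x < y" | "y < x" by (metis linorder_neqE_nat)
    then show False using xy that by cases blast+
  qed
  have "\<exists>H. init H F \<and> (\<forall>D. init D F \<longrightarrow> D \<subseteq> H)" if F: "finite F" for F
  proof -
    have fin: "finite {D. init D F}"
      by (rule finite_subset[of _ "Pow F"]) (use F in \<open>auto simp: init_def\<close>)
    have ne: "{D. init D F} \<noteq> {}" using A(2) by (auto simp: init_def)
    have "Max (card ` {D. init D F}) \<in> card ` {D. init D F}" using fin ne by (intro Max_in) auto
    then obtain H where H: "init H F" "card H = Max (card ` {D. init D F})" by auto
    then have H2: "card D \<le> card H" if "init D F" for D using fin that by simp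
    have "D \<subseteq> H" if D: "init D F" for D
    proof -
      have "D \<subseteq> H \<or> H \<subseteq> D" using init_cmp[of D F H] D H(1) unfolding init_def by blast
      moreover have "D = H" if "H \<subseteq> D"
        using card_seteq[OF _ that H2[OF D]] D F finite_subset unfolding init_def by metis
      ultimately show ?thesis by blast
    qed
    then show ?thesis using H(1) by blast
  qed
  then obtain head where head: "\<And>F. finite F \<Longrightarrow> init (head F) F"
      "\<And>F D. finite F \<Longrightarrow> init D F \<Longrightarrow> D \<subseteq> head F"
    by metis
  note RA = rankedD[OF A(1)] and RB = rankedD[OF B(1)]
  have finC: "finite F" if "F \<in> \<C>" for F using that C(1) by (auto simp: Fpow_def)
  have restB: "F - head F \<in> \<B>" if F: "F \<in> \<C>" for F
  proof -
    obtain E G where EG: "E \<in> \<A>" "G \<in> \<B>" "F = E \<union> G" "\<forall>x\<in>E. \<forall>y\<in>G. x < y" using join[OF F] by blast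
    then have "init E F" by (force simp: init_def)
    then have "F - head F \<subseteq> G" using head(2)[OF finC[OF F]] EG(3) by blast
    then show ?thesis using hereditaryD[OF RB(2) EG(2)] by blast
  qed
  define \<rho> where "\<rho> F = (if F \<in> \<A> then \<beta> + \<rho>\<^sub>A F else \<rho>\<^sub>B (F - head F))" for F
  have "\<rho> F' < \<rho> F" if F: "F \<in> \<C>" "F' \<in> \<C>" "end_ext F F'" for F F'
  proof (cases "F \<in> \<A>")
    case True
    show ?thesis
    proof (cases "F' \<in> \<A>")
      case True
      then show ?thesis
        using \<open>F \<in> \<A>\<close> RA(3)[OF _ _ F(3)] by (simp add: \<rho>_def plus_strict_mono_omega1)
    next
      case False
      have "head F' \<in> \<A>" "head F' \<subseteq> F'" using head(1)[OF finC[OF F(2)]] by (auto simp: init_def)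
      then have "F' - head F' \<noteq> {}" using False by auto
      then have "\<rho>\<^sub>B (F' - head F') < \<rho>\<^sub>B {}"
        using RB(3)[of "{}" "F' - head F'"] restB[OF F(2)] hereditaryD[OF RB(2) restB[OF F(2)]]
        by (simp add: end_ext_empty)
      also have "\<dots> \<le> \<beta> + \<rho>\<^sub>A F" using B(2) le_plus_omega1 order_trans by blast
      finally show ?thesis using True False by (simp add: \<rho>_def)
    qed
  next
    case False
    have F': "F' \<notin> \<A>" using False F(3) hereditaryD[OF RA(2), of F' F] by (auto simp: end_ext_def)
    have hF: "init (head F) F" and hF': "init (head F') F'" using head(1) finC F by blast+
    have FF': "F \<subseteq> F'" "\<forall>x\<in>F. \<forall>y\<in>F'. y < x \<longrightarrow> y \<in> F"
    proof (safe)
      fix x y assume "x \<in> F" "y \<in> F'" "y < x"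
      then show "y \<in> F" using F(3) by (meson DiffI end_ext_def less_asym)
    qed (use F(3) in \<open>auto simp: end_ext_def\<close>)
    have "init (head F) F'" using hF FF' unfolding init_def by blast
    then have 1: "head F \<subseteq> head F'" using head(2) finC F(2) by blast
    have "head F' \<subseteq> F \<or> F \<subseteq> head F'"
      by (rule init_cmp[of "head F'" F' F]) (use hF' FF' in \<open>auto simp: init_def\<close>)
    moreover have "\<not> F \<subseteq> head F'"
    proof
      assume "F \<subseteq> head F'"
      then have "F \<in> \<A>" using hF' hereditaryD[OF RA(2), of "head F'" F] by (simp add: init_def)
      then show False using False by simp
    qed
    ultimately have "head F' \<subseteq> F" by blast
    then have "init (head F') F" using hF' FF' unfolding init_def by blast
    then have eq: "head F' = head F" using 1 head(2) finC F(1) by blast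
    have "end_ext (F - head F) (F' - head F')"
      using F(3) hF unfolding eq init_def end_ext_def by auto
    then have "\<rho>\<^sub>B (F' - head F') < \<rho>\<^sub>B (F - head F)" using RB(3) restB F by blast
    then show ?thesis using False F' by (simp add: \<rho>_def)
  qed
  then have "ranked \<C> \<rho>" using C by (simp add: ranked_def)
  then show ?thesis using A(2) by (intro exI[of _ \<rho>]) (simp add: \<rho>_def)
qed

text \<open>The sets with at most \<open>n\<close> elements; \<open>composition (small_sets n) \<A>\<close> consists of the unions of at most
  \<open>n\<close> successive members of \<open>\<A>\<close>.\<close>

definition small_sets :: "nat \<Rightarrow> nat set set" where
  "small_sets n = {X. finite X \<and> card X \<le> n}"

lemma small_sets: "hereditary (small_sets n)" "spreading (small_sets n)" "{} \<in> small_sets n"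
proof -
  show "hereditary (small_sets n)"
    unfolding hereditary_def small_sets_def by (auto intro: finite_subset) (meson card_mono order_trans)
  show "spreading (small_sets n)"
    unfolding spreading_def spread_of_iff small_sets_def
    by (auto intro: order_trans[OF card_image_le])
qed (simp add: small_sets_def)

lemma ranked_composition_small_sets:
  assumes A: "ranked \<A> \<rho>\<^sub>A" "{} \<in> \<A>" "\<rho>\<^sub>A {} \<le> \<alpha>"
  shows "\<exists>\<rho>. ranked (composition (small_sets n) \<A>) \<rho> \<and> \<rho> {} \<le> \<alpha> * (osucc ^^ n) 0"
proof (induction n)
  case 0
  have "composition (small_sets 0) \<A> \<subseteq> {{}}"
    using decomp_finite by (fastforce simp: composition_def small_sets_def)
  then have "ranked (composition (small_sets 0) \<A>) (\<lambda>_. 0)"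
    unfolding ranked_def hereditary_def end_ext_def using small_sets(3)[of 0]
    by (auto simp: Fpow_def)
  then show ?case by (intro exI[of _ "\<lambda>_. 0"]) simp
next
  case (Suc n)
  then obtain \<rho>\<^sub>B where B: "ranked (composition (small_sets n) \<A>) \<rho>\<^sub>B" "\<rho>\<^sub>B {} \<le> \<alpha> * (osucc ^^ n) 0" by blast
  have emp: "{} \<in> composition (small_sets n) \<A>" using small_sets(3) decomp.empty by (auto simp: composition_def)
  have "\<exists>E\<in>\<A>. \<exists>G\<in>composition (small_sets n) \<A>. F = E \<union> G \<and> (\<forall>x\<in>E. \<forall>y\<in>G. x < y)"
    if F: "F \<in> composition (small_sets (Suc n)) \<A>" for F
  proof -
    obtain X where X: "decomp \<A> F X" "card X \<le> Suc n" using F by (auto simp: composition_def small_sets_def)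
    from X(1) show ?thesis
    proof cases
      case empty
      then show ?thesis using A(2) emp by blast
    next
      case (insert E G Y)
      have Y: "finite Y" "Y \<subseteq> G" using decomp_finite[OF insert(7)] by auto
      have "Min E \<notin> Y" using Min_less_of_less[OF insert(4,5,6) Y(2)] by blast
      then have "card Y \<le> n" using X(2) insert(2) Y(1) by simp
      then have "G \<in> composition (small_sets n) \<A>" using insert(7) Y(1) by (auto simp: composition_def small_sets_def)
      then show ?thesis using insert by blast
    qed
  qed
  from ranked_join[OF A(1,2) B composition_subset[OF rankedD(1)[OF A(1)]]
      hereditary_composition[OF small_sets(1,2) rankedD(2)[OF A(1)]] this]
  obtain \<rho> where "ranked (composition (small_sets (Suc n)) \<A>) \<rho>" "\<rho> {} = \<alpha> * (osucc ^^ n) 0 + \<rho>\<^sub>A {}"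
    by blast
  then show ?case using plus_mono_omega1[OF A(3)] by (auto simp: times_osucc)
qed

text \<open>The members of \<open>\<S>\<^bsub>\<xi>+1\<^esub>\<close> with minimum \<open>n\<close> are unions of at most \<open>n\<close> successive members of \<open>\<S>\<^sub>\<xi>\<close>.\<close>

lemma Schreier_osucc_iff:
  assumes S: "Schreier s \<xi> \<subseteq> Fpow {1..}" and "E \<noteq> {}"
  shows "E \<in> Schreier s (osucc \<xi>) \<longleftrightarrow> E \<in> composition (small_sets (Min E)) (Schreier s \<xi>)"
proof
  assume "E \<in> Schreier s (osucc \<xi>)"
  then obtain D n where D: "E = (\<Union>i\<in>{1..n}. D i)" "1 \<le> n"
      "\<forall>i\<in>{1..n}. D i \<noteq> {} \<and> D i \<in> Schreier s \<xi>" "below n (D 1)"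
      "\<forall>i\<in>{1..<n}. before (D i) (D (Suc i))"
    using \<open>E \<noteq> {}\<close> unfolding Schreier_osucc by blast
  have fin: "\<forall>i\<in>{1..n}. D i \<noteq> {} \<and> finite (D i) \<and> D i \<in> Schreier s \<xi>"
    using D(3) S by (auto simp: Fpow_def)
  have d: "decomp (Schreier s \<xi>) E ((\<lambda>i. Min (D i)) ` {1..n})"
    unfolding D(1) by (rule decomp_of_sequence[OF fin D(5)]) (use D(2) in auto)
  have n1: "n \<le> Min (D 1)" "finite (D 1)" "D 1 \<noteq> {}" using D(2,4) fin by (auto simp: below_def)
  have "n \<le> x" if x: "x \<in> E" for x
  proof -
    obtain i where i: "i \<in> {1..n}" "x \<in> D i" using x D(1) by blast
    show ?thesis
    proof (cases "i = 1")
      case True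
      then show ?thesis using n1 i Min_le[OF n1(2)] order_trans by blast
    next
      case False
      have "\<forall>x\<in>D 1. \<forall>y\<in>D i. x < y"
        by (rule before_chain[of n D]) (use fin D(5) i False in auto)
      then have "Min (D 1) < x" using Min_in[OF n1(2,3)] i by blast
      then show ?thesis by (rule order_trans[OF n1(1) less_imp_le])
    qed
  qed
  then have "n \<le> Min E" using decomp_finite[OF d] \<open>E \<noteq> {}\<close> by simp
  moreover have "card ((\<lambda>i. Min (D i)) ` {1..n}) \<le> n" using card_image_le[of "{1..n}"] by simp
  ultimately show "E \<in> composition (small_sets (Min E)) (Schreier s \<xi>)"
    by (intro compositionI[OF d]) (simp add: small_sets_def)
next
  assume "E \<in> composition (small_sets (Min E)) (Schreier s \<xi>)"
  then obtain X where X: "decomp (Schreier s \<xi>) E X" "finite X" "card X \<le> Min E"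
    by (auto simp: composition_def small_sets_def)
  obtain D n where D: "E = (\<Union>i\<in>{1..n}. D i)" "\<forall>i\<in>{1..n}. D i \<noteq> {} \<and> D i \<in> Schreier s \<xi>"
      "\<forall>i\<in>{1..<n}. before (D i) (D (Suc i))" "n = card X"
    using sequence_of_decomp[OF X(1)] by blast
  have n1: "1 \<le> n" using D(1) \<open>E \<noteq> {}\<close> by (cases n) auto
  have "D 1 \<subseteq> E" "D 1 \<noteq> {}" using D n1 by auto
  then have "Min E \<le> Min (D 1)" using decomp_finite[OF X(1)] by (intro Min_antimono) auto
  then have "below n (D 1)" using X(3) D(4) by (simp add: below_def)
  then show "E \<in> Schreier s (osucc \<xi>)"
    unfolding Schreier_osucc
    by (intro UnI2 CollectI exI[of _ D] exI[of _ n]) (use D n1 in simp)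
qed

text \<open>A spreading ranked family containing the empty set, with all ranks at most \<open>\<alpha>\<close>.\<close>

definition spreading_ranked :: "nat set set \<Rightarrow> omega1 \<Rightarrow> bool" where
  "spreading_ranked \<A> \<alpha> \<longleftrightarrow> {} \<in> \<A> \<and> spreading \<A> \<and> (\<exists>\<rho>. ranked \<A> \<rho> \<and> \<rho> {} \<le> \<alpha>)"

lemma spreading_rankedD:
  assumes "spreading_ranked \<A> \<alpha>"
  shows "{} \<in> \<A>" "spreading \<A>" "hereditary \<A>" "\<A> \<subseteq> Fpow {1..}"
  using assms rankedD by (auto simp: spreading_ranked_def)

text \<open>A presentation of the family \<open>\<S>\<close> by families of rank smaller than \<open>\<alpha>\<close>, increasing from the index \<open>1\<close>
  on, the \<open>n\<close>-th of which decides about the sets with minimum \<open>n\<close>.\<close>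

definition approximated :: "nat set set \<Rightarrow> omega1 \<Rightarrow> (nat \<Rightarrow> nat set set) \<Rightarrow> bool" where
  "approximated \<S> \<alpha> A \<longleftrightarrow> {} \<in> \<S> \<and> (\<forall>n. \<exists>\<beta><\<alpha>. spreading_ranked (A n) \<beta>) \<and>
     (\<forall>m n. 1 \<le> m \<longrightarrow> m \<le> n \<longrightarrow> A m \<subseteq> A n) \<and> (\<forall>E. E \<noteq> {} \<longrightarrow> (E \<in> \<S> \<longleftrightarrow> E \<in> A (Min E)))"

lemma spreading_ranked_if_approximated:
  assumes "approximated \<S> \<alpha> A" shows "spreading_ranked \<S> \<alpha>"
proof -
  have emp: "{} \<in> \<S>" and A: "\<And>n. \<exists>\<beta><\<alpha>. spreading_ranked (A n) \<beta>"
    and mono: "\<And>m n. 1 \<le> m \<Longrightarrow> m \<le> n \<Longrightarrow> A m \<subseteq> A n"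
    and iff: "\<And>E. E \<noteq> {} \<Longrightarrow> E \<in> \<S> \<longleftrightarrow> E \<in> A (Min E)"
    using assms unfolding approximated_def by auto
  have AD: "spreading (A n)" "hereditary (A n)" "A n \<subseteq> Fpow {1..}" for n
    using A[of n] spreading_rankedD by blast+
  have sub: "E \<in> Fpow {1..}" if "E \<in> \<S>" for E
    using that iff[of E] AD(3) by (cases "E = {}") (auto simp: Fpow_def)
  have "\<exists>\<rho>. ranked (A n) \<rho> \<and> \<rho> {} < \<alpha>" for n
    using A[of n] le_less_trans unfolding spreading_ranked_def by blast
  then obtain \<rho> where \<rho>: "\<And>n. ranked (A n) (\<rho> n)" "\<And>n. \<rho> n {} < \<alpha>" by metis
  have MinE: "1 \<le> Min E" if "E \<in> \<S>" "E \<noteq> {}" for E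
  proof -
    have "Min E \<in> E" using sub[OF that(1)] that(2) by (intro Min_in) (auto simp: Fpow_def)
    then show ?thesis using sub[OF that(1)] by (auto simp: Fpow_def)
  qed
  have her: "hereditary \<S>"
    unfolding hereditary_def
  proof (intro ballI allI impI)
    fix E F assume EF: "E \<in> \<S>" "F \<subseteq> E"
    show "F \<in> \<S>"
    proof (cases "F = {}")
      case False
      then have E: "E \<noteq> {}" "finite E" using EF sub[OF EF(1)] by (auto simp: Fpow_def)
      have "Min E \<le> Min F" using EF(2) False E(2) by (rule Min_antimono)
      moreover have "F \<in> A (Min E)" using iff[OF E(1)] EF hereditaryD[OF AD(2)] by blast
      ultimately have "F \<in> A (Min F)" using mono[OF MinE[OF EF(1) E(1)]] by blast
      then show ?thesis using iff[OF False] by blast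
    qed (use emp in simp)
  qed
  have "spreading \<S>"
    unfolding spreading_def
  proof (intro ballI allI impI)
    fix E F assume EF: "E \<in> \<S>" "spread_of E F"
    show "F \<in> \<S>"
    proof (cases "F = {}")
      case False
      obtain \<phi> where \<phi>: "finite E" "\<phi> ` E = F" "\<forall>x\<in>E. x \<le> \<phi> x"
        using EF(2) unfolding spread_of_iff by blast
      then have E: "E \<noteq> {}" using False by auto
      have "Min E \<le> Min F"
        using \<phi> False by (auto intro!: Min.boundedI intro: order_trans[OF Min_le])
      moreover have "F \<in> A (Min E)"
        using iff[OF E] EF AD(1)[of "Min E"] unfolding spreading_def by blast
      ultimately have "F \<in> A (Min F)" using mono[OF MinE[OF EF(1) E]] by blast
      then show ?thesis using iff[OF False] by blast
    qed (use emp in simp)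
  qed
  moreover have "ranked \<S> (\<lambda>E. if E = {} then \<alpha> else \<rho> (Min E) E)"
    unfolding ranked_def
  proof (intro conjI ballI impI)
    fix E F assume EF: "E \<in> \<S>" "F \<in> \<S>" "end_ext E F"
    have F: "F \<noteq> {}" "F \<in> A (Min F)" using EF iff[of F] by (auto simp: end_ext_def)
    show "(if F = {} then \<alpha> else \<rho> (Min F) F) < (if E = {} then \<alpha> else \<rho> (Min E) E)"
    proof (cases "E = {}")
      case True
      have "\<rho> (Min F) F < \<rho> (Min F) {}"
        using rankedD(3)[OF \<rho>(1), of "{}" "Min F" F] F hereditaryD[OF AD(2) F(2)]
        by (simp add: end_ext_empty)
      then show ?thesis using True F \<rho>(2)[of "Min F"] by simp
    next
      case False
      have fin: "finite E" "finite F" using EF sub by (auto simp: Fpow_def)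
      have "Min F = Min E"
      proof (rule Min_eqI[OF fin(2)])
        show "Min E \<in> F" using EF(3) Min_in[OF fin(1) False] by (auto simp: end_ext_def)
        fix y assume "y \<in> F"
        then show "Min E \<le> y"
          using EF(3) Min_in[OF fin(1) False] Min_le[OF fin(1)]
          by (cases "y \<in> E") (auto simp: end_ext_def intro: less_imp_le)
      qed
      moreover have "E \<in> A (Min E)" using EF(1) iff[OF False] by blast
      ultimately show ?thesis using rankedD(3)[OF \<rho>(1), of E "Min E" F] F EF(3) False by simp
    qed
  qed (use sub her in auto)
  ultimately show ?thesis unfolding spreading_ranked_def using emp by force
qed

lemma spreading_ranked_Schreier_zero: "spreading_ranked (Schreier s 0) (omega_power 0)"
proof -
  have eq: "Schreier s 0 = {E \<in> Fpow {1..}. card E \<le> 1}" by (rule Schreier_zero)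
  have her: "hereditary (Schreier s 0)"
    unfolding eq hereditary_def Fpow_def
    by (auto intro: finite_subset) (metis card_mono le_trans)
  have "spreading (Schreier s 0)"
    unfolding spreading_def
  proof (intro ballI allI impI)
    fix E F assume E: "E \<in> Schreier s 0" "spread_of E F"
    then obtain \<phi> where \<phi>: "finite E" "\<phi> ` E = F" "\<forall>x\<in>E. x \<le> \<phi> x"
      unfolding spread_of_iff by blast
    then have "card F \<le> card E" using card_image_le by blast
    then show "F \<in> Schreier s 0" using E(1) \<phi> unfolding eq by (force simp: Fpow_def)
  qed
  moreover have "ranked (Schreier s 0) (\<lambda>E. if E = {} then 1 else 0)"
    unfolding ranked_def
  proof (intro conjI ballI impI)
    fix E F assume EF: "E \<in> Schreier s 0" "F \<in> Schreier s 0" "end_ext E F"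
    have "card E < card F" using EF unfolding eq end_ext_def Fpow_def by (auto intro: psubset_card_mono)
    moreover have "card F \<le> 1" "finite E" using EF unfolding eq Fpow_def by auto
    ultimately have "card E = 0" by linarith
    then have "E = {}" using \<open>finite E\<close> by simp
    then have "E = {}" "F \<noteq> {}" using EF(3) by (auto simp: end_ext_def)
    then show "(if F = {} then 1 else (0 :: omega1)) < (if E = {} then 1 else 0)"
      by (simp add: one_omega1_def less_osucc_iff)
  qed (use her eq in auto)
  ultimately show ?thesis
    unfolding spreading_ranked_def
    by (auto simp: eq Fpow_def omega_power_zero intro!: exI[of _ "\<lambda>E. if E = {} then 1 else 0"])
qed

lemma Schreier_subset_osucc:
  assumes "spreading_ranked (Schreier s \<eta>) \<alpha>"
  shows "Schreier s \<eta> \<subseteq> Schreier s (osucc \<eta>)"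
proof
  note S = spreading_rankedD[OF assms]
  fix E assume E: "E \<in> Schreier s \<eta>"
  show "E \<in> Schreier s (osucc \<eta>)"
  proof (cases "E = {}")
    case True
    then show ?thesis by (simp add: Schreier_osucc)
  next
    case False
    have fin: "finite E" "E \<subseteq> {1..}" using E S(4) by (auto simp: Fpow_def)
    have "1 \<le> Min E" using Min_in[OF fin(1) False] fin(2) by auto
    then have "E \<in> composition (small_sets (Min E)) (Schreier s \<eta>)"
      by (intro compositionI[OF decomp_singleton[OF E False fin(1)]]) (simp add: small_sets_def)
    then show ?thesis using Schreier_osucc_iff[OF S(4) False] by blast
  qed
qed

lemma approximated_Schreier_osucc:
  assumes "spreading_ranked (Schreier s \<eta>) (omega_power \<eta>)"
  shows "approximated (Schreier s (osucc \<eta>)) (omega_power (osucc \<eta>))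
    (\<lambda>n. composition (small_sets n) (Schreier s \<eta>))"
  unfolding approximated_def
proof (intro conjI allI impI)
  note S = spreading_rankedD[OF assms]
  obtain \<rho> where \<rho>: "ranked (Schreier s \<eta>) \<rho>" "\<rho> {} \<le> omega_power \<eta>"
    using assms by (auto simp: spreading_ranked_def)
  show "{} \<in> Schreier s (osucc \<eta>)" by (simp add: Schreier_osucc)
  fix n
  let ?\<beta> = "omega_power \<eta> * (osucc ^^ n) 0"
  have "?\<beta> < ?\<beta> + omega_power \<eta>"
    using plus_strict_mono_omega1[of 0 "omega_power \<eta>"] omega_power_pos[of \<eta>]
    by (metis plus_zero_omega1 one_omega1_def osucc_le_iff)
  also have "\<dots> \<le> omega_power (osucc \<eta>)"
    unfolding omega_power_osucc by (rule times_step_omega1[OF funpow_osucc_less_omega])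
  finally have "?\<beta> < omega_power (osucc \<eta>)" .
  moreover have "{} \<in> composition (small_sets n) (Schreier s \<eta>)"
    by (rule compositionI[OF decomp.empty small_sets(3)])
  then have "spreading_ranked (composition (small_sets n) (Schreier s \<eta>)) ?\<beta>"
    unfolding spreading_ranked_def
    using ranked_composition_small_sets[OF \<rho>(1) S(1) \<rho>(2)] spreading_composition[OF small_sets(2) S(2)] by simp
  ultimately show "\<exists>\<beta><omega_power (osucc \<eta>). spreading_ranked (composition (small_sets n) (Schreier s \<eta>)) \<beta>"
    by blast
next
  fix m n :: nat assume "m \<le> n"
  then show "composition (small_sets m) (Schreier s \<eta>) \<subseteq> composition (small_sets n) (Schreier s \<eta>)"
    by (intro composition_mono) (auto simp: small_sets_def)
next
  fix E :: "nat set" assume "E \<noteq> {}"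
  then show "E \<in> Schreier s (osucc \<eta>) \<longleftrightarrow> E \<in> composition (small_sets (Min E)) (Schreier s \<eta>)"
    using Schreier_osucc_iff spreading_rankedD(4)[OF assms] by blast
qed

text \<open>The fixed sequence at \<open>\<xi>\<close> matters only from the index \<open>1\<close> on, hence the maximum in the statement.\<close>

lemma approximated_Schreier_limit:
  assumes s: "admissible s" and lim: "limit_ord \<xi>"
    and IH: "\<And>\<eta>. \<eta> < \<xi> \<Longrightarrow> spreading_ranked (Schreier s \<eta>) (omega_power \<eta>)"
  shows "approximated (Schreier s \<xi>) (omega_power \<xi>) (\<lambda>n. Schreier s (osucc (s \<xi> (max 1 n))))"
proof -
  have lt: "s \<xi> n < \<xi>" and step: "Schreier s (osucc (s \<xi> n)) \<subseteq> Schreier s (s \<xi> (Suc n))"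
    if "1 \<le> n" for n
    using s lim that unfolding admissible_def by auto
  let ?A = "\<lambda>n. Schreier s (osucc (s \<xi> (max 1 n)))"
  have lt': "osucc (s \<xi> n) < \<xi>" if "1 \<le> n" for n by (rule limit_ord_osucc_less[OF lim lt[OF that]])
  have mono: "?A m \<subseteq> ?A n" if "1 \<le> m" "m \<le> n" for m n
    using that(2)
  proof (induction n rule: dec_induct)
    case (step n)
    have "Schreier s (osucc (s \<xi> n)) \<subseteq> Schreier s (osucc (s \<xi> (Suc n)))"
      using \<open>1 \<le> m\<close> step(1) \<open>\<And>n. 1 \<le> n \<Longrightarrow> Schreier s (osucc (s \<xi> n)) \<subseteq> Schreier s (s \<xi> (Suc n))\<close>[of n]
        Schreier_subset_osucc[OF IH[OF lt[of "Suc n"]]] by auto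
    moreover have "max 1 n = n" "max 1 (Suc n) = Suc n" using \<open>1 \<le> m\<close> step(1) by auto
    ultimately show ?case using step(3) by simp
  qed simp
  have Aemp: "{} \<in> ?A n" for n by (simp add: Schreier_osucc)
  show ?thesis
    unfolding approximated_def
  proof (intro conjI allI impI)
    show "{} \<in> Schreier s \<xi>"
      using Aemp[of 1] unfolding Schreier_limit[OF lim] by (auto simp: below_def)
    fix n
    show "\<exists>\<beta><omega_power \<xi>. spreading_ranked (?A n) \<beta>"
      using IH[OF lt'[of "max 1 n"]] omega_power_strict_mono[OF lt'[of "max 1 n"]] by auto
  next
    fix m n :: nat assume "1 \<le> m" "m \<le> n"
    then show "?A m \<subseteq> ?A n" by (rule mono)
  next
    fix E :: "nat set" assume E: "E \<noteq> {}"
    show "E \<in> Schreier s \<xi> \<longleftrightarrow> E \<in> ?A (Min E)"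
    proof
      assume "E \<in> Schreier s \<xi>"
      then obtain n where n: "1 \<le> n" "n \<le> Min E" "E \<in> Schreier s (osucc (s \<xi> n))"
        using E unfolding Schreier_limit[OF lim] by (auto simp: below_def)
      then have "E \<in> ?A n" by (simp add: max_absorb2)
      then show "E \<in> ?A (Min E)" using mono[OF n(1,2)] by blast
    next
      assume EA: "E \<in> ?A (Min E)"
      have fin: "finite E" "E \<subseteq> {1..}"
        using EA spreading_rankedD(4)[OF IH[OF lt'[of "max 1 (Min E)"]]] by (auto simp: Fpow_def)
      have "1 \<le> Min E" using Min_in[OF fin(1) E] fin(2) by auto
      then show "E \<in> Schreier s \<xi>"
        using EA unfolding Schreier_limit[OF lim]
        by (intro CollectI exI[of _ "Min E"]) (simp add: below_def max_absorb2)
    qed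
  qed
qed

lemma spreading_ranked_Schreier:
  assumes "admissible s" shows "spreading_ranked (Schreier s \<xi>) (omega_power \<xi>)"
proof (induction \<xi> rule: less_induct)
  case (less \<xi>)
  consider "\<xi> = 0" | \<eta> where "\<xi> = osucc \<eta>" | "limit_ord \<xi>" unfolding limit_ord_def by blast
  then show ?case
  proof cases
    case 1
    then show ?thesis using spreading_ranked_Schreier_zero by simp
  next
    case (2 \<eta>)
    then show ?thesis
      using spreading_ranked_if_approximated[OF approximated_Schreier_osucc] less[of \<eta>]
      by (simp add: less_osucc_iff)
  next
    case 3
    then show ?thesis
      using spreading_ranked_if_approximated[OF approximated_Schreier_limit[OF assms]] less by blast
  qed
qed

lemma approximated_Schreier:
  assumes "admissible s" "\<xi> \<noteq> 0"
  shows "\<exists>A. approximated (Schreier s \<xi>) (omega_power \<xi>) A"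
proof -
  consider \<eta> where "\<xi> = osucc \<eta>" | "limit_ord \<xi>" using assms(2) unfolding limit_ord_def by blast
  then show ?thesis
    using approximated_Schreier_osucc[OF spreading_ranked_Schreier[OF assms(1)]]
      approximated_Schreier_limit[OF assms(1) _ spreading_ranked_Schreier[OF assms(1)]]
    by cases blast+
qed

section \<open>Families that are not full\<close>

lemma elt_mem: "M \<in> Ipow {1..} \<Longrightarrow> elt M n \<in> M"
  unfolding elt_def by (rule enumerate_in_set) (simp add: Ipow_def)

lemma full_zero:
  assumes E: "hereditary \<E>" "\<E> \<subseteq> Fpow {1..}" "{} \<in> \<E>"
    and M: "M \<in> Ipow {1..}" "\<And>m. m \<in> M \<Longrightarrow> {m} \<in> \<E>"
  shows "full s 0 \<E>"
proof -
  have "elt M ` D \<in> \<E>" if "D \<in> Schreier s 0" for D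
  proof -
    have "finite D" "card D \<le> 1" using that by (auto simp: Schreier_zero Fpow_def)
    then consider "D = {}" | n where "D = {n}" by (metis card_0_eq card_1_singletonE le_Suc_eq le_zero_eq One_nat_def)
    then show ?thesis by cases (use E(3) M elt_mem[OF M(1)] in auto)
  qed
  then show ?thesis using E M by (auto simp: full_def transport_def)
qed

text \<open>Suppose that for each \<open>n\<close> every infinite set has an infinite subset on which \<open>\<E>\<close> contains \<open>A n\<close>. Then
  there is a diagonal set \<open>M\<close> whose tails beyond points \<open>m \<ge> n\<close> have this property for \<open>n\<close>. That is
  enough, since a set in \<open>\<S>\<^sub>\<xi>\<close> with minimum \<open>n\<close> lies in \<open>A n\<close>.\<close>

lemma full_if_approximated:
  assumes s: "admissible s" and A: "approximated (Schreier s \<xi>) \<alpha> A"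
    and E: "hereditary \<E>" "\<E> \<subseteq> Fpow {1..}" "{} \<in> \<E>" and L: "L \<in> Ipow {1..}"
    and dense: "\<And>n N. N \<in> Ipow L \<Longrightarrow> \<exists>M\<in>Ipow N. \<forall>D\<in>A n. D \<subseteq> M \<longrightarrow> D \<in> \<E>"
  shows "full s \<xi> \<E>"
proof -
  define \<Phi> where "\<Phi> D N \<longleftrightarrow> (\<forall>n. D = {n} \<longrightarrow> (\<forall>F\<in>A n. F \<subseteq> N \<longrightarrow> F \<in> \<E>))" for D N :: "nat set"
  have "\<exists>M\<in>Ipow L. \<Phi> {} M \<and> (\<forall>m\<in>M. \<forall>D. D \<subseteq> {..m} \<longrightarrow> \<Phi> D {n \<in> M. m < n})"
  proof (rule fusion[OF _ _ L])
    show "\<Phi> D N'" if "\<Phi> D N" "N' \<in> Ipow N" for D N N'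
      using that unfolding \<Phi>_def Ipow_def by blast
    show "\<exists>N'\<in>Ipow N. \<Phi> D N'" if N: "N \<in> Ipow L" for D N
    proof (cases "\<exists>n. D = {n}")
      case True
      then obtain n where "D = {n}" by blast
      then show ?thesis using dense[OF N, of n] by (auto simp: \<Phi>_def)
    next
      case False
      then show ?thesis using Ipow_refl[OF N] by (auto simp: \<Phi>_def)
    qed
  qed
  then obtain M where M: "M \<in> Ipow L" "\<And>m D. m \<in> M \<Longrightarrow> D \<subseteq> {..m} \<Longrightarrow> \<Phi> D {n \<in> M. m < n}" by blast
  have infM: "infinite M" and M1: "M \<in> Ipow {1..}" using M(1) L by (auto simp: Ipow_def)
  \<comment> \<open>without two points, the \<open>i\<close>-th element is larger than \<open>enumerate M n\<close> for \<open>i \<ge> n \<ge> 1\<close>,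
    and the latter is at least \<open>n\<close>\<close>
  define M1' where "M1' = M - {LEAST n. n \<in> M}"
  define M2 where "M2 = M1' - {LEAST n. n \<in> M1'}"
  have M2: "M2 \<in> Ipow {1..}" using M1 by (auto simp: M2_def M1'_def Ipow_def)
  have elt: "elt M2 i = enumerate M (Suc i)" if "1 \<le> i" for i
  proof -
    have "enumerate M (Suc (Suc (i - 1))) = enumerate M2 (i - 1)"
      by (simp only: enumerate_Suc M1'_def M2_def)
    then show ?thesis using that by (simp add: elt_def)
  qed
  have mono: "enumerate M i < enumerate M j" if "i < j" for i j
    using enumerate_mono[OF that infM] .
  have "elt M2 ` D \<in> \<E>" if D: "D \<in> Schreier s \<xi>" for D
  proof (cases "D = {}")
    case False
    note S = spreading_rankedD[OF spreading_ranked_Schreier[OF s, of \<xi>]]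
    have fin: "finite D" "D \<subseteq> {1..}" using D S(4) by (auto simp: Fpow_def)
    let ?n = "Min D"
    have "D \<in> A ?n" using A D False by (auto simp: approximated_def)
    moreover have "spreading (A ?n)" using A spreading_rankedD(2) unfolding approximated_def by blast
    moreover have "strict_mono_on D (elt M2)"
      using mono elt fin(2) by (auto simp: strict_mono_on_def subset_iff)
    moreover have "i \<le> elt M2 i" if "i \<in> D" for i
      using elt[of i] le_enumerate[OF infM, of "Suc i"] that fin(2) by auto
    ultimately have 1: "elt M2 ` D \<in> A ?n" using spreading_image fin(1) by blast
    let ?m = "enumerate M ?n"
    have m: "?m \<in> M" "?n \<le> ?m" using enumerate_in_set[OF infM] le_enumerate[OF infM] by auto
    then have "\<Phi> {?n} {n \<in> M. ?m < n}" using M(2) by simp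
    moreover have "elt M2 ` D \<subseteq> {n \<in> M. ?m < n}"
    proof safe
      fix i assume i: "i \<in> D"
      then have "?n \<le> i" "1 \<le> i" using fin by auto
      then show "elt M2 i \<in> M" "?m < elt M2 i"
        using elt[of i] enumerate_in_set[OF infM] mono[of ?n "Suc i"] by auto
    qed
    ultimately show ?thesis using 1 by (auto simp: \<Phi>_def)
  qed (use E(3) in simp)
  then show ?thesis using E M2 by (auto simp: full_def transport_def)
qed

text \<open>A hereditary family that is not \<open>\<xi>\<close>-full has rank smaller than \<open>\<omega>\<^sup>\<xi>\<close> on some infinite set: otherwise
  the dichotomy puts the approximating families of \<open>\<S>\<^sub>\<xi>\<close> into it.\<close>

lemma full_or_small_rank:
  assumes s: "admissible s"
    and E: "hereditary \<E>" "\<E> \<subseteq> Fpow {1..}" "{} \<in> \<E>" and L: "L \<in> Ipow {1..}"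
    and not_full: "\<not> full s \<xi> \<E>"
  shows "\<exists>M\<in>Ipow L. \<exists>\<A> \<rho>. ranked \<A> \<rho> \<and> \<rho> {} < omega_power \<xi> \<and> (\<forall>D\<in>\<E>. D \<subseteq> M \<longrightarrow> D \<in> \<A>)"
proof (cases "\<xi> = 0")
  case True
  define X where "X = {m \<in> L. {m} \<in> \<E>}"
  have "finite X"
  proof (rule ccontr)
    assume "infinite X"
    then have "X \<in> Ipow {1..}" using L by (auto simp: Ipow_def X_def)
    moreover have "{m} \<in> \<E>" if "m \<in> X" for m using that by (simp add: X_def)
    ultimately have "full s 0 \<E>" by (rule full_zero[OF E])
    then show False using not_full True by simp
  qed
  then have M: "L - X \<in> Ipow L" using L Diff_infinite_finite[of X L] by (auto simp: Ipow_def)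
  have "D \<in> {{}}" if D: "D \<in> \<E>" "D \<subseteq> L - X" for D
  proof (rule ccontr)
    assume "D \<notin> {{}}"
    then obtain m where "m \<in> D" by blast
    then show False using D hereditaryD[OF E(1) D(1), of "{m}"] by (auto simp: X_def)
  qed
  moreover have "ranked {{}} (\<lambda>_. 0)"
    by (auto simp: ranked_def hereditary_def end_ext_def Fpow_def)
  moreover have "0 < omega_power \<xi>"
    using omega_power_pos[of \<xi>] by (simp add: one_omega1_def osucc_le_iff)
  ultimately show ?thesis using M by blast
next
  case False
  obtain A where A: "approximated (Schreier s \<xi>) (omega_power \<xi>) A"
    using approximated_Schreier[OF s False] by blast
  show ?thesis
  proof (rule ccontr)
    assume no: "\<not> ?thesis"
    have "full s \<xi> \<E>"
    proof (rule full_if_approximated[OF s A E L])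
      fix n N assume N: "N \<in> Ipow L"
      obtain \<beta> where "\<beta> < omega_power \<xi>" "spreading_ranked (A n) \<beta>"
        using A unfolding approximated_def by blast
      then obtain \<rho> where \<rho>: "ranked (A n) \<rho>" "\<rho> {} < omega_power \<xi>"
        unfolding spreading_ranked_def by (blast intro: le_less_trans)
      obtain M where M: "M \<in> Ipow N"
          "(\<forall>D\<in>A n. D \<subseteq> M \<longrightarrow> D \<in> \<E>) \<or> (\<forall>D\<in>\<E>. D \<subseteq> M \<longrightarrow> D \<in> A n)"
        using hereditary_dichotomy[OF rankedD(2,1)[OF \<rho>(1)] E(1,2) Ipow_trans[OF N L]] by auto
      have "M \<in> Ipow L" by (rule Ipow_trans[OF M(1) N])
      then have "\<not> (\<forall>D\<in>\<E>. D \<subseteq> M \<longrightarrow> D \<in> A n)" using no \<rho> by auto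
      then have "\<forall>D\<in>A n. D \<subseteq> M \<longrightarrow> D \<in> \<E>"
        using M(2) by argo
      then show "\<exists>M\<in>Ipow N. \<forall>D\<in>A n. D \<subseteq> M \<longrightarrow> D \<in> \<E>" using M(1) by (rule bexI)
    qed
    then show False using not_full by contradiction
  qed
qed

section \<open>Partitions into maximal members of a nice family\<close>

lemma niceD:
  assumes "nice \<P>"
  shows "regular \<P>" "\<P> \<subseteq> Fpow {1..}" "hereditary \<P>" "spreading \<P>" "compactin cantor \<P>" "{1} \<in> \<P>"
    and "\<And>E. E \<in> \<P> \<Longrightarrow> E \<noteq> {} \<Longrightarrow> E \<notin> maximals \<P> \<Longrightarrow> insert (1 + Max E) E \<in> \<P>"
  using assms regularD by (auto simp: nice_def)

lemma empty_mem_nice: "nice \<P> \<Longrightarrow> {} \<in> \<P>"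
  using hereditaryD[OF niceD(3) niceD(6)] by blast

lemma maximalsD:
  assumes "nice \<P>" "E \<in> maximals \<P>"
  shows "E \<in> \<P>" "finite E" "E \<noteq> {}" "E \<subseteq> {1..}" "\<And>F. F \<in> \<P> \<Longrightarrow> E \<subseteq> F \<Longrightarrow> F = E"
proof -
  show "E \<in> \<P>" and max: "\<And>F. F \<in> \<P> \<Longrightarrow> E \<subseteq> F \<Longrightarrow> F = E" using assms(2) by (auto simp: maximals_def)
  then show "finite E" "E \<subseteq> {1..}" using niceD(2)[OF assms(1)] by (auto simp: Fpow_def)
  show "E \<noteq> {}" using max[OF niceD(6)[OF assms(1)]] by auto
qed

lemma singleton_mem_nice:
  assumes "nice \<P>" "1 \<le> n" shows "{n} \<in> \<P>"
proof -
  have "(\<lambda>_ :: nat. n) ` {1} \<in> \<P>"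
    by (rule spreading_image[OF niceD(4,6)[OF assms(1)], of "\<lambda>_. n"])
      (use assms(2) in \<open>auto simp: strict_mono_on_def\<close>)
  then show ?thesis by simp
qed

lemma insert_later_mem_spreading:
  fixes m n :: nat
  assumes "spreading \<P>" "insert m E \<in> \<P>" "finite E" "\<forall>x\<in>E. x < m" "m \<le> n"
  shows "insert n E \<in> \<P>"
proof -
  have "(\<lambda>x. if x = m then n else x) ` insert m E \<in> \<P>"
    by (rule spreading_image[OF assms(1,2)]) (use assms(3-5) in \<open>auto simp: strict_mono_on_def\<close>)
  moreover have "(\<lambda>x. if x = m then n else x) ` insert m E = insert n E" using assms(4) by force
  ultimately show ?thesis by simp
qed

lemma insert_mem_of_not_maximal:
  assumes "nice \<P>" "E \<in> \<P>" "E \<notin> maximals \<P>" "1 \<le> n" "\<forall>x\<in>E. x < n"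
  shows "insert n E \<in> \<P>"
proof (cases "E = {}")
  case True
  then show ?thesis using singleton_mem_nice[OF assms(1,4)] by simp
next
  case False
  have fin: "finite E" using assms(2) niceD(2)[OF assms(1)] by (auto simp: Fpow_def)
  show ?thesis
    by (rule insert_later_mem_spreading[OF niceD(4)[OF assms(1)] niceD(7)[OF assms(1,2) False assms(3)] fin])
      (use assms(5) fin False in \<open>auto simp: less_Suc_eq_le Suc_le_eq\<close>)
qed

lemma maximal_initial_segment_ex:
  assumes P: "nice \<P>" and M: "M \<in> Ipow {1..}"
  shows "\<exists>k. M \<inter> {..<k} \<in> maximals \<P>"
proof -
  have ex: "\<exists>k. M \<inter> {..k} \<notin> \<P>" using compactin_cantorD[OF niceD(5,2)[OF P] M] .
  define k where "k = (LEAST k. M \<inter> {..k} \<notin> \<P>)"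
  have k: "M \<inter> {..k} \<notin> \<P>" unfolding k_def by (rule LeastI_ex[OF ex])
  have lt: "M \<inter> {..<k} \<in> \<P>"
  proof (cases k)
    case 0
    then show ?thesis using empty_mem_nice[OF P] by simp
  next
    case (Suc j)
    then have "M \<inter> {..j} \<in> \<P>" using not_less_Least[of j "\<lambda>k. M \<inter> {..k} \<notin> \<P>"] by (simp add: k_def)
    then show ?thesis using Suc by (simp add: lessThan_Suc_atMost)
  qed
  have "k \<in> M"
  proof (rule ccontr)
    assume "k \<notin> M"
    then have "M \<inter> {..k} = M \<inter> {..<k}" by (auto simp: order_le_less)
    then show False using k lt by simp
  qed
  then have ins: "insert k (M \<inter> {..<k}) = M \<inter> {..k}" and k1: "1 \<le> k"
    using M by (auto simp: order_le_less Ipow_def)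
  have "M \<inter> {..<k} \<in> maximals \<P>"
  proof (rule ccontr)
    assume "M \<inter> {..<k} \<notin> maximals \<P>"
    then have "insert k (M \<inter> {..<k}) \<in> \<P>"
      using insert_mem_of_not_maximal[OF P lt _ k1] by auto
    then show False using ins k by simp
  qed
  then show ?thesis ..
qed

lemma maximals_eq: "E \<in> maximals \<P> \<Longrightarrow> F \<in> maximals \<P> \<Longrightarrow> E \<subseteq> F \<Longrightarrow> E = F"
  unfolding maximals_def by blast

lemma maximal_initial_segment_unique:
  assumes "M \<inter> {..<k} \<in> maximals \<P>" "M \<inter> {..<l} \<in> maximals \<P>"
  shows "M \<inter> {..<k} = M \<inter> {..<(l::nat)}"
proof (cases "k \<le> l")
  case True
  then have "M \<inter> {..<k} \<subseteq> M \<inter> {..<l}" by auto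
  then show ?thesis by (rule maximals_eq[OF assms])
next
  case False
  then have "M \<inter> {..<l} \<subseteq> M \<inter> {..<k}" by auto
  then show ?thesis by (rule maximals_eq[OF assms(2,1), symmetric])
qed

text \<open>The property describing \<open>block \<P> M\<close>.\<close>

definition block_partition :: "nat set set \<Rightarrow> nat set \<Rightarrow> (nat \<Rightarrow> nat set) \<Rightarrow> bool" where
  "block_partition \<P> M B \<longleftrightarrow> B 0 = {} \<and> (\<forall>n\<ge>1. B n \<in> maximals \<P>) \<and>
     (\<forall>n\<ge>1. before (B n) (B (Suc n))) \<and> (\<Union>n\<in>{1..}. B n) = M"

lemma block_partitionD:
  assumes P: "nice \<P>" and B: "block_partition \<P> M B" and n: "1 \<le> n"
  shows "B n \<in> maximals \<P>" "B n \<in> \<P>" "finite (B n)" "B n \<noteq> {}" "B n \<subseteq> {1..}" "B n \<subseteq> M"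
    and "\<And>m. n < m \<Longrightarrow> \<forall>x\<in>B n. \<forall>y\<in>B m. x < y"
proof -
  have max: "B k \<in> maximals \<P>" if "1 \<le> k" for k using B that by (simp add: block_partition_def)
  show "B n \<in> maximals \<P>" using max[OF n] .
  show "B n \<in> \<P>" "finite (B n)" "B n \<noteq> {}" "B n \<subseteq> {1..}" using maximalsD[OF P max[OF n]] by auto
  show "B n \<subseteq> M" using B n by (auto simp: block_partition_def)
  show "\<forall>x\<in>B n. \<forall>y\<in>B m. x < y" if "n < m" for m
    by (rule before_chain[of m B n m])
      (use B n that maximalsD(2,3)[OF P max] in \<open>auto simp: block_partition_def\<close>)
qed

lemma block_partition_Union:
  assumes "block_partition \<P> M B" shows "M = (\<Union>n\<in>{1..}. B n)"
  using assms by (simp add: block_partition_def)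

lemma block_partition_tail:
  assumes P: "nice \<P>" and B: "block_partition \<P> M B"
  shows "M - (\<Union>i\<in>{1..<r}. B i) = (\<Union>i\<in>{r..} \<inter> {1..}. B i)"
proof -
  have disj: "B i \<inter> B j = {}" if "1 \<le> i" "i < j" for i j
    using block_partitionD(7)[OF P B that] by fastforce
  show ?thesis
  proof (intro equalityI subsetI)
    fix x assume x: "x \<in> M - (\<Union>i\<in>{1..<r}. B i)"
    then obtain n where n: "1 \<le> n" "x \<in> B n" using block_partition_Union[OF B] by auto
    then have "r \<le> n" using x by (meson DiffD2 UN_I atLeastLessThan_iff not_le)
    then show "x \<in> (\<Union>i\<in>{r..} \<inter> {1..}. B i)" using n by auto
  next
    fix x assume "x \<in> (\<Union>i\<in>{r..} \<inter> {1..}. B i)"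
    then obtain n where n: "r \<le> n" "1 \<le> n" "x \<in> B n" by auto
    have "x \<notin> B i" if "i \<in> {1..<r}" for i using disj[of i n] that n by auto
    then show "x \<in> M - (\<Union>i\<in>{1..<r}. B i)" using n block_partition_Union[OF B] by auto
  qed
qed

text \<open>Each block is an initial segment of what the earlier blocks leave over; this makes the partition
  unique.\<close>

lemma block_partition_initial:
  assumes P: "nice \<P>" and B: "block_partition \<P> M B" and n: "1 \<le> n"
  shows "B n = (M - (\<Union>i\<in>{1..<n}. B i)) \<inter> {..<Min (B (Suc n))}"
proof -
  note D = block_partitionD[OF P B]
  have "Min (B (Suc n)) \<in> B (Suc n)" using D(3,4)[of "Suc n"] by simp
  then have lt: "x < Min (B (Suc n))" if "x \<in> B n" for x using D(7)[OF n, of "Suc n"] that by blast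
  have ge: "Min (B (Suc n)) \<le> x" if "x \<in> B m" "n < m" for x m
  proof (cases "m = Suc n")
    case True
    then show ?thesis using that D(3)[of "Suc n"] by simp
  next
    case False
    then have "Min (B (Suc n)) < x"
      using D(7)[of "Suc n" m] that \<open>Min (B (Suc n)) \<in> B (Suc n)\<close> by simp
    then show ?thesis by simp
  qed
  show ?thesis
  proof (intro equalityI subsetI)
    fix x assume "x \<in> B n"
    then show "x \<in> (M - (\<Union>i\<in>{1..<n}. B i)) \<inter> {..<Min (B (Suc n))}"
      unfolding block_partition_tail[OF P B] using lt n by auto
  next
    fix x assume "x \<in> (M - (\<Union>i\<in>{1..<n}. B i)) \<inter> {..<Min (B (Suc n))}"
    then obtain m where m: "n \<le> m" "x \<in> B m" "x < Min (B (Suc n))"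
      unfolding block_partition_tail[OF P B] by auto
    then have "m = n" using ge[of x m] by (cases "m = n") auto
    then show "x \<in> B n" using m by simp
  qed
qed

lemma block_partition_unique:
  assumes P: "nice \<P>" and B: "block_partition \<P> M B" and B': "block_partition \<P> M B'"
  shows "B = B'"
proof
  fix n show "B n = B' n"
  proof (induction n rule: less_induct)
    case (less n)
    show ?case
    proof (cases "n = 0")
      case True
      then show ?thesis using B B' by (simp add: block_partition_def)
    next
      case False
      then have n: "1 \<le> n" by simp
      have eq: "(\<Union>i\<in>{1..<n}. B' i) = (\<Union>i\<in>{1..<n}. B i)" using less by auto
      let ?N = "M - (\<Union>i\<in>{1..<n}. B i)"
      have 1: "B n = ?N \<inter> {..<Min (B (Suc n))}" by (rule block_partition_initial[OF P B n])
      have 2: "B' n = ?N \<inter> {..<Min (B' (Suc n))}"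
        using block_partition_initial[OF P B' n] unfolding eq .
      show ?thesis
        using maximal_initial_segment_unique[of ?N _ \<P>] block_partitionD(1)[OF P B n]
          block_partitionD(1)[OF P B' n] unfolding 1 2 by blast
    qed
  qed
qed

lemma block_partition_ex:
  assumes P: "nice \<P>" and M: "M \<in> Ipow {1..}"
  shows "\<exists>B. block_partition \<P> M B"
proof -
  define R where "R = (\<lambda>N N'. \<exists>k. N \<inter> {..<k} \<in> maximals \<P> \<and> N' = N - {..<k})"
  have step: "\<exists>N'. N' \<in> Ipow {1..} \<and> R N N'" if N: "N \<in> Ipow {1..}" for N
  proof -
    obtain k where "N \<inter> {..<k} \<in> maximals \<P>" using maximal_initial_segment_ex[OF P N] by blast
    moreover have "N - {..<k} \<in> Ipow {1..}" using N Diff_infinite_finite[of "{..<k}" N] by (auto simp: Ipow_def)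
    ultimately show ?thesis by (auto simp: R_def)
  qed
  have "\<exists>S. \<forall>i. (S i \<in> Ipow {1..} \<and> (i = 0 \<longrightarrow> S i = M)) \<and> R (S i) (S (Suc i))"
    by (intro dependent_nat_choice) (use M step in auto)
  then obtain S where S: "S 0 = M" "\<And>i. S i \<in> Ipow {1..}" "\<And>i. R (S i) (S (Suc i))" by blast
  from S(3) have "\<exists>k. \<forall>i. S i \<inter> {..<k i} \<in> maximals \<P> \<and> S (Suc i) = S i - {..<k i}"
    unfolding R_def by metis
  then obtain k where k: "\<And>i. S i \<inter> {..<k i} \<in> maximals \<P>" "\<And>i. S (Suc i) = S i - {..<k i}" by blast
  define B where "B n = (if n = 0 then {} else S (n - 1) \<inter> {..<k (n - 1)})" for n
  have BS: "B (Suc i) = S i \<inter> {..<k i}" for i by (simp add: B_def)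
  have BD: "finite (B (Suc i))" "B (Suc i) \<noteq> {}" for i
    using maximalsD(2,3)[OF P k(1)[of i]] by (simp_all add: BS)
  have SM: "S i \<subseteq> M" for i by (induction i) (use S(1) k(2) in auto)
  have "before (B (Suc i)) (B (Suc (Suc i)))" for i
  proof -
    have "Max (B (Suc i)) \<in> S i \<inter> {..<k i}" using Max_in[OF BD] BS by metis
    moreover have "Min (B (Suc (Suc i))) \<in> S (Suc i)" using Min_in[OF BD, of "Suc i"] BS[of "Suc i"] by blast
    ultimately show ?thesis using k(2)[of i] by (auto simp: before_def)
  qed
  then have bef: "before (B n) (B (Suc n))" if "1 \<le> n" for n using that by (cases n) auto
  have "(\<Union>n\<in>{1..}. B n) = M"
  proof (intro equalityI subsetI)
    fix x assume "x \<in> (\<Union>n\<in>{1..}. B n)"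
    then show "x \<in> M" using SM by (auto simp: B_def)
  next
    fix x assume x: "x \<in> M"
    show "x \<in> (\<Union>n\<in>{1..}. B n)"
    proof (rule ccontr)
      assume no: "x \<notin> (\<Union>n\<in>{1..}. B n)"
      have xS: "x \<in> S i" for i
      proof (induction i)
        case (Suc i)
        have "x \<notin> B (Suc i)" using no by auto
        then show ?case using Suc k(2)[of i] BS[of i] by auto
      qed (use S(1) x in simp)
      have "k i \<le> x" for i
        using xS[of "Suc i"] k(2)[of i] by auto
      moreover have kmono: "k i < k (Suc i)" for i
      proof -
        obtain y where "y \<in> B (Suc (Suc i))" using BD by blast
        then show ?thesis using BS[of "Suc i"] k(2)[of i] by auto
      qed
      have "i \<le> k i" for i by (induction i) (use kmono in \<open>auto simp: Suc_le_eq intro: le_less_trans\<close>)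
      from this[of "Suc x"] \<open>\<And>i. k i \<le> x\<close>[of "Suc x"] show False by simp
    qed
  qed
  moreover have "B n \<in> maximals \<P>" if "1 \<le> n" for n using that k(1)[of "n - 1"] by (simp add: B_def)
  ultimately have "block_partition \<P> M B"
    unfolding block_partition_def using bef by (simp add: B_def)
  then show ?thesis by - (rule exI)
qed

lemma block_eqI:
  assumes "nice \<P>" "block_partition \<P> M B" shows "block \<P> M = B"
  unfolding block_def block_partition_def[symmetric]
  by (rule the_equality, rule assms(2), rule block_partition_unique[OF assms(1) _ assms(2)])

lemma block_partition_block:
  assumes "nice \<P>" "M \<in> Ipow {1..}" shows "block_partition \<P> M (block \<P> M)"
  using block_partition_ex[OF assms] block_eqI[OF assms(1)] by metis

lemma block_tail:
  assumes P: "nice \<P>" and M: "M \<in> Ipow {1..}" and r: "1 \<le> r"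
  shows "M - (\<Union>i\<in>{1..<r}. block \<P> M i) \<in> Ipow {1..}"
    and "1 \<le> n \<Longrightarrow> block \<P> (M - (\<Union>i\<in>{1..<r}. block \<P> M i)) n = block \<P> M (r - 1 + n)"
proof -
  let ?B = "block \<P> M" and ?N = "M - (\<Union>i\<in>{1..<r}. block \<P> M i)"
  have B: "block_partition \<P> M ?B" by (rule block_partition_block[OF P M])
  note D = block_partitionD[OF P B]
  have "finite (\<Union>i\<in>{1..<r}. ?B i)" using D(3) by auto
  then show "?N \<in> Ipow {1..}" using M Diff_infinite_finite by (auto simp: Ipow_def)
  define B' where "B' n = (if n = 0 then {} else ?B (r - 1 + n))" for n
  have "(\<Union>n\<in>{1..}. B' n) = (\<Union>i\<in>{r..} \<inter> {1..}. ?B i)"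
  proof (intro equalityI subsetI)
    fix x assume "x \<in> (\<Union>n\<in>{1..}. B' n)"
    then obtain n where "1 \<le> n" "x \<in> ?B (r - 1 + n)" by (auto simp: B'_def)
    then show "x \<in> (\<Union>i\<in>{r..} \<inter> {1..}. ?B i)" using r by (intro UN_I[of "r - 1 + n"]) auto
  next
    fix x assume "x \<in> (\<Union>i\<in>{r..} \<inter> {1..}. ?B i)"
    then obtain i where "r \<le> i" "x \<in> ?B i" by auto
    then have "x \<in> B' (i - r + 1)" using r by (simp add: B'_def)
    then show "x \<in> (\<Union>n\<in>{1..}. B' n)" by auto
  qed
  then have "block_partition \<P> ?N B'"
    unfolding block_partition_def block_partition_tail[OF P B]
    using B by (auto simp: B'_def block_partition_def)
  then show "block \<P> ?N n = ?B (r - 1 + n)" if "1 \<le> n"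
    using block_eqI[OF P] that by (simp add: B'_def)
qed

section \<open>Probability blocks: sufficient implies regulatory\<close>

lemma probability_blockD:
  assumes "probability_block \<PP> \<P>"
  shows "nice \<P>"
    and "\<And>M r. M \<in> Ipow {1..} \<Longrightarrow> 1 \<le> r \<Longrightarrow> \<PP> (M - (\<Union>i\<in>{1..<r}. set_pmf (\<PP> M i))) 1 = \<PP> M r"
    and "\<And>M. M \<in> Ipow {1..} \<Longrightarrow> set_pmf (\<PP> M 1) = block \<P> M 1"
    and "\<And>M N r s i. M \<in> Ipow {1..} \<Longrightarrow> N \<in> Ipow {1..} \<Longrightarrow> (\<And>i. i \<in> {1..s} \<Longrightarrow> 1 \<le> r i) \<Longrightarrow>
      strict_mono_on {1..s} r \<Longrightarrow> initial_segment (\<Union>i\<in>{1..s}. set_pmf (\<PP> M (r i))) N \<Longrightarrow>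
      i \<in> {1..s} \<Longrightarrow> \<PP> N i = \<PP> M (r i)"
  using assms unfolding probability_block_def by blast+

lemma set_pmf_probability_block:
  assumes PB: "probability_block \<PP> \<P>" and M: "M \<in> Ipow {1..}" and n: "1 \<le> n"
  shows "set_pmf (\<PP> M n) = block \<P> M n"
  using n
proof (induction n rule: less_induct)
  case (less n)
  note P = probability_blockD(1)[OF PB]
  have eq: "(\<Union>i\<in>{1..<n}. set_pmf (\<PP> M i)) = (\<Union>i\<in>{1..<n}. block \<P> M i)" using less.IH by auto
  let ?N = "M - (\<Union>i\<in>{1..<n}. block \<P> M i)"
  have "\<PP> ?N 1 = \<PP> M n" using probability_blockD(2)[OF PB M less.prems] by (simp only: eq)
  moreover have "set_pmf (\<PP> ?N 1) = block \<P> ?N 1"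
    by (rule probability_blockD(3)[OF PB block_tail(1)[OF P M less.prems]])
  moreover have "block \<P> ?N 1 = block \<P> M n"
    using block_tail(2)[OF P M less.prems, of 1] less.prems by simp
  ultimately show ?case by simp
qed

text \<open>Sufficiency applies to all families of rank below \<open>\<omega>\<^sup>\<xi>\<close>, regular or not.\<close>

lemma sufficient_ranked:
  assumes suff: "sufficient \<xi> \<PP> \<P>" and A: "ranked \<A> \<rho>" "\<rho> {} < omega_power \<xi>"
    and "0 < \<epsilon>" "L \<in> Ipow {1..}"
  shows "\<exists>M\<in>Ipow L. \<forall>N\<in>Ipow M. \<forall>E\<in>\<A>. measure_pmf.prob (\<PP> N 1) E \<le> \<epsilon>"
proof -
  obtain \<G> where G: "regular \<G>" "CB \<G> \<le> osucc (\<rho> {})" "\<A> \<subseteq> \<G>"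
    using ranked_subset_regular[OF A(1)] .
  have "CB \<G> \<le> omega_power \<xi>" using G(2) A(2) by (meson order_trans osucc_le_iff)
  then have "\<exists>M\<in>Ipow L. \<forall>N\<in>Ipow M. \<forall>E\<in>\<G>. measure_pmf.prob (\<PP> N 1) E \<le> \<epsilon>"
    using suff G(1) assms(4,5) unfolding sufficient_def by auto
  then show ?thesis using G(3) by (meson subsetD)
qed

text \<open>If the family of finite sets \<open>E\<close> with \<open>f (i, F) \<ge> \<delta>\<close> on \<open>E\<close>, for some \<open>F\<close>, were not \<open>\<xi>\<close>-full, it would
  have rank below \<open>\<omega>\<^sup>\<xi>\<close> on some infinite set. By sufficiency the set where \<open>f\<close> is at least \<open>\<delta>\<close> then has
  small mass for some \<open>\<PP>\<^bsub>N,1\<^esub>\<close>, and as \<open>f\<close> is bounded, its mean is smaller than \<open>\<epsilon>\<close>.\<close>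

theorem regulatory_if_sufficient:
  assumes s: "admissible s" and suff: "sufficient \<xi> \<PP> \<P>"
  shows "regulatory s \<xi> \<PP> \<P>"
  unfolding regulatory_def
proof (intro conjI allI impI ballI)
  show PB: "probability_block \<PP> \<P>" using suff by (simp add: sufficient_def)
  note P = probability_blockD(1)[OF PB]
  fix f :: "nat \<times> nat set \<Rightarrow> real" and \<delta> \<epsilon> :: real and L
  assume f: "bounded (f ` ({1..} \<times> maximals \<P>)) \<and> \<delta> < \<epsilon>" and L: "L \<in> Ipow {1..}"
    and ge: "\<forall>M\<in>Ipow L. (\<Sum>\<^sub>\<infinity>i\<in>{1..}. pmf (\<PP> M 1) i * f (i, set_pmf (\<PP> M 1))) \<ge> \<epsilon>"
  let ?E = "{E \<in> Fpow L. \<exists>F \<in> maximals \<P> \<inter> Fpow L. \<forall>i\<in>E. f (i, F) \<ge> \<delta>}"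
  have supp: "set_pmf (\<PP> N 1) \<in> maximals \<P>" "set_pmf (\<PP> N 1) \<in> Fpow N" if N: "N \<in> Ipow {1..}" for N
    using block_partitionD[OF P block_partition_block[OF P N], of 1] set_pmf_probability_block[OF PB N]
    by (auto simp: Fpow_def)
  show "full s \<xi> ?E"
  proof (rule ccontr)
    assume not_full: "\<not> full s \<xi> ?E"
    have her: "hereditary ?E"
      unfolding hereditary_def
    proof (intro ballI allI impI)
      fix E D assume E: "E \<in> ?E" "D \<subseteq> E"
      then obtain F where "F \<in> maximals \<P> \<inter> Fpow L" "\<forall>i\<in>E. f (i, F) \<ge> \<delta>" by blast
      moreover from this E(2) have "\<forall>i\<in>D. f (i, F) \<ge> \<delta>" by blast
      moreover have "D \<in> Fpow L" using E by (auto simp: Fpow_def intro: finite_subset)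
      ultimately show "D \<in> ?E" by blast
    qed
    have sub: "?E \<subseteq> Fpow {1..}" using L by (auto simp: Fpow_def Ipow_def)
    have emp: "{} \<in> ?E" using supp[OF L] by (auto simp: Fpow_def)
    obtain M \<A> \<rho> where M: "M \<in> Ipow L" "ranked \<A> \<rho>" "\<rho> {} < omega_power \<xi>"
        "\<forall>D\<in>?E. D \<subseteq> M \<longrightarrow> D \<in> \<A>"
      using full_or_small_rank[OF s her sub emp L not_full] by blast
    obtain C where C: "\<forall>x\<in>f ` ({1..} \<times> maximals \<P>). \<bar>x\<bar> \<le> C" "0 < C"
      using f bounded_pos[of "f ` ({1..} \<times> maximals \<P>)"] by (auto simp: real_norm_def)
    \<comment> \<open>a set of mass \<open>e\<close>, on which \<open>f \<le> C\<close>, raises the mean above \<open>\<delta>\<close> by at most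
      \<open>(\<epsilon> - \<delta>) / 2\<close>\<close>
    define e where "e = (\<epsilon> - \<delta>) / (2 * (C + \<bar>\<delta>\<bar>))"
    have epos: "0 < e" using f C(2) by (simp add: e_def)
    have M1: "M \<in> Ipow {1..}" by (rule Ipow_trans[OF M(1) L])
    obtain N where N: "N \<in> Ipow M" "\<forall>N'\<in>Ipow N. \<forall>E\<in>\<A>. measure_pmf.prob (\<PP> N' 1) E \<le> e"
      using sufficient_ranked[OF suff M(2,3) epos M1] by blast
    have N1: "N \<in> Ipow {1..}" by (rule Ipow_trans[OF N(1) M1])
    have NL: "N \<in> Ipow L" by (rule Ipow_trans[OF N(1) M(1)])
    define p where "p = \<PP> N 1"
    define F where "F = set_pmf p"
    have F: "F \<in> maximals \<P>" "finite F" "F \<subseteq> N" "F \<subseteq> {1..}"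
      using supp[OF N1] N1 by (auto simp: F_def p_def Fpow_def Ipow_def)
    define E where "E = {i \<in> F. \<delta> \<le> f (i, F)}"
    have "E \<in> ?E" using F NL by (auto simp: E_def Fpow_def Ipow_def intro!: bexI[of _ F])
    moreover have "E \<subseteq> M" using F(3) N(1) by (auto simp: E_def Ipow_def)
    ultimately have "E \<in> \<A>" using M(4) by blast
    then have pE: "measure_pmf.prob p E \<le> e" using N Ipow_refl[OF N(1)] by (simp add: p_def)
    have "(\<Sum>\<^sub>\<infinity>i\<in>{1..}. pmf p i * f (i, F)) = (\<Sum>\<^sub>\<infinity>i\<in>F. pmf p i * f (i, F))"
      by (rule infsum_cong_neutral) (use F in \<open>auto simp: F_def set_pmf_iff\<close>)
    also have "\<dots> = (\<Sum>i\<in>F. pmf p i * f (i, F))" using F(2) by simp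
    also have "\<dots> \<le> (\<Sum>i\<in>F. pmf p i * \<delta> + (if i \<in> E then pmf p i * (C + \<bar>\<delta>\<bar>) else 0))"
    proof (rule sum_mono)
      fix i assume i: "i \<in> F"
      have "f (i, F) \<le> C" using C(1) i F by (auto simp: abs_le_iff)
      then have "f (i, F) \<le> \<delta> + (if i \<in> E then C + \<bar>\<delta>\<bar> else 0)" using i by (auto simp: E_def)
      from mult_left_mono[OF this pmf_nonneg[of p i]]
      show "pmf p i * f (i, F) \<le> pmf p i * \<delta> + (if i \<in> E then pmf p i * (C + \<bar>\<delta>\<bar>) else 0)"
        by (simp add: distrib_left split: if_splits)
    qed
    also have "\<dots> = \<delta> * (\<Sum>i\<in>F. pmf p i) + (C + \<bar>\<delta>\<bar>) * (\<Sum>i\<in>E. pmf p i)"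
    proof -
      have "(\<Sum>i\<in>F. if i \<in> E then pmf p i * (C + \<bar>\<delta>\<bar>) else 0) = (\<Sum>i\<in>E. pmf p i * (C + \<bar>\<delta>\<bar>))"
        using F(2) by (intro sum.mono_neutral_cong_right) (auto simp: E_def)
      then show ?thesis by (simp add: sum.distrib sum_distrib_left mult.commute)
    qed
    also have "(\<Sum>i\<in>F. pmf p i) = 1" using F(2) by (intro sum_pmf_eq_1) (auto simp: F_def)
    also have "(\<Sum>i\<in>E. pmf p i) = measure_pmf.prob p E"
      using F(2) by (intro measure_measure_pmf_finite[symmetric]) (simp add: E_def)
    also have "\<delta> * 1 + (C + \<bar>\<delta>\<bar>) * measure_pmf.prob p E \<le> \<delta> + (C + \<bar>\<delta>\<bar>) * e"
      using pE C(2) by (intro add_mono mult_left_mono) auto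
    also have "\<dots> = \<delta> + (\<epsilon> - \<delta>) / 2" using C(2) by (simp add: e_def field_simps)
    also have "\<dots> < \<epsilon>" using f by (simp add: field_simps)
    finally have "(\<Sum>\<^sub>\<infinity>i\<in>{1..}. pmf p i * f (i, F)) < \<epsilon>" .
    then show False using ge NL by (auto simp: p_def F_def not_le[symmetric])
  qed
qed

section \<open>Composition of nice families\<close>

text \<open>Decomposing into maximal members uses the fewest and latest pieces: the minima of such a
  decomposition of \<open>D\<close>, followed by \<open>x\<close>, dominate minima of any decomposition of a set containing
  \<open>insert x D\<close>. Indeed the first piece \<open>E\<close> of the latter cannot contain the first maximal piece \<open>B\<close>
  and a later point, so it ends before the next piece of \<open>D\<close> begins.\<close>

lemma decomp_maximals_dominates:
  assumes P: "nice \<P>"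
  shows "decomp (maximals \<P>) D L \<Longrightarrow> \<forall>y\<in>D. y < x \<Longrightarrow> decomp \<P> C X \<Longrightarrow> insert x D \<subseteq> C \<Longrightarrow>
    \<exists>\<phi>. strict_mono_on (insert x L) \<phi> \<and> \<phi> ` insert x L \<subseteq> X \<and> (\<forall>l\<in>insert x L. \<phi> l \<le> l)"
proof (induction arbitrary: C X rule: decomp.induct)
  case empty
  then have C: "finite C" "C \<noteq> {}" "finite X" "X \<noteq> {}" "x \<in> C" using decomp_finite[of \<P> C X] by auto
  have "Min X \<le> x" using decomp_Min[OF empty(2) C(2)] C by simp
  moreover have "Min X \<in> X" using C by simp
  ultimately show ?case by (intro exI[of _ "\<lambda>_. Min X"]) (auto simp: strict_mono_on_def)
next
  case (insert B D L)
  from insert.prems(2) show ?case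
  proof cases
    case empty
    then show ?thesis using insert.prems(3) by auto
  next
    case (insert E G Y)
    note maxB = maximalsD[OF P \<open>B \<in> maximals \<P>\<close>]
    have "insert x D \<subseteq> G"
    proof (rule ccontr)
      assume "\<not> insert x D \<subseteq> G"
      then obtain y where y: "y \<in> insert x D" "y \<notin> G" by blast
      then have yE: "y \<in> E" using insert.prems(3) insert(1) by auto
      have lt: "\<forall>b\<in>B. b < y" using y(1) insert.prems(1) \<open>\<forall>x\<in>B. \<forall>y\<in>D. x < y\<close> by auto
      have "z \<in> E" if "z \<in> B" for z
      proof (rule ccontr)
        assume "z \<notin> E"
        then have "z \<in> G" using that insert.prems(3) insert(1) by auto
        then have "y < z" using insert(6) yE by blast
        then show False using lt that by (meson less_asym)
      qed
      then have "B \<subseteq> E" by blast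
      then have "E = B" using maxB(5)[OF insert(3)] by blast
      then show False using yE lt by auto
    qed
    then obtain \<phi> where \<phi>: "strict_mono_on (insert x L) \<phi>" "\<phi> ` insert x L \<subseteq> Y"
        "\<forall>l\<in>insert x L. \<phi> l \<le> l"
      using insert.IH[OF _ insert(7)] insert.prems(1) by blast
    let ?b = "Min B"
    have b: "?b \<in> B" using maxB by simp
    have LD: "L \<subseteq> D" using decomp_finite[OF insert.hyps(5)] by blast
    have blt: "?b < l" if "l \<in> insert x L" for l
      using that b LD insert.prems(1) insert.hyps(4) by blast
    have YG: "Y \<subseteq> G" using decomp_finite[OF insert(7)] by blast
    have Elt: "Min E < z" if "z \<in> Y" for z by (rule Min_less_of_less[OF insert(4,5,6) YG that])
    have "Min E \<le> ?b"
    proof (cases "?b \<in> E")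
      case True
      then show ?thesis using insert(5) by simp
    next
      case False
      then have "?b \<in> G" using b insert.prems(3) insert(1) by auto
      then have "Min E < ?b" by (rule Min_less_of_less[OF insert(4,5,6) subset_refl])
      then show ?thesis by simp
    qed
    let ?\<phi> = "\<phi>(?b := Min E)"
    have old: "?\<phi> l = \<phi> l" if "l \<in> insert x L" for l using blt[OF that] by auto
    have set: "insert x (insert ?b L) = insert ?b (insert x L)" by blast
    have "strict_mono_on (insert ?b (insert x L)) ?\<phi>"
    proof (rule strict_mono_onI)
      fix u v assume uv: "u \<in> insert ?b (insert x L)" "v \<in> insert ?b (insert x L)" "u < v"
      have v: "v \<in> insert x L"
      proof (rule ccontr)
        assume "v \<notin> insert x L"
        then have "v = ?b" "u \<in> insert x L" using uv by auto
        then show False using blt[of u] uv(3) by simp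
      qed
      show "?\<phi> u < ?\<phi> v"
      proof (cases "u = ?b")
        case True
        have "\<phi> v \<in> Y" using \<phi>(2) v by blast
        then have "Min E < \<phi> v" by (rule Elt)
        then show ?thesis using True old[OF v] by simp
      next
        case False
        then have u: "u \<in> insert x L" using uv(1) by blast
        show ?thesis using old[OF u] old[OF v] strict_mono_onD[OF \<phi>(1) u v uv(3)] by simp
      qed
    qed
    moreover have "?\<phi> ` insert ?b (insert x L) \<subseteq> X" using \<phi>(2) insert(2) by auto
    moreover have "\<forall>l\<in>insert ?b (insert x L). ?\<phi> l \<le> l" using \<phi>(3) \<open>Min E \<le> ?b\<close> by auto
    ultimately show ?thesis unfolding set by blast
  qed
qed

lemma insert_minima_mem:
  assumes P: "nice \<P>" and Q: "hereditary \<Q>" "spreading \<Q>"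
    and D: "decomp (maximals \<P>) D L" "\<forall>y\<in>D. y < x" and mem: "insert x D \<in> composition \<Q> \<P>"
  shows "insert x L \<in> \<Q>"
proof -
  obtain X where X: "X \<in> \<Q>" "decomp \<P> (insert x D) X" using mem by (auto simp: composition_def)
  obtain \<phi> where \<phi>: "strict_mono_on (insert x L) \<phi>" "\<phi> ` insert x L \<subseteq> X"
      "\<forall>l\<in>insert x L. \<phi> l \<le> l"
    using decomp_maximals_dominates[OF P D X(2) subset_refl] by blast
  show ?thesis
    by (rule spreading_of_dominated[OF Q(2) hereditaryD[OF Q(1) X(1) \<phi>(2)] _ \<phi>(1)])
      (use decomp_finite[OF D(1)] \<phi>(3) in auto)
qed

lemma decomp_append:
  "decomp \<A> F X \<Longrightarrow> R \<in> \<A> \<Longrightarrow> R \<noteq> {} \<Longrightarrow> finite R \<Longrightarrow> \<forall>x\<in>F. \<forall>y\<in>R. x < y \<Longrightarrow>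
    decomp \<A> (F \<union> R) (insert (Min R) X)"
proof (induction rule: decomp.induct)
  case empty
  then show ?case using decomp_singleton by simp
next
  case (insert E F X)
  have "decomp \<A> (E \<union> (F \<union> R)) (insert (Min E) (insert (Min R) X))"
    by (rule decomp.insert) (use insert in auto)
  then show ?case by (simp add: Un_assoc insert_commute)
qed

lemma decomp_last:
  "decomp \<A> F X \<Longrightarrow> F \<noteq> {} \<Longrightarrow> \<exists>F' X' R. decomp \<A> F' X' \<and> R \<in> \<A> \<and> R \<noteq> {} \<and> finite R \<and>
    (\<forall>x\<in>F'. \<forall>y\<in>R. x < y) \<and> F = F' \<union> R \<and> X = insert (Min R) X'"
proof (induction rule: decomp.induct)
  case (insert E F X)
  show ?case
  proof (cases "F = {}")
    case True
    then have "X = {}" using insert(5) decomp_finite by blast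
    then show ?thesis
      using True insert(1-3) decomp.empty by (intro exI[of _ "{}"] exI[of _ E]) simp
  next
    case False
    then obtain F' X' R where IH: "decomp \<A> F' X'" "R \<in> \<A>" "R \<noteq> {}" "finite R"
        "\<forall>x\<in>F'. \<forall>y\<in>R. x < y" "F = F' \<union> R" "X = insert (Min R) X'"
      using insert.IH by blast
    have "decomp \<A> (E \<union> F') (insert (Min E) X')"
      by (rule decomp.insert) (use insert IH in auto)
    moreover have "\<forall>x\<in>E \<union> F'. \<forall>y\<in>R. x < y" using insert(4) IH(5,6) by auto
    moreover have "E \<union> F = (E \<union> F') \<union> R" "insert (Min E) X = insert (Min R) (insert (Min E) X')"
      using IH(6,7) by auto
    ultimately show ?thesis using IH(2-4) by blast
  qed
qed simp

text \<open>Replacing \<open>z\<close> by a later point \<open>n\<close> is a spread even if \<open>z\<close> is not the last element: all elements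
  from \<open>z\<close> on are shifted to the next one.\<close>

lemma insert_mem_spreading_of_insert_earlier:
  fixes E :: "nat set"
  assumes sp: "spreading \<G>" and mem: "insert z E \<in> \<G>" and fin: "finite E" and z: "z \<notin> E" "\<exists>x\<in>E. z < x"
    and n: "\<forall>x\<in>E. x < n"
  shows "insert n E \<in> \<G>"
proof -
  define \<phi> where "\<phi> y = (if y < z then y else LEAST w. w \<in> insert n E \<and> y < w)" for y
  have zn: "z < n" using z n by (meson less_trans)
  have L: "\<phi> y \<in> insert n E" "y < \<phi> y" "\<And>w. w \<in> insert n E \<Longrightarrow> y < w \<Longrightarrow> \<phi> y \<le> w"
    if y: "y \<in> insert z E" "\<not> y < z" for y
  proof -
    have "\<exists>w. w \<in> insert n E \<and> y < w" using y(1) zn n by blast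
    from LeastI_ex[OF this] show "\<phi> y \<in> insert n E" "y < \<phi> y" using y(2) by (simp_all add: \<phi>_def)
    show "\<phi> y \<le> w" if "w \<in> insert n E" "y < w" for w
      using Least_le[of "\<lambda>w. w \<in> insert n E \<and> y < w" w] y(2) that by (simp add: \<phi>_def)
  qed
  have sm: "strict_mono_on (insert z E) \<phi>"
  proof (rule strict_mono_onI)
    fix u v assume uv: "u \<in> insert z E" "v \<in> insert z E" "u < v"
    show "\<phi> u < \<phi> v"
    proof (cases "v < z")
      case True
      then show ?thesis using uv(3) by (simp add: \<phi>_def)
    next
      case False
      note Lv = L[OF uv(2) False]
      show ?thesis
      proof (cases "u < z")
        case True
        then have "\<phi> u = u" by (simp add: \<phi>_def)
        then show ?thesis using uv(3) Lv(2) by simp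
      next
        case False
        then have "v \<in> insert n E" using uv by auto
        then have "\<phi> u \<le> v" using L(3)[OF uv(1) False] uv(3) by blast
        then show ?thesis using Lv(2) by simp
      qed
    qed
  qed
  have ge: "y \<le> \<phi> y" if "y \<in> insert z E" for y
    using L(2)[OF that] by (cases "y < z") (auto simp: \<phi>_def intro: less_imp_le)
  have "\<phi> ` insert z E \<in> \<G>" by (rule spreading_image[OF sp mem _ sm ge]) (use fin in auto)
  moreover have "\<phi> ` insert z E = insert n E"
  proof (rule card_subset_eq)
    show "\<phi> ` insert z E \<subseteq> insert n E"
    proof
      fix w assume "w \<in> \<phi> ` insert z E"
      then obtain y where y: "y \<in> insert z E" "w = \<phi> y" by blast
      show "w \<in> insert n E"
      proof (cases "y < z")
        case True
        then show ?thesis using y by (auto simp: \<phi>_def)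
      next
        case False
        then show ?thesis using L(1)[OF y(1) False] y(2) by blast
      qed
    qed
    have "n \<notin> E" using n by auto
    then show "card (\<phi> ` insert z E) = card (insert n E)"
      using card_image[OF strict_mono_on_imp_inj_on[OF sm]] z(1) fin by simp
  qed (use fin in simp)
  ultimately show ?thesis by simp
qed

lemma decomp_mono: "decomp \<A> F X \<Longrightarrow> \<A> \<subseteq> \<B> \<Longrightarrow> decomp \<B> F X"
  by (induction rule: decomp.induct) (auto intro: decomp.intros)

lemma maximals_subset: "maximals \<P> \<subseteq> \<P>"
  by (auto simp: maximals_def)

lemma decomp_blocks:
  assumes P: "nice \<P>" and B: "block_partition \<P> M B" and J: "finite J" "J \<subseteq> {1..}"
  shows "decomp (maximals \<P>) (\<Union>i\<in>J. B i) ((\<lambda>i. Min (B i)) ` J)"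
  using J
proof (induction J rule: finite_linorder_min_induct)
  case empty
  then show ?case using decomp.empty by simp
next
  case (insert a J)
  note D = block_partitionD[OF P B]
  have a: "1 \<le> a" using insert by simp
  have "\<forall>x\<in>B a. \<forall>y\<in>(\<Union>i\<in>J. B i). x < y" using D(7)[OF a] insert(2) by blast
  then have "decomp (maximals \<P>) (B a \<union> (\<Union>i\<in>J. B i)) (insert (Min (B a)) ((\<lambda>i. Min (B i)) ` J))"
    using D(1,3,4)[OF a] insert by (intro decomp.insert) auto
  then show ?case by simp
qed

lemma Min_block_strict_mono:
  assumes P: "nice \<P>" and B: "block_partition \<P> M B" and "1 \<le> i" "i < j"
  shows "Min (B i) < Min (B j)"
  using block_partitionD(7)[OF P B assms(3,4)] block_partitionD(3,4)[OF P B, of i]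
    block_partitionD(3,4)[OF P B, of j] assms(3,4) by simp

lemma Ipow_block_minima:
  assumes P: "nice \<P>" and B: "block_partition \<P> M B"
  shows "(\<lambda>i. Min (B i)) ` {1..} \<in> Ipow M"
proof -
  have inj: "inj_on (\<lambda>i. Min (B i)) {1..}"
    by (rule strict_mono_on_imp_inj_on) (auto intro!: strict_mono_onI Min_block_strict_mono[OF P B])
  have "infinite ((\<lambda>i. Min (B i)) ` {1..})" using inj by (simp add: finite_image_iff infinite_Ici)
  moreover have "Min (B i) \<in> M" if "1 \<le> i" for i
    using block_partitionD(3,4,6)[OF P B that] Min_in by blast
  ultimately show ?thesis by (auto simp: Ipow_def)
qed

lemma le_Min_block:
  assumes P: "nice \<P>" and B: "block_partition \<P> M B" and "1 \<le> i"
  shows "i \<le> Min (B i)"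
  using assms(3)
proof (induction i rule: dec_induct)
  case base
  have "Min (B 1) \<in> {1..}" using block_partitionD(3,4,5)[OF P B, of 1] Min_in by blast
  then show ?case by simp
next
  case (step i)
  then show ?case using Min_block_strict_mono[OF P B step(1), of "Suc i"] by simp
qed

text \<open>If the minima of the first \<open>k + 1\<close> blocks of \<open>M\<close> do not form a member of \<open>\<Q>\<close>, then the first \<open>k\<close> blocks
  together with the next minimum do not form a member of \<open>\<Q>[\<P>]\<close>.\<close>

lemma composition_no_branch:
  assumes P: "nice \<P>" and Q: "nice \<Q>" and M: "M \<in> Ipow {1..}"
  shows "\<exists>k. M \<inter> {..k} \<notin> composition \<Q> \<P>"
proof -
  let ?B = "block \<P> M"
  have B: "block_partition \<P> M ?B" by (rule block_partition_block[OF P M])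
  note D = block_partitionD[OF P B]
  define l where "l = (\<lambda>i. Min (?B i))"
  have L: "l ` {1..} \<in> Ipow {1..}" unfolding l_def by (rule Ipow_trans[OF Ipow_block_minima[OF P B] M])
  obtain k where k: "l ` {1..} \<inter> {..k} \<notin> \<Q>" using compactin_cantorD[OF niceD(5,2)[OF Q] L] by blast
  have "l ` {1..} \<inter> {..k} \<subseteq> l ` {1..Suc k}"
  proof safe
    fix i :: nat assume "1 \<le> i" "l i \<le> k"
    then have "i \<le> Suc k" using le_Min_block[OF P B, of i] by (simp add: l_def)
    then show "l i \<in> l ` {1..Suc k}" using \<open>1 \<le> i\<close> by auto
  qed
  then have notQ: "l ` {1..Suc k} \<notin> \<Q>" using k hereditaryD[OF niceD(3)[OF Q]] by blast
  let ?D = "\<Union>i\<in>{1..k}. ?B i" and ?x = "l (Suc k)"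
  have xB: "?x \<in> ?B (Suc k)" unfolding l_def using D(3,4)[of "Suc k"] by simp
  have lt: "\<forall>y\<in>?D. y < ?x"
  proof
    fix y assume "y \<in> ?D"
    then obtain i where i: "i \<in> {1..k}" "y \<in> ?B i" by blast
    then show "y < ?x" using D(7)[of i "Suc k"] xB by auto
  qed
  have D_dec: "decomp (maximals \<P>) ?D (l ` {1..k})" unfolding l_def by (rule decomp_blocks[OF P B]) auto
  have "insert ?x ?D \<subseteq> M \<inter> {..?x}"
  proof -
    have "?x \<in> M" using xB D(6)[of "Suc k"] by auto
    moreover have "?D \<subseteq> M" using D(6) by (intro UN_least) simp
    moreover have "?D \<subseteq> {..?x}" using lt by (auto intro: less_imp_le)
    ultimately show ?thesis by blast
  qed
  moreover have "insert ?x ?D \<notin> composition \<Q> \<P>"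
  proof
    assume "insert ?x ?D \<in> composition \<Q> \<P>"
    from insert_minima_mem[OF P niceD(3,4)[OF Q] D_dec lt this]
    have "insert ?x (l ` {1..k}) \<in> \<Q>" .
    moreover have "insert ?x (l ` {1..k}) = l ` {1..Suc k}" by (simp add: atLeastAtMostSuc_conv)
    ultimately show False using notQ by simp
  qed
  ultimately have "M \<inter> {..?x} \<notin> composition \<Q> \<P>"
    using hereditaryD[OF hereditary_composition[OF niceD(3,4)[OF Q] niceD(3)[OF P]]] by blast
  then show ?thesis by blast
qed

lemma nice_composition:
  assumes P: "nice \<P>" and Q: "nice \<Q>" shows "nice (composition \<Q> \<P>)"
proof -
  let ?R = "composition \<Q> \<P>"
  have sub: "?R \<subseteq> Fpow {1..}" by (rule composition_subset[OF niceD(2)[OF P]])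
  have her: "hereditary ?R" by (rule hereditary_composition[OF niceD(3,4)[OF Q] niceD(3)[OF P]])
  have spr: "spreading ?R" by (rule spreading_composition[OF niceD(4)[OF Q] niceD(4)[OF P]])
  have "regular ?R"
    unfolding regular_def
    using sub her spr compactin_cantorI[OF sub her composition_no_branch[OF P Q]] by simp
  moreover have "{1} \<in> ?R"
    using decomp_singleton[OF niceD(6)[OF P]] niceD(6)[OF Q] by (intro compositionI[of _ _ "{1}"]) auto
  moreover have "insert (1 + Max E) E \<in> ?R" if E: "E \<in> ?R" "E \<noteq> {}" "E \<notin> maximals ?R" for E
  proof -
    let ?n = "1 + Max E"
    have fin: "finite E" "E \<subseteq> {1..}" using E(1) sub by (auto simp: Fpow_def)
    have n: "\<forall>x\<in>E. x < ?n" using fin(1) by (simp add: less_Suc_eq_le)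
    obtain F where F: "F \<in> ?R" "E \<subseteq> F" "F \<noteq> E" using E(1,3) by (auto simp: maximals_def)
    then obtain z where z: "z \<in> F" "z \<notin> E" by blast
    have zE: "insert z E \<in> ?R" using hereditaryD[OF her F(1), of "insert z E"] z F(2) by blast
    show ?thesis
    proof (cases "\<exists>x\<in>E. z < x")
      case True
      then show ?thesis by (rule insert_mem_spreading_of_insert_earlier[OF spr zE fin(1) z(2) _ n])
    next
      case False
      then have ltz: "\<forall>x\<in>E. x < z" using z(2) by (metis linorder_neqE_nat)
      obtain X where X: "X \<in> \<Q>" "decomp \<P> (insert z E) X" using zE by (auto simp: composition_def)
      obtain F' X' R where R: "decomp \<P> F' X'" "R \<in> \<P>" "R \<noteq> {}" "finite R" "\<forall>x\<in>F'. \<forall>y\<in>R. x < y"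
          "insert z E = F' \<union> R" "X = insert (Min R) X'"
        using decomp_last[OF X(2)] by blast
      have zR: "z \<in> R"
      proof (rule ccontr)
        assume "z \<notin> R"
        moreover have "z \<in> F' \<union> R" "R \<subseteq> insert z E" unfolding R(6)[symmetric] using R(6) by blast+
        ultimately have "z \<in> F'" "R \<subseteq> E" by blast+
        then obtain y where "y \<in> R" "z < y" "y < z" using R(3,5) ltz by blast
        then show False by simp
      qed
      then have "z \<notin> F'" using R(5) by blast
      define R' where "R' = R - {z}"
      have "E = insert z E - {z}" using z(2) by blast
      also have "\<dots> = F' \<union> R'" unfolding R(6) R'_def using \<open>z \<notin> F'\<close> by blast
      finally have E': "E = F' \<union> R'" .
      have R'lt: "\<forall>x\<in>F'. \<forall>y\<in>insert ?n R'. x < y" using R(5) n E' unfolding R'_def by auto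
      show ?thesis
      proof (cases "R' = {}")
        case True
        then have "R = {z}" "E = F'" using zR E' unfolding R'_def by auto
        then have X': "insert z X' \<in> \<Q>" "z \<notin> X'" using X(1) R(7) decomp_finite[OF R(1)] z(2) by auto
        then have "X' \<in> \<Q>" using hereditaryD[OF niceD(3)[OF Q] X'(1)] by blast
        moreover have "X' \<notin> maximals \<Q>"
          using maximalsD(5)[OF Q _ X'(1)] X'(2) by blast
        ultimately have "X' \<in> \<Q>" "X' \<notin> maximals \<Q>" by simp_all
        then have "insert ?n X' \<in> \<Q>"
          using decomp_finite[OF R(1)] n \<open>E = F'\<close> by (intro insert_mem_of_not_maximal[OF Q]) auto
        moreover have "decomp \<P> (F' \<union> {?n}) (insert (Min {?n}) X')"
          by (rule decomp_append[OF R(1) singleton_mem_nice[OF P]]) (use R'lt in auto)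
        ultimately show ?thesis using \<open>E = F'\<close> by (intro compositionI[of _ _ "insert ?n X'"]) auto
      next
        case False
        have "insert ?n R' \<in> \<P>"
        proof (rule insert_mem_of_not_maximal[OF P])
          show "R' \<in> \<P>" using hereditaryD[OF niceD(3)[OF P] R(2)] by (auto simp: R'_def)
          show "R' \<notin> maximals \<P>" using maximalsD(5)[OF P _ R(2), of R'] zR by (auto simp: R'_def)
        qed (use n E' in auto)
        then have d: "decomp \<P> (F' \<union> insert ?n R') (insert (Min (insert ?n R')) X')"
          using R'lt R(4) by (intro decomp_append[OF R(1)]) (auto simp: R'_def)
        have fR: "finite R'" using R(4) by (simp add: R'_def)
        have MR: "Min R' \<in> R'" using False fR by simp
        have "Min R' \<le> z" "Min R' \<le> ?n"
          using MR ltz n E' by (auto intro: less_imp_le)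
        moreover have "R = insert z R'" using zR by (auto simp: R'_def)
        ultimately have "Min R = Min R'" "Min (insert ?n R') = Min R'"
          using Min_insert[OF fR False] by (simp_all only: min_absorb2)
        then have "insert (Min (insert ?n R')) X' = X" using R(7) by simp
        moreover have "F' \<union> insert ?n R' = insert ?n E" using E' by blast
        ultimately have "decomp \<P> (insert ?n E) X" using d by simp
        then show ?thesis using X(1) by (rule compositionI)
      qed
    qed
  qed
  ultimately show ?thesis unfolding nice_def by blast
qed

text \<open>The blocks for \<open>\<Q>[\<P>]\<close> collect those blocks for \<open>\<P>\<close> whose minima form one block for \<open>\<Q>\<close>.\<close>

lemma block_composition:
  assumes P: "nice \<P>" and Q: "nice \<Q>" and M: "M \<in> Ipow {1..}"
  defines "l \<equiv> \<lambda>i. Min (block \<P> M i)"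
  shows "block (composition \<Q> \<P>) M = (\<lambda>n. \<Union>i\<in>{i \<in> {1..}. l i \<in> block \<Q> (l ` {1..}) n}. block \<P> M i)"
proof -
  let ?B = "block \<P> M" and ?L = "l ` {1..}"
  have B: "block_partition \<P> M ?B" by (rule block_partition_block[OF P M])
  note D = block_partitionD[OF P B]
  have L: "?L \<in> Ipow {1..}" unfolding l_def by (rule Ipow_trans[OF Ipow_block_minima[OF P B] M])
  let ?Q = "block \<Q> ?L"
  have BQ: "block_partition \<Q> ?L ?Q" by (rule block_partition_block[OF Q L])
  note DQ = block_partitionD[OF Q BQ]
  have mono: "l i < l j" if "1 \<le> i" "i < j" for i j
    unfolding l_def by (rule Min_block_strict_mono[OF P B that])
  have lB: "l i \<in> ?B i" if "1 \<le> i" for i unfolding l_def using D(3,4)[OF that] by simp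
  define J where "J n = {i \<in> {1..}. l i \<in> ?Q n}" for n
  define C where "C n = (\<Union>i\<in>J n. ?B i)" for n
  have lJ: "l ` J n = ?Q n" if "1 \<le> n" for n using DQ(6)[OF that] by (auto simp: J_def)
  have finJ: "finite (J n)" if n: "1 \<le> n" for n
  proof (rule finite_subset)
    show "J n \<subseteq> {..Max (?Q n)}"
    proof
      fix i assume "i \<in> J n"
      then have "i \<le> l i" "l i \<le> Max (?Q n)"
        using le_Min_block[OF P B, of i] DQ(3)[OF n] by (auto simp: J_def l_def)
      then show "i \<in> {..Max (?Q n)}" by simp
    qed
  qed simp
  have decC: "decomp (maximals \<P>) (C n) (?Q n)" if n: "1 \<le> n" for n
  proof -
    have "decomp (maximals \<P>) (\<Union>i\<in>J n. ?B i) ((\<lambda>i. Min (?B i)) ` J n)"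
      by (rule decomp_blocks[OF P B finJ[OF n]]) (auto simp: J_def)
    moreover have "(\<lambda>i. Min (?B i)) ` J n = ?Q n" using lJ[OF n] by (simp add: l_def)
    ultimately show ?thesis by (simp add: C_def)
  qed
  have maxC: "C n \<in> maximals (composition \<Q> \<P>)" if n: "1 \<le> n" for n
  proof (rule ccontr)
    assume notmax: "C n \<notin> maximals (composition \<Q> \<P>)"
    have mem: "C n \<in> composition \<Q> \<P>" by (rule compositionI[OF decomp_mono[OF decC[OF n] maximals_subset] DQ(2)[OF n]])
    have fin: "finite (C n)" using decomp_finite[OF decC[OF n]] by blast
    let ?x = "1 + Max (C n)"
    have lt: "\<forall>y\<in>C n. y < ?x" using fin by (simp add: less_Suc_eq_le)
    have "insert ?x (C n) \<in> composition \<Q> \<P>"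
      by (rule insert_mem_of_not_maximal[OF nice_composition[OF P Q] mem notmax _ lt]) simp
    from insert_minima_mem[OF P niceD(3,4)[OF Q] decC[OF n] lt this]
    have "insert ?x (?Q n) \<in> \<Q>" .
    then have "insert ?x (?Q n) = ?Q n" using maximalsD(5)[OF Q DQ(1)[OF n]] by blast
    then have "?x \<in> C n" using decomp_finite[OF decC[OF n]] by blast
    then show False using lt by blast
  qed
  have befC: "before (C n) (C (Suc n))" if n: "1 \<le> n" for n
  proof -
    have fin: "finite (C n)" "finite (C (Suc n))" using decomp_finite[OF decC[OF n]] decomp_finite[OF decC[of "Suc n"]] by auto
    have "x < y" if xy: "x \<in> C n" "y \<in> C (Suc n)" for x y
    proof -
      obtain i j where i: "i \<in> J n" "x \<in> ?B i" and j: "j \<in> J (Suc n)" "y \<in> ?B j"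
        using xy by (auto simp: C_def)
      have "l i < l j" using DQ(7)[OF n, of "Suc n"] i(1) j(1) by (auto simp: J_def)
      then have "i < j" using mono[of j i] j(1) by (cases i j rule: linorder_cases) (auto simp: J_def)
      then show ?thesis using D(7)[of i j] i j by (auto simp: J_def)
    qed
    then show ?thesis using fin Max_in Min_in unfolding before_def by blast
  qed
  have "(\<Union>n\<in>{1..}. C n) = M"
  proof (intro equalityI subsetI)
    fix x assume "x \<in> (\<Union>n\<in>{1..}. C n)"
    then obtain n i where "i \<in> J n" "x \<in> ?B i" by (auto simp: C_def)
    then show "x \<in> M" using D(6)[of i] by (auto simp: J_def)
  next
    fix x assume "x \<in> M"
    then obtain i where i: "1 \<le> i" "x \<in> ?B i" using block_partition_Union[OF B] by auto
    then have "l i \<in> ?L" by simp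
    then obtain n where "1 \<le> n" "l i \<in> ?Q n" using block_partition_Union[OF BQ] by auto
    then show "x \<in> (\<Union>n\<in>{1..}. C n)" using i by (auto simp: C_def J_def)
  qed
  moreover have "C 0 = {}" using BQ by (simp add: C_def J_def block_partition_def)
  ultimately have "block_partition (composition \<Q> \<P>) M C"
    unfolding block_partition_def using maxC befC by simp
  from block_eqI[OF nice_composition[OF P Q] this] show ?thesis
    by (simp add: C_def J_def fun_eq_iff)
qed

section \<open>Convolutions of probability blocks\<close>

lemma elt_strict_mono_image:
  assumes f: "\<And>i j. 1 \<le> i \<Longrightarrow> i < j \<Longrightarrow> f i < f j" and n: "1 \<le> n"
  shows "elt (f ` {1..}) n = f n"
proof -
  let ?S = "f ` {1..}"
  have inj: "inj_on f {1..}" by (rule strict_mono_on_imp_inj_on) (auto intro!: strict_mono_onI f)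
  then have infS: "infinite ?S" by (simp add: finite_image_iff infinite_Ici)
  have le: "f i \<le> f j" if "1 \<le> i" "i \<le> j" for i j using f[of i j] that by (cases "i = j") auto
  have "enumerate ?S n = f (Suc n)" for n
  proof (induction n)
    case 0
    have "(LEAST s. s \<in> ?S) = f 1" by (rule Least_equality) (auto intro: le)
    then show ?case by (simp add: enumerate_0)
  next
    case (Suc n)
    have "(LEAST s. s \<in> ?S \<and> f (Suc n) < s) = f (Suc (Suc n))"
    proof (rule Least_equality)
      show "f (Suc (Suc n)) \<in> ?S \<and> f (Suc n) < f (Suc (Suc n))" using f[of "Suc n" "Suc (Suc n)"] by auto
      fix y assume "y \<in> ?S \<and> f (Suc n) < y"
      then obtain i where i: "1 \<le> i" "y = f i" "f (Suc n) < f i" by auto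
      then have "Suc n < i" using le[of i "Suc n"] by (meson not_le)
      then show "f (Suc (Suc n)) \<le> y" using i le[of "Suc (Suc n)" i] by simp
    qed
    then show ?case by (simp only: enumerate_Suc''[OF infS] Suc)
  qed
  from this[of "n - 1"] n show ?thesis by (simp add: elt_def)
qed

text \<open>The minimum of the support of \<open>\<PP>\<^bsub>M,i\<^esub>\<close>, the set of all these minima for \<open>i \<ge> 1\<close>, and the measure
  \<open>\<PP>\<^bsub>M,i\<^esub>\<close> as a function of the minimum of its support. The latter is only used at such minima.\<close>

definition block_min :: "(nat set \<Rightarrow> nat \<Rightarrow> nat pmf) \<Rightarrow> nat set \<Rightarrow> nat \<Rightarrow> nat" where
  "block_min \<PP> M i = Min (set_pmf (\<PP> M i))"

definition block_minima :: "(nat set \<Rightarrow> nat \<Rightarrow> nat pmf) \<Rightarrow> nat set \<Rightarrow> nat set" where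
  "block_minima \<PP> M = block_min \<PP> M ` {1..}"

definition block_kernel :: "(nat set \<Rightarrow> nat \<Rightarrow> nat pmf) \<Rightarrow> nat set \<Rightarrow> nat \<Rightarrow> nat pmf" where
  "block_kernel \<PP> M x = \<PP> M (inv_into {1..} (block_min \<PP> M) x)"

context
  fixes \<PP> \<P> M assumes PB: "probability_block \<PP> \<P>" and M: "M \<in> Ipow {1..}"
begin

lemma block_partition_set_pmf: "block_partition \<P> M (block \<P> M)"
  by (rule block_partition_block[OF probability_blockD(1)[OF PB] M])

lemma set_pmf_less:
  "1 \<le> i \<Longrightarrow> i < j \<Longrightarrow> x \<in> set_pmf (\<PP> M i) \<Longrightarrow> y \<in> set_pmf (\<PP> M j) \<Longrightarrow> x < y"
  using block_partitionD(7)[OF probability_blockD(1)[OF PB] block_partition_set_pmf, of i j]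
    set_pmf_probability_block[OF PB M, of i] set_pmf_probability_block[OF PB M, of j] by auto

lemma finite_set_pmf_block: "1 \<le> i \<Longrightarrow> finite (set_pmf (\<PP> M i))"
  using block_partitionD(3)[OF probability_blockD(1)[OF PB] block_partition_set_pmf, of i]
    set_pmf_probability_block[OF PB M, of i] by simp

lemma block_min_eq: "1 \<le> i \<Longrightarrow> block_min \<PP> M i = Min (block \<P> M i)"
  by (simp add: block_min_def set_pmf_probability_block[OF PB M])

lemma block_min_mem: "1 \<le> i \<Longrightarrow> block_min \<PP> M i \<in> set_pmf (\<PP> M i)"
  unfolding block_min_def by (rule Min_in[OF finite_set_pmf_block]) (simp_all add: set_pmf_not_empty)

lemma block_min_less:
  assumes "1 \<le> i" "i < j" shows "block_min \<PP> M i < block_min \<PP> M j"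
  by (rule set_pmf_less[OF assms block_min_mem[OF assms(1)] block_min_mem]) (use assms in simp)

lemma block_min_less_iff: "1 \<le> i \<Longrightarrow> 1 \<le> j \<Longrightarrow> block_min \<PP> M i < block_min \<PP> M j \<longleftrightarrow> i < j"
  using block_min_less[of i j] block_min_less[of j i] by (cases i j rule: linorder_cases) auto

lemma inj_on_block_min: "inj_on (block_min \<PP> M) {1..}"
  by (rule strict_mono_on_imp_inj_on) (auto intro!: strict_mono_onI block_min_less)

lemma block_kernel_block_min: "1 \<le> i \<Longrightarrow> block_kernel \<PP> M (block_min \<PP> M i) = \<PP> M i"
  unfolding block_kernel_def using inv_into_f_f[OF inj_on_block_min, of i] by simp

lemma block_minima_eq: "block_minima \<PP> M = (\<lambda>i. Min (block \<P> M i)) ` {1..}"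
  unfolding block_minima_def by (rule image_cong) (simp_all add: block_min_eq)

lemma block_minima_mem: "block_minima \<PP> M \<in> Ipow M"
  unfolding block_minima_eq by (rule Ipow_block_minima[OF probability_blockD(1)[OF PB] block_partition_set_pmf])

lemma block_minima_Ipow_atLeast: "block_minima \<PP> M \<in> Ipow {1..}"
  by (rule Ipow_trans[OF block_minima_mem M])

lemma elt_block_minima: "1 \<le> i \<Longrightarrow> elt (block_minima \<PP> M) i = block_min \<PP> M i"
  unfolding block_minima_def by (rule elt_strict_mono_image) (rule block_min_less)

text \<open>The convolution as a two-stage experiment: choose the minimum of a block according to \<open>\<QQ>\<close>, then a
  point of that block according to the member of \<open>\<PP>\<close> supported by it.\<close>

lemma convolve_eq_bind_pmf:
  assumes QB: "probability_block \<QQ> \<Q>" and n: "1 \<le> n"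
  shows "convolve \<Q> \<QQ> \<PP> M n = bind_pmf (\<QQ> (block_minima \<PP> M) n) (block_kernel \<PP> M)"
proof -
  let ?L = "block_minima \<PP> M" and ?l = "block_min \<PP> M"
  let ?q = "\<QQ> ?L n" and ?J = "block_inv \<Q> (block_minima \<PP> M) n"
  note Q = probability_blockD(1)[OF QB]
  have sq: "set_pmf ?q = block \<Q> ?L n"
    by (rule set_pmf_probability_block[OF QB block_minima_Ipow_atLeast n])
  note bQ = block_partition_block[OF Q block_minima_Ipow_atLeast]
  have J: "?J = {i \<in> {1..}. ?l i \<in> block \<Q> ?L n}"
    unfolding block_inv_def using elt_block_minima by auto
  have im: "?l ` ?J = block \<Q> ?L n"
    using block_partitionD(6)[OF Q bQ n] unfolding J by (auto simp: block_minima_def)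
  have inj: "inj_on ?l ?J" by (rule inj_on_subset[OF inj_on_block_min]) (auto simp: J)
  have "(\<Sum>i\<in>?J. pmf ?q (?l i) * pmf (\<PP> M i) k) = pmf (bind_pmf ?q (block_kernel \<PP> M)) k" for k
  proof -
    have "pmf (bind_pmf ?q (block_kernel \<PP> M)) k = (\<integral>x. pmf (block_kernel \<PP> M x) k \<partial>measure_pmf ?q)"
      by (rule pmf_bind)
    also have "\<dots> = (\<Sum>x\<in>block \<Q> ?L n. pmf (block_kernel \<PP> M x) k * pmf ?q x)"
      using block_partitionD(3)[OF Q bQ n] sq by (intro integral_measure_pmf_real) auto
    also have "\<dots> = (\<Sum>i\<in>?J. pmf (block_kernel \<PP> M (?l i)) k * pmf ?q (?l i))"
      unfolding im[symmetric] by (simp add: sum.reindex[OF inj])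
    also have "\<dots> = (\<Sum>i\<in>?J. pmf ?q (?l i) * pmf (\<PP> M i) k)"
      by (rule sum.cong) (auto simp: J block_kernel_block_min mult.commute)
    finally show ?thesis by simp
  qed
  then have "convolve \<Q> \<QQ> \<PP> M n = embed_pmf (pmf (bind_pmf ?q (block_kernel \<PP> M)))"
    by (simp add: convolve_def Let_def block_minima_def block_min_def)
  also have "\<dots> = bind_pmf ?q (block_kernel \<PP> M)"
    by (rule type_definition.Rep_inverse[OF td_pmf_embed_pmf])
  finally show ?thesis .
qed

lemma set_pmf_convolve:
  assumes QB: "probability_block \<QQ> \<Q>" and n: "1 \<le> n"
  shows "set_pmf (convolve \<Q> \<QQ> \<PP> M n) = (\<Union>i\<in>{i \<in> {1..}. block_min \<PP> M i \<in> set_pmf (\<QQ> (block_minima \<PP> M) n)}. set_pmf (\<PP> M i))"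
proof -
  note Q = probability_blockD(1)[OF QB]
  have "set_pmf (\<QQ> (block_minima \<PP> M) n) \<subseteq> block_minima \<PP> M"
    using set_pmf_probability_block[OF QB block_minima_Ipow_atLeast n]
      block_partitionD(6)[OF Q block_partition_block[OF Q block_minima_Ipow_atLeast] n] by simp
  moreover define J where "J = {i \<in> {1..}. block_min \<PP> M i \<in> set_pmf (\<QQ> (block_minima \<PP> M) n)}"
  ultimately have A: "set_pmf (\<QQ> (block_minima \<PP> M) n) = block_min \<PP> M ` J"
    by (auto simp: block_minima_def)
  have "set_pmf (convolve \<Q> \<QQ> \<PP> M n) = (\<Union>i\<in>J. set_pmf (block_kernel \<PP> M (block_min \<PP> M i)))"
    unfolding convolve_eq_bind_pmf[OF QB n] set_bind_pmf A by simp
  also have "\<dots> = (\<Union>i\<in>J. set_pmf (\<PP> M i))"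
    by (rule SUP_cong) (simp_all add: block_kernel_block_min J_def)
  finally show ?thesis by (simp only: J_def)
qed

lemma set_pmf_convolve_eq_block:
  assumes QB: "probability_block \<QQ> \<Q>" and n: "1 \<le> n"
  shows "set_pmf (convolve \<Q> \<QQ> \<PP> M n) = block (composition \<Q> \<P>) M n"
proof -
  have "set_pmf (convolve \<Q> \<QQ> \<PP> M n) =
      (\<Union>i\<in>{i \<in> {1..}. block_min \<PP> M i \<in> block \<Q> (block_minima \<PP> M) n}. set_pmf (\<PP> M i))"
    unfolding set_pmf_convolve[OF QB n] set_pmf_probability_block[OF QB block_minima_Ipow_atLeast n] ..
  also have "\<dots> = (\<Union>i\<in>{i \<in> {1..}. Min (block \<P> M i) \<in> block \<Q> ((\<lambda>i. Min (block \<P> M i)) ` {1..}) n}.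
      block \<P> M i)"
    unfolding block_minima_eq by (rule SUP_cong) (auto simp: block_min_eq set_pmf_probability_block[OF PB M])
  also have "\<dots> = block (composition \<Q> \<P>) M n"
    by (simp only: block_composition[OF probability_blockD(1)[OF PB] probability_blockD(1)[OF QB] M])
  finally show ?thesis .
qed

end

lemma finite_set_strict_mono_enum:
  fixes I :: "nat set"
  assumes "finite I"
  obtains k :: "nat \<Rightarrow> nat" and t :: nat where "strict_mono_on {1..t} k" "k ` {1..t} = I"
proof -
  define xs where "xs = sorted_list_of_set I"
  have xs: "set xs = I" "sorted_wrt (<) xs" using assms by (auto simp: xs_def)
  define k where "k i = xs ! (i - 1)" for i
  have "strict_mono_on {1..length xs} k"
    by (rule strict_mono_onI) (auto simp: k_def intro!: sorted_wrt_nth_less[OF xs(2)])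
  moreover have "k ` {1..length xs} = I"
  proof -
    have "{1..length xs} = Suc ` {..<length xs}" by (simp add: lessThan_atLeast0 image_Suc_atLeastLessThan atLeastLessThanSuc_atLeastAtMost)
    then have "k ` {1..length xs} = (\<lambda>i. xs ! i) ` {..<length xs}"
      by (simp add: image_image k_def)
    then show ?thesis using xs(1) by (auto simp: set_conv_nth)
  qed
  ultimately show ?thesis by (rule that)
qed

text \<open>The third property of probability blocks for the convolution. The hypothesis involves the blocks
  \<open>\<PP>\<^bsub>M,j\<^esub>\<close> with \<open>j\<close> in a finite set \<open>I\<close>, enumerated by \<open>k\<close>; it gives \<open>\<PP>\<^bsub>N,j\<^esub> = \<PP>\<^bsub>M,k j\<^esub>\<close>, so the minima
  selected by \<open>\<QQ>\<close> in \<open>M\<close> form an initial segment of the minima in \<open>N\<close>.\<close>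

lemma convolve_local:
  assumes PB: "probability_block \<PP> \<P>" and QB: "probability_block \<QQ> \<Q>"
    and M: "M \<in> Ipow {1..}" and N: "N \<in> Ipow {1..}"
    and r: "\<And>i. i \<in> {1..s} \<Longrightarrow> 1 \<le> r i" "strict_mono_on {1..s} r"
    and init: "initial_segment (\<Union>i\<in>{1..s}. set_pmf (convolve \<Q> \<QQ> \<PP> M (r i))) N"
    and i: "i \<in> {1..s}"
  shows "convolve \<Q> \<QQ> \<PP> N i = convolve \<Q> \<QQ> \<PP> M (r i)"
proof -
  let ?LM = "block_minima \<PP> M" and ?LN = "block_minima \<PP> N" and ?lM = "block_min \<PP> M" and ?lN = "block_min \<PP> N"
  note LM = block_minima_Ipow_atLeast[OF PB M] and LN = block_minima_Ipow_atLeast[OF PB N]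
  note Q = probability_blockD(1)[OF QB]
  define V where "V = (\<Union>t\<in>{1..s}. set_pmf (\<QQ> ?LM (r t)))"
  define I where "I = {j \<in> {1..}. ?lM j \<in> V}"
  have finV: "finite V" unfolding V_def using finite_set_pmf_block[OF QB LM] r(1) by blast
  have "V \<subseteq> ?LM"
    unfolding V_def using set_pmf_probability_block[OF QB LM] r(1)
      block_partitionD(6)[OF Q block_partition_block[OF Q LM]] by blast
  then have V: "V = ?lM ` I" unfolding I_def by (auto simp: block_minima_def)
  have "inj_on ?lM I" by (rule inj_on_subset[OF inj_on_block_min[OF PB M]]) (auto simp: I_def)
  then have finI: "finite I" using finV V by (simp add: finite_image_iff)
  obtain k :: "nat \<Rightarrow> nat" and t :: nat where k: "strict_mono_on {1..t} k" "k ` {1..t} = I"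
    by (rule finite_set_strict_mono_enum[OF finI])
  have k1: "1 \<le> k j" if "j \<in> {1..t}" for j using k(2) that by (auto simp: I_def)
  have "(\<Union>j\<in>{1..s}. set_pmf (convolve \<Q> \<QQ> \<PP> M (r j))) = (\<Union>j\<in>I. set_pmf (\<PP> M j))"
  proof -
    have "(\<Union>j\<in>{1..s}. set_pmf (convolve \<Q> \<QQ> \<PP> M (r j))) =
        (\<Union>j\<in>{1..s}. \<Union>a\<in>{a \<in> {1..}. ?lM a \<in> set_pmf (\<QQ> ?LM (r j))}. set_pmf (\<PP> M a))"
      by (rule SUP_cong) (use set_pmf_convolve[OF PB M QB] r(1) in auto)
    also have "\<dots> = (\<Union>j\<in>I. set_pmf (\<PP> M j))" unfolding I_def V_def by blast
    finally show ?thesis .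
  qed
  also have "\<dots> = (\<Union>j\<in>{1..t}. set_pmf (\<PP> M (k j)))" unfolding k(2)[symmetric] by simp
  finally have "initial_segment (\<Union>j\<in>{1..t}. set_pmf (\<PP> M (k j))) N" using init by simp
  then have PN: "\<PP> N j = \<PP> M (k j)" if "j \<in> {1..t}" for j
    using probability_blockD(4)[OF PB M N k1 k(1) _ that] by blast
  then have lN: "?lN j = ?lM (k j)" if "j \<in> {1..t}" for j using that by (simp add: block_min_def)
  have VN: "V = ?lN ` {1..t}" unfolding V k(2)[symmetric] using lN by (auto simp: image_image)
  have "initial_segment V ?LN"
    unfolding initial_segment_def
  proof (intro conjI ballI impI)
    show "V \<subseteq> ?LN" unfolding VN block_minima_def by auto
    fix a y assume "a \<in> V" "y \<in> ?LN" "y < a"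
    then obtain j h where "j \<in> {1..t}" "1 \<le> h" "a = ?lN j" "y = ?lN h" unfolding VN block_minima_def by auto
    moreover from this \<open>y < a\<close> have "h < j" using block_min_less_iff[OF PB N, of h j] by auto
    ultimately show "y \<in> V" unfolding VN by auto
  qed
  then have QN: "\<QQ> ?LN i = \<QQ> ?LM (r i)"
    unfolding V_def using probability_blockD(4)[OF QB LM LN r _ i] by blast
  have "convolve \<Q> \<QQ> \<PP> N i = bind_pmf (\<QQ> ?LM (r i)) (block_kernel \<PP> N)"
    using convolve_eq_bind_pmf[OF PB N QB, of i] i QN by simp
  also have "\<dots> = bind_pmf (\<QQ> ?LM (r i)) (block_kernel \<PP> M)"
  proof (rule bind_pmf_cong[OF refl])
    fix x assume "x \<in> set_pmf (\<QQ> ?LM (r i))"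
    then have "x \<in> V" using i by (auto simp: V_def)
    then obtain j where j: "j \<in> {1..t}" "x = ?lN j" unfolding VN by blast
    have "block_kernel \<PP> N x = \<PP> N j" using j block_kernel_block_min[OF PB N, of j] by simp
    also have "\<dots> = \<PP> M (k j)" by (rule PN[OF j(1)])
    also have "\<dots> = block_kernel \<PP> M x" using j lN[OF j(1)] block_kernel_block_min[OF PB M k1[OF j(1)]] by simp
    finally show "block_kernel \<PP> N x = block_kernel \<PP> M x" .
  qed
  also have "\<dots> = convolve \<Q> \<QQ> \<PP> M (r i)"
    by (rule convolve_eq_bind_pmf[OF PB M QB r(1)[OF i], symmetric])
  finally show ?thesis .
qed

lemma probability_block_convolve:
  assumes PB: "probability_block \<PP> \<P>" and QB: "probability_block \<QQ> \<Q>"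
  shows "probability_block (convolve \<Q> \<QQ> \<PP>) (composition \<Q> \<P>)"
proof -
  let ?R = "composition \<Q> \<P>" and ?O = "convolve \<Q> \<QQ> \<PP>"
  have R: "nice ?R" by (rule nice_composition[OF probability_blockD(1)[OF PB] probability_blockD(1)[OF QB]])
  have supp: "set_pmf (?O M n) = block ?R M n" if "M \<in> Ipow {1..}" "1 \<le> n" for M n
    by (rule set_pmf_convolve_eq_block[OF PB that(1) QB that(2)])
  show ?thesis
    unfolding probability_block_def
  proof (intro conjI ballI allI impI)
    show "nice ?R" by (rule R)
    fix M :: "nat set" assume M: "M \<in> Ipow {1..}"
    note B = block_partition_block[OF R M]
    show "set_pmf (?O M n) \<subseteq> {1..}" if "1 \<le> n" for n
      unfolding supp[OF M that] by (rule block_partitionD(5)[OF R B that])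
    show "set_pmf (?O M 1) = block ?R M 1" by (rule supp[OF M]) simp
    show "?O (M - (\<Union>i\<in>{1..<r}. set_pmf (?O M i))) 1 = ?O M r" if r: "1 \<le> r" for r
    proof -
      let ?N = "M - (\<Union>i\<in>{1..<r}. block ?R M i)"
      have "(\<Union>i\<in>{1..<r}. set_pmf (?O M i)) = (\<Union>i\<in>{1..<r}. block ?R M i)"
        using supp[OF M] by auto
      moreover have "?O ?N 1 = ?O M r"
      proof (rule convolve_local[OF PB QB M block_tail(1)[OF R M r], of 1 "\<lambda>_. r"])
        show "initial_segment (\<Union>i\<in>{1..1}. set_pmf (?O M r)) ?N"
          using block_partition_initial[OF R B r] supp[OF M r] by (auto simp: initial_segment_def)
      qed (use r in \<open>auto simp: strict_mono_on_def\<close>)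
      ultimately show ?thesis by simp
    qed
  next
    fix M N :: "nat set" and r :: "nat \<Rightarrow> nat" and s i
    assume "M \<in> Ipow {1..}" "N \<in> Ipow {1..}" "i \<in> {1..s}"
      "(\<forall>i\<in>{1..s}. 1 \<le> r i) \<and> strict_mono_on {1..s} r \<and>
        initial_segment (\<Union>i\<in>{1..s}. set_pmf (?O M (r i))) N"
    then show "?O N i = ?O M (r i)"
      by (intro convolve_local[OF PB QB, where s = s and r = r and i = i]) auto
  qed
qed

section \<open>Convolutions of sufficient probability blocks\<close>

lemma prob_bind_pmf_le:
  assumes "\<And>x. x \<in> set_pmf p \<Longrightarrow> x \<notin> X \<Longrightarrow> measure_pmf.prob (f x) E \<le> e" and e: "0 \<le> e"
  shows "measure_pmf.prob (bind_pmf p f) E \<le> measure_pmf.prob p X + e"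
proof -
  have "emeasure (measure_pmf (bind_pmf p f)) E = (\<integral>\<^sup>+x. emeasure (measure_pmf (f x)) E \<partial>measure_pmf p)"
    by (rule emeasure_bind_pmf)
  also have "\<dots> \<le> (\<integral>\<^sup>+x. indicator X x + ennreal e \<partial>measure_pmf p)"
  proof (rule nn_integral_mono_AE, unfold AE_measure_pmf_iff, rule ballI)
    fix x assume x: "x \<in> set_pmf p"
    show "emeasure (measure_pmf (f x)) E \<le> indicator X x + ennreal e"
    proof (cases "x \<in> X")
      case True
      have "emeasure (measure_pmf (f x)) E \<le> 1" by (simp add: measure_pmf.emeasure_le_1)
      then show ?thesis using True by (simp add: add_increasing2)
    next
      case False
      then show ?thesis using assms(1)[OF x] e
        by (simp add: measure_pmf.emeasure_eq_measure ennreal_leI)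
    qed
  qed
  also have "\<dots> = ennreal (measure_pmf.prob p X) + ennreal e"
    by (simp add: nn_integral_add measure_pmf.emeasure_eq_measure)
  also have "\<dots> = ennreal (measure_pmf.prob p X + e)"
    using e by (intro ennreal_plus[symmetric]) auto
  finally have "ennreal (measure_pmf.prob (bind_pmf p f) E) \<le> ennreal (measure_pmf.prob p X + e)"
    by (simp only: measure_pmf.emeasure_eq_measure)
  moreover have "0 \<le> measure_pmf.prob p X + e" using e by simp
  ultimately show ?thesis using ennreal_le_iff by blast
qed

text \<open>Write the rank of \<open>E \<in> \<G>\<close> as \<open>\<omega>\<^sup>\<xi> * r E + \<eta>\<close> with \<open>\<eta> < \<omega>\<^sup>\<xi>\<close>. The continuations of a set \<open>D\<close> that do not
  lower \<open>r\<close> form a family of rank smaller than \<open>\<omega>\<^sup>\<xi>\<close>, which is negligible for \<open>\<PP>\<close>. So \<open>r\<close> drops whenever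
  \<open>E\<close> has mass more than \<open>\<epsilon> / 2\<close> on a block. The minima of such blocks thus carry descending labels
  below \<open>\<omega>\<^sup>\<zeta>\<close>, and the sets with this property are negligible for \<open>\<QQ>\<close>.\<close>

lemma sufficient_convolve_aux:
  assumes suffP: "sufficient \<xi> \<PP> \<P>" and suffQ: "sufficient \<zeta> \<QQ> \<Q>"
    and \<epsilon>: "0 < \<epsilon>" and G: "regular \<G>" "CB \<G> \<le> omega_power (\<xi> + \<zeta>)" and L: "L \<in> Ipow {1..}"
  shows "\<exists>M\<in>Ipow L. \<forall>N\<in>Ipow M. \<forall>E\<in>\<G>. measure_pmf.prob (convolve \<Q> \<QQ> \<PP> N 1) E \<le> \<epsilon>"
proof (cases "\<G> = {}")
  case True
  then show ?thesis using Ipow_refl[OF L] by blast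
next
  case False
  have PB: "probability_block \<PP> \<P>" and QB: "probability_block \<QQ> \<Q>"
    using suffP suffQ by (auto simp: sufficient_def)
  note P = probability_blockD(1)[OF PB] and Q = probability_blockD(1)[OF QB]
  note GD = regularD[OF G(1)]
  have emp: "{} \<in> \<G>" using False hereditaryD[OF GD(2)] by blast
  define \<alpha> where "\<alpha> = omega_power \<xi>"
  have \<alpha>: "1 \<le> \<alpha>" by (simp add: \<alpha>_def omega_power_pos)
  define r where "r E = oquot \<alpha> (cb_rank \<G> E)" for E
  have r_mono: "r E \<le> r D" if "E \<in> \<G>" "D \<subseteq> E" for D E
    unfolding r_def by (rule oquot_mono[OF \<alpha> cb_rank_antimono[OF G(1) that]])
  have "cb_rank \<G> {} < \<alpha> * omega_power \<zeta>"
    using cb_rank_less_CB[OF G(1) emp] G(2) omega_power_plus_le[of \<xi> \<zeta>] unfolding \<alpha>_def by simp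
  then have r0: "r {} < omega_power \<zeta>" unfolding r_def by (rule oquot_less)

  \<comment> \<open>the continuations of \<open>D\<close> that do not lower the quotient of the rank\<close>
  define \<A> where "\<A> D = {F \<in> Fpow {1..}. (\<forall>x\<in>D. \<forall>y\<in>F. x < y) \<and> D \<union> F \<in> \<G> \<and> r (D \<union> F) = r D}" for D
  have ranked_\<A>: "ranked (\<A> D) (\<lambda>F. orem \<alpha> (cb_rank \<G> (D \<union> F)))" for D
    unfolding ranked_def
  proof (intro conjI ballI impI)
    show "\<A> D \<subseteq> Fpow {1..}" by (auto simp: \<A>_def)
    show "hereditary (\<A> D)"
      unfolding hereditary_def
    proof (intro ballI allI impI)
      fix E F assume EF: "E \<in> \<A> D" "F \<subseteq> E"
      then have E: "E \<in> Fpow {1..}" "\<forall>x\<in>D. \<forall>y\<in>E. x < y" "D \<union> E \<in> \<G>" "r (D \<union> E) = r D"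
        by (auto simp: \<A>_def)
      have DF: "D \<union> F \<in> \<G>" using hereditaryD[OF GD(2) E(3), of "D \<union> F"] EF(2) by blast
      have "r (D \<union> E) \<le> r (D \<union> F)" by (rule r_mono[OF E(3)]) (use EF(2) in blast)
      moreover have "r (D \<union> F) \<le> r D" by (rule r_mono[OF DF]) blast
      ultimately have "r (D \<union> F) = r D" using E(4) by simp
      moreover have "F \<in> Fpow {1..}" using E(1) EF(2) by (auto simp: Fpow_def intro: finite_subset)
      moreover have "\<forall>x\<in>D. \<forall>y\<in>F. x < y" using E(2) EF(2) by blast
      ultimately show "F \<in> \<A> D" using DF by (simp add: \<A>_def)
    qed
    fix E F assume EF: "E \<in> \<A> D" "F \<in> \<A> D" "end_ext E F"
    have lt: "\<forall>x\<in>D. \<forall>y\<in>F. x < y" using EF(2) by (simp add: \<A>_def)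
    have "D \<inter> F = {}" using lt by blast
    then have "end_ext (D \<union> E) (D \<union> F)" using EF(3) lt unfolding end_ext_def by blast
    then have "cb_rank \<G> (D \<union> F) < cb_rank \<G> (D \<union> E)"
      using rankedD(3)[OF ranked_cb_rank[OF G(1)]] EF(1,2) by (simp add: \<A>_def)
    moreover have "oquot \<alpha> (cb_rank \<G> (D \<union> F)) = oquot \<alpha> (cb_rank \<G> (D \<union> E))"
      using EF(1,2) by (simp add: \<A>_def r_def)
    ultimately show "orem \<alpha> (cb_rank \<G> (D \<union> F)) < orem \<alpha> (cb_rank \<G> (D \<union> E))"
      by (intro orem_strict_mono)
  qed
  define \<Phi> where "\<Phi> D N \<longleftrightarrow> (\<forall>N'\<in>Ipow N. \<forall>F\<in>\<A> D. measure_pmf.prob (\<PP> N' 1) F \<le> \<epsilon> / 2)" for D N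
  have "\<exists>M\<in>Ipow L. \<Phi> {} M \<and> (\<forall>m\<in>M. \<forall>D. D \<subseteq> {..m} \<longrightarrow> \<Phi> D {n \<in> M. m < n})"
  proof (rule fusion[OF _ _ L])
    show "\<Phi> D N'" if "\<Phi> D N" "N' \<in> Ipow N" for D N N'
      using that(1) Ipow_trans[OF _ that(2)] unfolding \<Phi>_def by simp
    show "\<exists>N'\<in>Ipow N. \<Phi> D N'" if N: "N \<in> Ipow L" for D N
      unfolding \<Phi>_def
      by (rule sufficient_ranked[OF suffP ranked_\<A> _ _ Ipow_trans[OF N L]])
        (use orem_less[OF \<alpha>] \<epsilon> in \<open>simp_all add: \<alpha>_def\<close>)
  qed
  then obtain M where M: "M \<in> Ipow L" "\<Phi> {} M"
      "\<And>m D. m \<in> M \<Longrightarrow> D \<subseteq> {..m} \<Longrightarrow> \<Phi> D {n \<in> M. m < n}" by auto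
  have M1: "M \<in> Ipow {1..}" by (rule Ipow_trans[OF M(1) L])

  \<comment> \<open>contains the values of \<open>r\<close> on the part of a set before a block with minimum \<open>n\<close>\<close>
  define B where "B n = r ` {D \<in> \<G>. D \<subseteq> {..n}}" for n
  define \<H> where "\<H> = descending B (osucc (r {}))"
  have finB: "finite (B n)" for n
    unfolding B_def by (rule finite_imageI, rule finite_subset[of _ "Pow {..n}"]) auto
  have monoB: "B m \<subseteq> B n" if "m \<le> n" for m n using that by (force simp: B_def)
  \<comment> \<open>if \<open>r {} = 0\<close>, then \<open>r\<close> cannot drop, and nothing is required of \<open>\<QQ>\<close>;
    this includes the case \<open>\<zeta> = 0\<close>\<close>
  have "\<exists>M'\<in>Ipow M. \<forall>N\<in>Ipow M'. \<forall>X\<in>\<H>. r {} \<noteq> 0 \<longrightarrow> measure_pmf.prob (\<QQ> N 1) X \<le> \<epsilon> / 2"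
  proof (cases "r {} = 0")
    case True
    then show ?thesis using Ipow_refl[OF M1] by auto
  next
    case False
    then have "\<zeta> \<noteq> 0"
      using r0 antisym[OF _ zero_le_omega1, of "r {}"]
      by (auto simp: omega_power_zero one_omega1_def less_osucc_iff)
    then have "0 < \<zeta>" by (simp add: order_less_le)
    then have "osucc (osucc (r {})) < omega_power \<zeta>"
      using osucc_less_omega_power r0 by blast
    then have "CB \<H> \<le> omega_power \<zeta>"
      using regular_descending(2)[of B, OF finB monoB] unfolding \<H>_def by (meson order_trans less_imp_le)
    moreover have "regular \<H>" unfolding \<H>_def using finB monoB by (rule regular_descending(1))
    ultimately have "\<exists>M'\<in>Ipow M. \<forall>N\<in>Ipow M'. \<forall>X\<in>\<H>. measure_pmf.prob (\<QQ> N 1) X \<le> \<epsilon> / 2"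
      using suffQ \<epsilon> M1 unfolding sufficient_def by (meson half_gt_zero)
    then show ?thesis by auto
  qed
  then obtain M' where M': "M' \<in> Ipow M"
      "\<And>N X. N \<in> Ipow M' \<Longrightarrow> X \<in> \<H> \<Longrightarrow> r {} \<noteq> 0 \<Longrightarrow> measure_pmf.prob (\<QQ> N 1) X \<le> \<epsilon> / 2"
    by auto
  have "measure_pmf.prob (convolve \<Q> \<QQ> \<PP> N 1) E \<le> \<epsilon>" if N: "N \<in> Ipow M'" and E: "E \<in> \<G>" for N E
  proof -
    have NM: "N \<in> Ipow M" by (rule Ipow_trans[OF N M'(1)])
    have N1: "N \<in> Ipow {1..}" by (rule Ipow_trans[OF NM M1])
    let ?L = "block_minima \<PP> N" and ?l = "block_min \<PP> N"
    have LN: "?L \<in> Ipow N" and L1: "?L \<in> Ipow {1..}"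
      by (rule block_minima_mem[OF PB N1], rule block_minima_Ipow_atLeast[OF PB N1])
    define X where "X = {x \<in> set_pmf (\<QQ> ?L 1). \<not> measure_pmf.prob (block_kernel \<PP> N x) E \<le> \<epsilon> / 2}"
    define D where "D x = E \<inter> N \<inter> {..<x}" for x
    define F where "F i = E \<inter> set_pmf (\<PP> N i)" for i
    have suppN: "set_pmf (\<PP> N i) \<subseteq> N" if "1 \<le> i" for i
      using set_pmf_probability_block[OF PB N1 that]
        block_partitionD(6)[OF P block_partition_set_pmf[OF PB N1] that] by simp
    have ge_l: "?l i \<le> y" if "y \<in> set_pmf (\<PP> N i)" "1 \<le> i" for y i
      using that finite_set_pmf_block[OF PB N1] by (simp add: block_min_def)
    have finE: "finite E" "E \<subseteq> {1..}" using E GD(1) by (auto simp: Fpow_def)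
    have DG: "D x \<union> F i \<in> \<G>" "D x \<in> \<G>" for x i
      by (rule hereditaryD[OF GD(2) E], auto simp: D_def F_def)+
    \<comment> \<open>a set that is heavy on the block starting at \<open>l\<^sub>i\<close> loses rank there\<close>
    have heavy: "r (D (?l i) \<union> F i) < r (D (?l i))"
      if i: "1 \<le> i" and hv: "\<not> measure_pmf.prob (\<PP> N i) E \<le> \<epsilon> / 2" for i
    proof -
      let ?x = "?l i"
      let ?N = "N - (\<Union>j\<in>{1..<i}. block \<P> N j)"
      have tail: "?N \<in> Ipow {1..}" by (rule block_tail(1)[OF P N1 i])
      have ge: "?x \<le> y" if y: "y \<in> ?N" for y
      proof -
        obtain j where j: "i \<le> j" "1 \<le> j" "y \<in> block \<P> N j"
          using y unfolding block_partition_tail[OF P block_partition_set_pmf[OF PB N1]] by auto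
        then have "?l j \<le> y" using ge_l[of y j] set_pmf_probability_block[OF PB N1 j(2)] by simp
        moreover have "?l i \<le> ?l j" using block_min_less[OF PB N1 i, of j] j(1) by (cases "i = j") auto
        ultimately show ?thesis by simp
      qed
      have eq: "(\<Union>j\<in>{1..<i}. set_pmf (\<PP> N j)) = (\<Union>j\<in>{1..<i}. block \<P> N j)"
        using set_pmf_probability_block[OF PB N1] by auto
      have PN: "\<PP> ?N 1 = \<PP> N i" using probability_blockD(2)[OF PB N1 i] unfolding eq .
      have small: "measure_pmf.prob (\<PP> N i) A \<le> \<epsilon> / 2" if A: "A \<in> \<A> (D ?x)" for A
      proof (cases "D ?x = {}")
        case True
        have "?N \<in> Ipow M" using tail NM by (auto simp: Ipow_def)
        then have "measure_pmf.prob (\<PP> ?N 1) A \<le> \<epsilon> / 2" using M(2) A True by (simp add: \<Phi>_def)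
        then show ?thesis by (simp only: PN)
      next
        case False
        let ?m = "Max (D ?x)"
        have finD: "finite (D ?x)" using finE by (simp add: D_def)
        have m: "?m \<in> D ?x" by (rule Max_in[OF finD False])
        then have "?m \<in> M" "?m < ?x" using NM by (auto simp: D_def Ipow_def)
        moreover have "D ?x \<subseteq> {..?m}" using finD by auto
        ultimately have \<Phi>: "\<Phi> (D ?x) {n \<in> M. ?m < n}" using M(3) by blast
        have "?N \<subseteq> {n \<in> M. ?m < n}" using ge \<open>?m < ?x\<close> NM by (fastforce simp: Ipow_def)
        then have "?N \<in> Ipow {n \<in> M. ?m < n}" using tail by (simp add: Ipow_def)
        then have "measure_pmf.prob (\<PP> ?N 1) A \<le> \<epsilon> / 2" using \<Phi> A unfolding \<Phi>_def by blast
        then show ?thesis by (simp only: PN)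
      qed
      have "measure_pmf.prob (\<PP> N i) (F i) = measure_pmf.prob (\<PP> N i) E"
        unfolding F_def by (simp add: measure_Int_set_pmf)
      then have notA: "F i \<notin> \<A> (D ?x)" using small hv by metis
      have "r (D ?x \<union> F i) \<noteq> r (D ?x)"
      proof
        assume "r (D ?x \<union> F i) = r (D ?x)"
        moreover have "F i \<in> Fpow {1..}" using finE by (auto simp: F_def Fpow_def)
        moreover have "\<forall>x\<in>D ?x. \<forall>y\<in>F i. x < y"
          using ge_l[OF _ i] by (fastforce simp: D_def F_def)
        ultimately show False using notA DG by (simp add: \<A>_def)
      qed
      moreover have "r (D ?x \<union> F i) \<le> r (D ?x)" by (rule r_mono[OF DG(1)]) simp
      ultimately show ?thesis by simp
    qed
    have Xl: "\<exists>i. 1 \<le> i \<and> x = ?l i \<and> \<not> measure_pmf.prob (\<PP> N i) E \<le> \<epsilon> / 2" if x: "x \<in> X" for x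
    proof -
      have "x \<in> ?L"
        using x block_partitionD(6)[OF Q block_partition_set_pmf[OF QB L1], of 1]
          set_pmf_probability_block[OF QB L1, of 1] by (auto simp: X_def)
      then obtain i where i: "1 \<le> i" "x = ?l i" by (auto simp: block_minima_def)
      then show ?thesis using x block_kernel_block_min[OF PB N1 i(1)] by (auto simp: X_def)
    qed
    have "X \<in> \<H>"
    proof -
      have "X \<subseteq> {1..}"
        using block_partitionD(5)[OF Q block_partition_set_pmf[OF QB L1], of 1]
          set_pmf_probability_block[OF QB L1, of 1] by (auto simp: X_def)
      moreover have "finite X"
        using finite_set_pmf_block[OF QB L1, of 1] by (simp add: X_def)
      moreover have "r (D n) \<in> B n" for n using DG(2)[of n] by (auto simp: B_def D_def)
      moreover have "r (D n) < osucc (r {})" for n using r_mono[OF DG(2)] by (simp add: less_osucc_iff)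
      moreover have "r (D n) < r (D m)" if mn: "m \<in> X" "n \<in> X" "m < n" for m n
      proof -
        obtain i where i: "1 \<le> i" "m = ?l i" "\<not> measure_pmf.prob (\<PP> N i) E \<le> \<epsilon> / 2" using Xl[OF mn(1)] by blast
        obtain j where j: "1 \<le> j" "n = ?l j" using Xl[OF mn(2)] by blast
        have "i < j" using block_min_less_iff[OF PB N1 i(1) j(1)] mn(3) i(2) j(2) by simp
        have "F i \<subseteq> D n"
        proof
          fix y assume y: "y \<in> F i"
          have "y < n" using y set_pmf_less[OF PB N1 i(1) \<open>i < j\<close> _ block_min_mem[OF PB N1 j(1)]] j(2)
            by (simp add: F_def)
          then show "y \<in> D n" using y suppN[OF i(1)] by (auto simp: F_def D_def)
        qed
        moreover have "D m \<subseteq> D n" using mn(3) by (auto simp: D_def)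
        ultimately have "r (D n) \<le> r (D m \<union> F i)" by (intro r_mono[OF DG(2)]) simp
        also have "\<dots> < r (D m)" using heavy[OF i(1,3)] i(2) by simp
        finally show ?thesis .
      qed
      ultimately show ?thesis
        unfolding \<H>_def descending_def Fpow_def by (intro CollectI conjI exI[of _ "\<lambda>n. r (D n)"]) simp_all
    qed
    have "measure_pmf.prob (\<QQ> ?L 1) X \<le> \<epsilon> / 2"
    proof (cases "r {} = 0")
      case True
      have "X = {}"
      proof (rule equals0I)
        fix x assume "x \<in> X"
        then obtain i where "1 \<le> i" "\<not> measure_pmf.prob (\<PP> N i) E \<le> \<epsilon> / 2" using Xl by blast
        then have "r (D (?l i) \<union> F i) < r (D (?l i))" by (rule heavy)
        moreover have "r (D (?l i)) \<le> r {}" by (rule r_mono[OF DG(2)]) simp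
        ultimately show False using True not_less_zero_omega1 less_le_trans by metis
      qed
      then show ?thesis using \<epsilon> by simp
    next
      case False
      then show ?thesis using M'(2)[OF Ipow_trans[OF LN N] \<open>X \<in> \<H>\<close>] by simp
    qed
    moreover have "measure_pmf.prob (convolve \<Q> \<QQ> \<PP> N 1) E \<le> measure_pmf.prob (\<QQ> ?L 1) X + \<epsilon> / 2"
      unfolding convolve_eq_bind_pmf[OF PB N1 QB order_refl]
      by (rule prob_bind_pmf_le) (use \<epsilon> in \<open>auto simp: X_def\<close>)
    ultimately show ?thesis by simp
  qed
  then show ?thesis by (intro bexI[OF _ Ipow_trans[OF M'(1) M(1)]] ballI)
qed

theorem sufficient_convolve:
  assumes "sufficient \<xi> \<PP> \<P>" "sufficient \<zeta> \<QQ> \<Q>"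
  shows "sufficient (\<xi> + \<zeta>) (convolve \<Q> \<QQ> \<PP>) (compose_families \<Q> \<P>)"
proof -
  have PB: "probability_block \<PP> \<P>" and QB: "probability_block \<QQ> \<Q>"
    using assms by (auto simp: sufficient_def)
  note P = probability_blockD(1)[OF PB] and Q = probability_blockD(1)[OF QB]
  have "compose_families \<Q> \<P> = composition \<Q> \<P>"
    by (rule compose_families_eq_composition[OF empty_mem_nice[OF Q] niceD(2)[OF P]])
  then show ?thesis
    unfolding sufficient_def
    using probability_block_convolve[OF PB QB] sufficient_convolve_aux[OF assms] by simp
qed

theorem theorem1p3:
  shows "(\<forall>s \<xi> \<PP> \<P>. admissible s \<and> probability_block \<PP> \<P> \<and> sufficient \<xi> \<PP> \<P> \<longrightarrow>
            regulatory s \<xi> \<PP> \<P>) \<and>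
         (\<forall>\<xi> \<zeta> \<PP> \<P> \<QQ> \<Q>.
            probability_block \<PP> \<P> \<and> sufficient \<xi> \<PP> \<P> \<and>
            probability_block \<QQ> \<Q> \<and> sufficient \<zeta> \<QQ> \<Q> \<longrightarrow>
            sufficient (\<xi> + \<zeta>) (convolve \<Q> \<QQ> \<PP>) (compose_families \<Q> \<P>))"
  using regulatory_if_sufficient sufficient_convolve by blast

end
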